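(* Consider the forward complete differential inclusion $\dot x(t)\in F(x(t))$ on $\mathbb{R}^n$, where $F$ is a locally Lipschitz set-valued map with nonempty compact values, with locally Lipschitz output maps $h:\mathbb{R}^n\to\mathbb{R}^{p_y}$ and $g:\mathbb{R}^n\to\mathbb{R}^{p_w}$ and continuous proper map $\omega:\mathbb{R}^n\to\mathbb{R}_{\ge 0}$. If the system is measurement to error stable (MES), then it satisfies the stability in three measures (SIT) property, i.e. it satisfies SIT with some gain $\rho\in\mathcal{K}$.
   Context: Setting. $F$ maps points of $\mathbb{R}^n$ to nonempty compact subsets of $\mathbb{R}^n$. $F$ is locally Lipschitz: every $\xi\in\mathbb{R}^n$ has a neighbourhood $U$ and $L>0$ with $F(\eta)\subseteq F(\zeta)+L|\eta-\zeta|\mathcal{B}$ for all $\eta,\zeta\in U$, where $\mathcal{B}$ is the closed Euclidean unit ball and $|\cdot|$ is the Euclidean norm. A solution of $\dot x\in F(x)$ on $[0,T)$, $0<T\le\infty$, is a function $x:[0,T)\to\mathbb{R}^n$, absolutely continuous on compact subintervals, with $\dot x(t)\in F(x(t))$ for almost every $t$. It is maximal if it has no extension to a solution on $[0,T_+)$ with $T_+>T$. Forward completeness means that every maximal solution is defined for all $t\ge0$. $\mathbf{S}$ is the set of all maximal solutions. Write $|\xi|_\omega:=\omega(\xi)$, $y(t):=h(x(t))$, $w(t):=g(x(t))$, and $\|w\|_{[a,b]}:=\sup_{s\in[a,b]}|w(s)|$. Comparison functions. $\gamma:\mathbb{R}_{\ge0}\to\mathbb{R}_{\ge0}$ is of class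 $\mathcal{K}$ if it is continuous, strictly increasing, zero at $0$ and positive elsewhere. $\beta:\mathbb{R}_{\ge0}\times\mathbb{R}_{\ge0}\to\mathbb{R}_{\ge0}$ is of class $\mathcal{KL}$ if $\beta(\cdot,t)\in\mathcal{K}$ for each fixed $t\ge 0$ and, for each fixed $s\ge 0$, $\beta(s,t)$ decreases (is nonincreasing) to $0$ as $t\to\infty$. MES: there exist $\beta\in\mathcal{KL}$ and $\gamma\in\mathcal{K}$ such that $|y(t)|\le\max\{\beta(|x(0)|_\omega,t),\gamma(\|w\|_{[0,t]})\}$ for each $x(\cdot)\in\mathbf{S}$ and all $t\ge0$. SIT with gain $\rho\in\mathcal{K}$: there exists $\beta\in\mathcal{KL}$ such that for every $x(\cdot)\in\mathbf{S}$ and every $t_1>0$ with $|y(t)|>\rho(|w(t)|)$ for all $t\in[0,t_1]$, one has $|y(t)|\le\beta(|x(0)|_\omega,t)$ for all $t\in[0,t_1]$. *)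

theory Defs
  imports "HOL-Analysis.Analysis"
begin

(* Functions on the nonnegative reals are represented by functions on all reals, of which
   only the values at nonnegative arguments matter. *)

definition class_K :: "(real \<Rightarrow> real) \<Rightarrow> bool" where
  "class_K \<gamma> \<longleftrightarrow>
     continuous_on {0..} \<gamma> \<and> strict_mono_on {0..} \<gamma> \<and> \<gamma> 0 = 0 \<and> (\<forall>s>0. \<gamma> s > 0)"

definition class_KL :: "(real \<Rightarrow> real \<Rightarrow> real) \<Rightarrow> bool" where
  "class_KL \<beta> \<longleftrightarrow>
     (\<forall>t\<ge>0. class_K (\<lambda>s. \<beta> s t)) \<and>
     (\<forall>s\<ge>0. antimono_on {0..} (\<beta> s) \<and> (\<beta> s \<longlongrightarrow> 0) at_top)"

definition locally_lipschitz ::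
    "('a::metric_space \<Rightarrow> 'b::metric_space) \<Rightarrow> bool" where
  "locally_lipschitz f \<longleftrightarrow> (\<forall>\<xi>. \<exists>U L. open U \<and> \<xi> \<in> U \<and> L-lipschitz_on U f)"

definition locally_lipschitz_setvalued ::
    "('a::real_normed_vector \<Rightarrow> 'b::real_normed_vector set) \<Rightarrow> bool" where
  "locally_lipschitz_setvalued F \<longleftrightarrow>
     (\<forall>\<xi>. \<exists>U L. open U \<and> \<xi> \<in> U \<and> L > 0 \<and>
        (\<forall>\<eta>\<in>U. \<forall>\<zeta>\<in>U. F \<eta> \<subseteq> {v + (L * norm (\<eta> - \<zeta>)) *\<^sub>R b | v b. v \<in> F \<zeta> \<and> b \<in> cball 0 1}))"

(* The finite families of non-overlapping subintervals [u, v] of [a, b] are given as sets of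
   pairs (u, v); degenerate intervals contribute nothing to either sum. *)
definition abs_continuous_on_interval ::
    "real \<Rightarrow> real \<Rightarrow> (real \<Rightarrow> 'a::real_normed_vector) \<Rightarrow> bool" where
  "abs_continuous_on_interval a b f \<longleftrightarrow>
     (\<forall>\<epsilon>>0. \<exists>\<delta>>0. \<forall>I :: (real \<times> real) set.
        finite I \<longrightarrow>
        (\<forall>(u, v)\<in>I. a \<le> u \<and> u \<le> v \<and> v \<le> b) \<longrightarrow>
        pairwise (\<lambda>p q. disjnt {fst p<..<snd p} {fst q<..<snd q}) I \<longrightarrow>
        (\<Sum>(u, v)\<in>I. v - u) < \<delta> \<longrightarrow>
        (\<Sum>(u, v)\<in>I. norm (f v - f u)) < \<epsilon>)"

(* A solution on [0, T), where T may be infinite, is represented by a function on all reals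
   whose values outside [0, T) are irrelevant. *)
definition is_solution ::
    "('a::euclidean_space \<Rightarrow> 'a set) \<Rightarrow> ereal \<Rightarrow> (real \<Rightarrow> 'a) \<Rightarrow> bool" where
  "is_solution F T x \<longleftrightarrow>
     0 < T \<and>
     (\<forall>a b. 0 \<le> a \<longrightarrow> a \<le> b \<longrightarrow> ereal b < T \<longrightarrow> abs_continuous_on_interval a b x) \<and>
     (AE t in lebesgue. 0 \<le> t \<longrightarrow> ereal t < T \<longrightarrow>
        (\<exists>v\<in>F (x t). (x has_vector_derivative v) (at t within {s. 0 \<le> s \<and> ereal s < T})))"

definition maximal_solutions ::
    "('a::euclidean_space \<Rightarrow> 'a set) \<Rightarrow> (ereal \<times> (real \<Rightarrow> 'a)) set" where
  "maximal_solutions F =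
     {(T, x). is_solution F T x \<and>
        \<not> (\<exists>T' x'. T < T' \<and> is_solution F T' x' \<and>
              (\<forall>t. 0 \<le> t \<and> ereal t < T \<longrightarrow> x' t = x t))}"

definition forward_complete :: "('a::euclidean_space \<Rightarrow> 'a set) \<Rightarrow> bool" where
  "forward_complete F \<longleftrightarrow> (\<forall>(T, x)\<in>maximal_solutions F. T = \<infinity>)"

(* In the two stability properties times are restricted to the domain [0, T) of the solution;
   this is no restriction when F is forward complete. *)

definition MES ::
    "('a::euclidean_space \<Rightarrow> 'a set) \<Rightarrow> ('a \<Rightarrow> 'b::real_normed_vector) \<Rightarrow>
     ('a \<Rightarrow> 'c::real_normed_vector) \<Rightarrow> ('a \<Rightarrow> real) \<Rightarrow> bool" where
  "MES F h g \<omega> \<longleftrightarrow>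
     (\<exists>\<beta> \<gamma>. class_KL \<beta> \<and> class_K \<gamma> \<and>
        (\<forall>(T, x)\<in>maximal_solutions F. \<forall>t. 0 \<le> t \<longrightarrow> ereal t < T \<longrightarrow>
           norm (h (x t)) \<le> max (\<beta> (\<omega> (x 0)) t) (\<gamma> (SUP s\<in>{0..t}. norm (g (x s))))))"

definition SIT ::
    "('a::euclidean_space \<Rightarrow> 'a set) \<Rightarrow> ('a \<Rightarrow> 'b::real_normed_vector) \<Rightarrow>
     ('a \<Rightarrow> 'c::real_normed_vector) \<Rightarrow> ('a \<Rightarrow> real) \<Rightarrow> (real \<Rightarrow> real) \<Rightarrow> bool" where
  "SIT F h g \<omega> \<rho> \<longleftrightarrow>
     (\<exists>\<beta>. class_KL \<beta> \<and>
        (\<forall>(T, x)\<in>maximal_solutions F. \<forall>t\<^sub>1>0. ereal t\<^sub>1 < T \<longrightarrow>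
           (\<forall>t\<in>{0..t\<^sub>1}. norm (h (x t)) > \<rho> (norm (g (x t)))) \<longrightarrow>
           (\<forall>t\<in>{0..t\<^sub>1}. norm (h (x t)) \<le> \<beta> (\<omega> (x 0)) t)))"

end

theory Submission
  imports Defs
begin

text \<open>
  With \<open>\<rho> = 2 \<gamma>\<close>, along a trajectory with \<open>\<bar>y\<bar> > \<rho>(\<bar>w\<bar>)\<close> the gain term
  in MES is at most half of the supremum of \<open>\<bar>y\<bar>\<close>. Hence \<open>\<bar>y\<bar>\<close> stays below
  \<open>\<beta>(\<omega>(x(0)), 0)\<close>, and every restart of the MES estimate at a later time halves the bound.
  For the decay to be uniform, \<open>\<omega>\<close> must be bounded at the restart times, uniformly over the
  trajectories from a sublevel set of \<open>\<omega>\<close>.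

  So the point is that forward completeness makes reachable sets of compact sets bounded in finite
  time, although the values of \<open>F\<close> need not be convex and limits of solutions need not be
  solutions. The proof works with polygonal approximate solutions. If those from near \<open>\<xi>\<close> are
  unbounded in time \<open>T\<close>, then compactness yields points and times at which the same holds for a
  shorter and shorter remaining time, and these points tend to infinity. The approximate solutions
  that connect them are joined by correcting, at each step, the earlier part backwards in time, by
  an amount that can be made small in the sup norm of the velocity. The corrected functions
  converge to an exact solution that escapes in finite time, which is excluded.
\<close>

section \<open>Polygonal approximate solutions\<close>

text \<open>The detour through polygonal curves avoids measurable selections: a tolerance can be
  lowered at will (\<open>polygonal_sol_refine\<close>), the price being a displacement controlled
  by the old tolerance times \<open>exp (L * t)\<close>, with \<open>L\<close> taken on a ball
  around the curve. That factor may grow without bound along an escaping chain of curves. Hence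
  every tolerance is fixed only after a bound for the curve that will carry it is known, and so
  small that the next correction alters values and velocities by at most \<open>(1/2)^n\<close>.
  Summability of these alterations replaces weak compactness, which would place the limit velocity
  only in the closed convex hull of the values of \<open>F\<close>.

  The bound obtained this way concerns polygonal curves. It reaches exact solutions by the opposite
  approximation, \<open>polygonal_sol_shadowing\<close>: for every tolerance there is a polygonal
  curve with the same start that ends within distance 1 of the exact solution.

  The decay of the output is first recorded as a supremum over all trajectories, which is monotone
  but possibly discontinuous in the initial value; \<open>class_KL_majorant\<close> turns it into a
  KL function.\<close>

definition sv_lipschitz_on :: "real \<Rightarrow> 'a::real_normed_vector set \<Rightarrow> ('a \<Rightarrow> 'b::real_normed_vector set) \<Rightarrow> bool" where
  "sv_lipschitz_on L S F \<longleftrightarrow>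
     0 \<le> L \<and> (\<forall>p\<in>S. \<forall>q\<in>S. \<forall>v\<in>F p. \<exists>w\<in>F q. norm (v - w) \<le> L * norm (p - q))"

text \<open>The tolerance is imposed at every point of the segment and not only at its left end, so
  that restriction to a subinterval and time reversal require no new estimate. For
  \<open>d < c\<close> the condition is vacuous.\<close>

definition segment_sol ::
    "('a::real_normed_vector \<Rightarrow> 'a set) \<Rightarrow> real \<Rightarrow> real \<Rightarrow> real \<Rightarrow> (real \<Rightarrow> 'a) \<Rightarrow> bool" where
  "segment_sol F \<epsilon> c d x \<longleftrightarrow>
     (\<exists>w. \<forall>s\<in>{c..d}. x s = x c + (s - c) *\<^sub>R w \<and> (\<exists>u\<in>F (x s). norm (w - u) \<le> \<epsilon>))"

text \<open>By compactness such a function is affine on finitely many pieces; the local form makes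
  restriction, concatenation and time reversal immediate.\<close>

definition polygonal_sol ::
    "('a::real_normed_vector \<Rightarrow> 'a set) \<Rightarrow> real \<Rightarrow> real \<Rightarrow> real \<Rightarrow> (real \<Rightarrow> 'a) \<Rightarrow> bool" where
  "polygonal_sol F \<epsilon> a b x \<longleftrightarrow>
     (\<forall>t\<in>{a..b}. \<exists>\<delta>>0.
        (\<forall>c. a \<le> c \<longrightarrow> t - \<delta> < c \<longrightarrow> c \<le> t \<longrightarrow> segment_sol F \<epsilon> c t x) \<and>
        (\<forall>d. t \<le> d \<longrightarrow> d < t + \<delta> \<longrightarrow> d \<le> b \<longrightarrow> segment_sol F \<epsilon> t d x))"

lemma segment_solI:
  assumes "\<And>s. c \<le> s \<Longrightarrow> s \<le> d \<Longrightarrow> x s = x c + (s - c) *\<^sub>R w"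
    and "\<And>s. c \<le> s \<Longrightarrow> s \<le> d \<Longrightarrow> \<exists>u\<in>F (x s). norm (w - u) \<le> \<epsilon>"
  shows "segment_sol F \<epsilon> c d x"
  unfolding segment_sol_def using assms by (metis atLeastAtMost_iff)

lemma segment_solE:
  assumes "segment_sol F \<epsilon> c d x"
  obtains w where "\<And>s. c \<le> s \<Longrightarrow> s \<le> d \<Longrightarrow> x s = x c + (s - c) *\<^sub>R w"
    and "\<And>s. c \<le> s \<Longrightarrow> s \<le> d \<Longrightarrow> \<exists>u\<in>F (x s). norm (w - u) \<le> \<epsilon>"
  using assms unfolding segment_sol_def by (metis atLeastAtMost_iff)

lemma segment_sol_subinterval:
  assumes "segment_sol F \<epsilon> c d x" "c \<le> c'" "d' \<le> d"
  shows "segment_sol F \<epsilon> c' d' x"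
proof -
  from assms(1) obtain w where w: "\<And>s. c \<le> s \<Longrightarrow> s \<le> d \<Longrightarrow> x s = x c + (s - c) *\<^sub>R w"
    "\<And>s. c \<le> s \<Longrightarrow> s \<le> d \<Longrightarrow> \<exists>u\<in>F (x s). norm (w - u) \<le> \<epsilon>"
    by (metis segment_solE)
  show ?thesis
  proof (rule segment_solI)
    fix s assume s: "c' \<le> s" "s \<le> d'"
    have "x s = x c + (s - c) *\<^sub>R w" "x c' = x c + (c' - c) *\<^sub>R w"
      using w(1)[of s] w(1)[of c'] s assms(2,3) by simp_all
    moreover have "(s - c) *\<^sub>R w = (c' - c) *\<^sub>R w + (s - c') *\<^sub>R w"
      by (simp flip: scaleR_add_left)
    ultimately show "x s = x c' + (s - c') *\<^sub>R w" by simp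
    show "\<exists>u\<in>F (x s). norm (w - u) \<le> \<epsilon>" using w(2)[of s] s assms(2,3) by simp
  qed
qed

lemma segment_sol_cong:
  assumes "segment_sol F \<epsilon> c d x" "\<And>s. c \<le> s \<Longrightarrow> s \<le> d \<Longrightarrow> x s = y s"
  shows "segment_sol F \<epsilon> c d y"
proof -
  from assms(1) obtain w where w: "\<And>s. c \<le> s \<Longrightarrow> s \<le> d \<Longrightarrow> x s = x c + (s - c) *\<^sub>R w"
    "\<And>s. c \<le> s \<Longrightarrow> s \<le> d \<Longrightarrow> \<exists>u\<in>F (x s). norm (w - u) \<le> \<epsilon>"
    by (metis segment_solE)
  show ?thesis
  proof (rule segment_solI)
    fix s assume s: "c \<le> s" "s \<le> d"
    then have "y s = x s" "y c = x c" using assms(2)[of s] assms(2)[of c] by simp_all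
    then show "y s = y c + (s - c) *\<^sub>R w" "\<exists>u\<in>F (y s). norm (w - u) \<le> \<epsilon>"
      using w(1)[OF s] w(2)[OF s] by simp_all
  qed
qed

lemma segment_sol_mono:
  assumes "segment_sol F \<epsilon> c d x" "\<epsilon> \<le> \<epsilon>'"
  shows "segment_sol F \<epsilon>' c d x"
  using assms unfolding segment_sol_def by (meson order_trans)

lemma polygonal_solE:
  assumes "polygonal_sol F \<epsilon> a b x" "a \<le> t" "t \<le> b"
  obtains \<delta> where "\<delta> > 0"
    "\<And>c. a \<le> c \<Longrightarrow> t - \<delta> < c \<Longrightarrow> c \<le> t \<Longrightarrow> segment_sol F \<epsilon> c t x"
    "\<And>d. t \<le> d \<Longrightarrow> d < t + \<delta> \<Longrightarrow> d \<le> b \<Longrightarrow> segment_sol F \<epsilon> t d x"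
proof -
  have "t \<in> {a..b}" using assms by simp
  then show ?thesis
    using assms(1) that unfolding polygonal_sol_def by blast
qed

lemma polygonal_solI:
  assumes "\<And>t. a \<le> t \<Longrightarrow> t \<le> b \<Longrightarrow> \<exists>\<delta>>0.
      (\<forall>c. a \<le> c \<longrightarrow> t - \<delta> < c \<longrightarrow> c \<le> t \<longrightarrow> segment_sol F \<epsilon> c t x) \<and>
      (\<forall>d. t \<le> d \<longrightarrow> d < t + \<delta> \<longrightarrow> d \<le> b \<longrightarrow> segment_sol F \<epsilon> t d x)"
  shows "polygonal_sol F \<epsilon> a b x"
  using assms unfolding polygonal_sol_def by simp

text \<open>The definition is local, so whatever maps segments to segments maps polygonal solutions
  to polygonal solutions. Monotonicity in the tolerance, restriction and congruence are
  instances.\<close>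

lemma polygonal_sol_transfer:
  assumes sol: "polygonal_sol F \<epsilon> a b x" and "a \<le> a'" "b' \<le> b"
    and seg: "\<And>c d. a' \<le> c \<Longrightarrow> d \<le> b' \<Longrightarrow> segment_sol F \<epsilon> c d x \<Longrightarrow> segment_sol G \<epsilon>' c d y"
  shows "polygonal_sol G \<epsilon>' a' b' y"
proof (rule polygonal_solI)
  fix t assume t: "a' \<le> t" "t \<le> b'"
  then have *: "a \<le> t" "t \<le> b" using assms(2,3) by auto
  obtain \<delta> where \<delta>: "\<delta> > 0"
    "\<And>c. a \<le> c \<Longrightarrow> t - \<delta> < c \<Longrightarrow> c \<le> t \<Longrightarrow> segment_sol F \<epsilon> c t x"
    "\<And>d. t \<le> d \<Longrightarrow> d < t + \<delta> \<Longrightarrow> d \<le> b \<Longrightarrow> segment_sol F \<epsilon> t d x"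
    using sol * by (metis polygonal_solE)
  show "\<exists>\<delta>>0.
      (\<forall>c. a' \<le> c \<longrightarrow> t - \<delta> < c \<longrightarrow> c \<le> t \<longrightarrow> segment_sol G \<epsilon>' c t y) \<and>
      (\<forall>d. t \<le> d \<longrightarrow> d < t + \<delta> \<longrightarrow> d \<le> b' \<longrightarrow> segment_sol G \<epsilon>' t d y)"
    using assms(2,3) t \<delta>(1) by (intro exI[of _ \<delta>] conjI allI impI) (simp_all add: seg \<delta>)
qed

lemma polygonal_sol_mono:
  assumes "polygonal_sol F \<epsilon> a b x" "\<epsilon> \<le> \<epsilon>'"
  shows "polygonal_sol F \<epsilon>' a b x"
  by (rule polygonal_sol_transfer[OF assms(1)]) (auto intro: segment_sol_mono[OF _ assms(2)])

lemma polygonal_sol_subinterval: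
  assumes "polygonal_sol F \<epsilon> a b x" "a \<le> a'" "b' \<le> b"
  shows "polygonal_sol F \<epsilon> a' b' x"
  by (rule polygonal_sol_transfer[OF assms])

lemma polygonal_sol_cong:
  assumes "polygonal_sol F \<epsilon> a b x" "\<And>s. a \<le> s \<Longrightarrow> s \<le> b \<Longrightarrow> x s = y s"
  shows "polygonal_sol F \<epsilon> a b y"
  by (rule polygonal_sol_transfer[OF assms(1) order_refl order_refl])
    (auto intro!: segment_sol_cong[of _ _ _ _ x] assms(2))

lemma segment_sol_imp_polygonal_sol:
  assumes "segment_sol F \<epsilon> a b x"
  shows "polygonal_sol F \<epsilon> a b x"
  by (rule polygonal_solI) (auto intro!: exI[of _ 1] segment_sol_subinterval[OF assms])

lemma polygonal_sol_join:
  assumes ab: "polygonal_sol F \<epsilon> a b x" and bc: "polygonal_sol F \<epsilon> b c x" and "a \<le> b" "b \<le> c"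
  shows "polygonal_sol F \<epsilon> a c x"
proof (rule polygonal_solI)
  fix t assume t: "a \<le> t" "t \<le> c"
  consider "t < b" | "t = b" | "t > b" by linarith
  then show "\<exists>\<delta>>0.
      (\<forall>c. a \<le> c \<longrightarrow> t - \<delta> < c \<longrightarrow> c \<le> t \<longrightarrow> segment_sol F \<epsilon> c t x) \<and>
      (\<forall>d. t \<le> d \<longrightarrow> d < t + \<delta> \<longrightarrow> d \<le> c \<longrightarrow> segment_sol F \<epsilon> t d x)"
  proof cases
    case 1
    obtain \<delta> where \<delta>: "\<delta> > 0"
      "\<And>c. a \<le> c \<Longrightarrow> t - \<delta> < c \<Longrightarrow> c \<le> t \<Longrightarrow> segment_sol F \<epsilon> c t x"
      "\<And>d. t \<le> d \<Longrightarrow> d < t + \<delta> \<Longrightarrow> d \<le> b \<Longrightarrow> segment_sol F \<epsilon> t d x"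
      using ab t(1) less_imp_le[OF 1] by (metis polygonal_solE)
    show ?thesis using 1 \<delta>(1) by (intro exI[of _ "min \<delta> (b - t)"] conjI allI impI) (auto intro: \<delta>)
  next
    case 2
    obtain \<delta> where \<delta>: "\<delta> > 0"
      "\<And>c. a \<le> c \<Longrightarrow> t - \<delta> < c \<Longrightarrow> c \<le> t \<Longrightarrow> segment_sol F \<epsilon> c t x"
      "\<And>d. t \<le> d \<Longrightarrow> d < t + \<delta> \<Longrightarrow> d \<le> b \<Longrightarrow> segment_sol F \<epsilon> t d x"
      using ab t(1) eq_refl[OF 2] by (metis polygonal_solE)
    obtain \<delta>' where \<delta>': "\<delta>' > 0"
      "\<And>d. t \<le> d \<Longrightarrow> d < t + \<delta>' \<Longrightarrow> d \<le> c \<Longrightarrow> segment_sol F \<epsilon> t d x"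
      using polygonal_solE[OF bc _ t(2)] 2 by auto
    show ?thesis using \<delta>(1) \<delta>'(1) by (intro exI[of _ "min \<delta> \<delta>'"] conjI allI impI) (auto intro: \<delta> \<delta>')
  next
    case 3
    obtain \<delta> where \<delta>: "\<delta> > 0"
      "\<And>c. b \<le> c \<Longrightarrow> t - \<delta> < c \<Longrightarrow> c \<le> t \<Longrightarrow> segment_sol F \<epsilon> c t x"
      "\<And>d. t \<le> d \<Longrightarrow> d < t + \<delta> \<Longrightarrow> d \<le> c \<Longrightarrow> segment_sol F \<epsilon> t d x"
      using bc less_imp_le[OF 3] t(2) by (metis polygonal_solE)
    show ?thesis using 3 \<delta>(1) by (intro exI[of _ "min \<delta> (t - b)"] conjI allI impI) (auto intro: \<delta>)
  qed
qed

lemma polygonal_sol_glue: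
  assumes "polygonal_sol F \<epsilon> a b x" "polygonal_sol F \<epsilon> b c y" "a \<le> b" "b \<le> c" "x b = y b"
  shows "polygonal_sol F \<epsilon> a c (\<lambda>s. if s \<le> b then x s else y s)"
proof (rule polygonal_sol_join)
  show "polygonal_sol F \<epsilon> a b (\<lambda>s. if s \<le> b then x s else y s)"
    by (rule polygonal_sol_cong[OF assms(1)]) auto
  show "polygonal_sol F \<epsilon> b c (\<lambda>s. if s \<le> b then x s else y s)"
    by (rule polygonal_sol_cong[OF assms(2)]) (use assms in auto)
qed (use assms in auto)

lemma polygonal_sol_shift:
  assumes "polygonal_sol F \<epsilon> (a + k) (b + k) x"
  shows "polygonal_sol F \<epsilon> a b (\<lambda>t. x (t + k))"
proof -
  have seg: "segment_sol F \<epsilon> c d (\<lambda>t. x (t + k))" if sol: "segment_sol F \<epsilon> (c + k) (d + k) x" for c d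
  proof -
    from sol obtain w where w: "\<And>s. c + k \<le> s \<Longrightarrow> s \<le> d + k \<Longrightarrow> x s = x (c + k) + (s - (c + k)) *\<^sub>R w"
      "\<And>s. c + k \<le> s \<Longrightarrow> s \<le> d + k \<Longrightarrow> \<exists>u\<in>F (x s). norm (w - u) \<le> \<epsilon>"
      by (metis segment_solE)
    show ?thesis
    proof (rule segment_solI)
      fix s assume "c \<le> s" "s \<le> d"
      then show "x (s + k) = x (c + k) + (s - c) *\<^sub>R w" "\<exists>u\<in>F (x (s + k)). norm (w - u) \<le> \<epsilon>"
        using w(1)[of "s + k"] w(2)[of "s + k"] by simp_all
    qed
  qed
  show ?thesis
  proof (rule polygonal_solI)
    fix t assume "a \<le> t" "t \<le> b"
    then have *: "a + k \<le> t + k" "t + k \<le> b + k" by auto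
    obtain \<delta> where \<delta>: "\<delta> > 0"
      "\<And>c. (a + k) \<le> c \<Longrightarrow> (t + k) - \<delta> < c \<Longrightarrow> c \<le> (t + k) \<Longrightarrow> segment_sol F \<epsilon> c (t + k) x"
      "\<And>d. (t + k) \<le> d \<Longrightarrow> d < (t + k) + \<delta> \<Longrightarrow> d \<le> (b + k) \<Longrightarrow> segment_sol F \<epsilon> (t + k) d x"
      using assms * by (metis polygonal_solE)
    show "\<exists>\<delta>>0. 
        (\<forall>c. a \<le> c \<longrightarrow> t - \<delta> < c \<longrightarrow> c \<le> t \<longrightarrow> segment_sol F \<epsilon> c t (\<lambda>t. x (t + k))) \<and>
        (\<forall>d. t \<le> d \<longrightarrow> d < t + \<delta> \<longrightarrow> d \<le> b \<longrightarrow> segment_sol F \<epsilon> t d (\<lambda>t. x (t + k)))"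
      using \<delta>(1) by (intro exI[of _ \<delta>]) (auto intro!: seg \<delta>)
  qed
qed

lemma polygonal_sol_reverse:
  assumes "polygonal_sol F \<epsilon> a b x"
  shows "polygonal_sol (\<lambda>p. uminus ` F p) \<epsilon> (- b) (- a) (\<lambda>t. x (- t))"
proof -
  have seg: "segment_sol (\<lambda>p. uminus ` F p) \<epsilon> c d (\<lambda>t. x (- t))" if sol: "segment_sol F \<epsilon> (- d) (- c) x" for c d
  proof -
    from sol obtain w where w: "\<And>s. - d \<le> s \<Longrightarrow> s \<le> - c \<Longrightarrow> x s = x (- d) + (s - (- d)) *\<^sub>R w"
      "\<And>s. - d \<le> s \<Longrightarrow> s \<le> - c \<Longrightarrow> \<exists>u\<in>F (x s). norm (w - u) \<le> \<epsilon>"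
      by (metis segment_solE)
    show ?thesis
    proof (rule segment_solI)
      fix s assume s: "c \<le> s" "s \<le> d"
      have "x (- s) = x (- d) + (- s - (- d)) *\<^sub>R w" "x (- c) = x (- d) + (- c - (- d)) *\<^sub>R w"
        using w(1)[of "- s"] w(1)[of "- c"] s by simp_all
      moreover have "(- s - (- d)) *\<^sub>R w = (- c - (- d)) *\<^sub>R w + (s - c) *\<^sub>R (- w)"
        by (simp add: algebra_simps)
      ultimately show "x (- s) = x (- c) + (s - c) *\<^sub>R (- w)" by simp
      obtain u where "u \<in> F (x (- s))" "norm (w - u) \<le> \<epsilon>" using w(2)[of "- s"] s by auto
      then show "\<exists>u\<in>uminus ` F (x (- s)). norm (- w - u) \<le> \<epsilon>"
        by (intro bexI[of _ "- u"]) (auto simp: norm_minus_commute)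
    qed
  qed
  show ?thesis
  proof (rule polygonal_solI)
    fix t assume "- b \<le> t" "t \<le> - a"
    then have *: "a \<le> - t" "- t \<le> b" by auto
    obtain \<delta> where \<delta>: "\<delta> > 0"
      "\<And>c. a \<le> c \<Longrightarrow> (- t) - \<delta> < c \<Longrightarrow> c \<le> (- t) \<Longrightarrow> segment_sol F \<epsilon> c (- t) x"
      "\<And>d. (- t) \<le> d \<Longrightarrow> d < (- t) + \<delta> \<Longrightarrow> d \<le> b \<Longrightarrow> segment_sol F \<epsilon> (- t) d x"
      using assms * by (metis polygonal_solE)
    show "\<exists>\<delta>>0. 
        (\<forall>c. - b \<le> c \<longrightarrow> t - \<delta> < c \<longrightarrow> c \<le> t \<longrightarrow> segment_sol (\<lambda>p. uminus ` F p) \<epsilon> c t (\<lambda>t. x (- t))) \<and>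
        (\<forall>d. t \<le> d \<longrightarrow> d < t + \<delta> \<longrightarrow> d \<le> - a \<longrightarrow> segment_sol (\<lambda>p. uminus ` F p) \<epsilon> t d (\<lambda>t. x (- t)))"
      using \<delta>(1) by (intro exI[of _ \<delta>]) (auto intro!: seg \<delta>)
  qed
qed

text \<open>Bisection (\<open>Bolzano\<close>) stands in for a finite subdivision: a property of
  intervals that survives concatenation has to be checked on affine pieces only, and these may be
  taken shorter than any prescribed \<open>h\<close>.\<close>

lemma polygonal_sol_induct [consumes 3, case_names trans segment]:
  assumes "polygonal_sol F \<epsilon> a b x" "a \<le> b" "0 < h"
    and trans: "\<And>c d e. a \<le> c \<Longrightarrow> c \<le> d \<Longrightarrow> d \<le> e \<Longrightarrow> e \<le> b \<Longrightarrow> Q c d \<Longrightarrow> Q d e \<Longrightarrow> Q c e"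
    and seg: "\<And>c d. a \<le> c \<Longrightarrow> c \<le> d \<Longrightarrow> d \<le> b \<Longrightarrow> d - c < h \<Longrightarrow> segment_sol F \<epsilon> c d x \<Longrightarrow> Q c d"
  shows "Q a b"
proof -
  \<comment> \<open>\<open>Bolzano\<close> also considers intervals that protrude from the given
    one; the guards make the property trivial there.\<close>
  define P where "P c d \<longleftrightarrow> (a \<le> c \<longrightarrow> d \<le> b \<longrightarrow> Q c d)" for c d
  have "P a b" using \<open>a \<le> b\<close>
  proof (induction rule: Bolzano)
    case (trans c d e)
    show ?case
      unfolding P_def
    proof (intro impI)
      assume *: "a \<le> c" "e \<le> b"
      then have "Q c d" "Q d e"
        using trans by (simp_all add: P_def)
      then show "Q c e"
        using assms(4) trans * by blast
    qed
  next
    case (local t)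
    obtain \<delta> where \<delta>: "\<delta> > 0"
      "\<And>c. a \<le> c \<Longrightarrow> t - \<delta> < c \<Longrightarrow> c \<le> t \<Longrightarrow> segment_sol F \<epsilon> c t x"
      "\<And>d. t \<le> d \<Longrightarrow> d < t + \<delta> \<Longrightarrow> d \<le> b \<Longrightarrow> segment_sol F \<epsilon> t d x"
      using assms(1) local by (metis polygonal_solE)
    have "P c d" if "c \<le> t" "t \<le> d" "d - c < min \<delta> h" for c d
      unfolding P_def
    proof (intro impI)
      assume "a \<le> c" "d \<le> b"
      then have "Q c t" "Q t d" 
        using that local by (auto intro!: seg \<delta>)
      then show "Q c d" using that \<open>a \<le> c\<close> \<open>d \<le> b\<close> assms(4)[of c t d] by auto
    qed
    then show ?case using \<delta>(1) \<open>0 < h\<close> by (intro exI[of _ "min \<delta> h"]) auto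
  qed
  then show ?thesis by (simp add: P_def)
qed

section \<open>Error growth and the discrete Filippov theorem\<close>

lemma gronwall_factor_compose:
  fixes e \<epsilon> L :: real
  assumes "0 \<le> e" "0 \<le> \<epsilon>" "0 \<le> L" "0 \<le> t\<^sub>1" "0 \<le> t\<^sub>2"
  shows "((e + \<epsilon> * t\<^sub>1) * exp (L * t\<^sub>1) + \<epsilon> * t\<^sub>2) * exp (L * t\<^sub>2)
    \<le> (e + \<epsilon> * (t\<^sub>1 + t\<^sub>2)) * exp (L * (t\<^sub>1 + t\<^sub>2))"
proof -
  have "\<epsilon> * t\<^sub>2 \<le> (\<epsilon> * t\<^sub>2) * exp (L * t\<^sub>1)"
    using assms by (intro mult_right_le_one_le[of _ "1", simplified] mult_left_mono[of 1 "exp (L * t\<^sub>1)", simplified]) auto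
  then have "(e + \<epsilon> * t\<^sub>1) * exp (L * t\<^sub>1) + \<epsilon> * t\<^sub>2 \<le> (e + \<epsilon> * (t\<^sub>1 + t\<^sub>2)) * exp (L * t\<^sub>1)"
    by (simp add: algebra_simps)
  then have "((e + \<epsilon> * t\<^sub>1) * exp (L * t\<^sub>1) + \<epsilon> * t\<^sub>2) * exp (L * t\<^sub>2)
      \<le> (e + \<epsilon> * (t\<^sub>1 + t\<^sub>2)) * exp (L * t\<^sub>1) * exp (L * t\<^sub>2)"
    by (rule mult_right_mono) simp
  then show ?thesis by (simp add: exp_add ring_distribs mult.assoc)
qed

lemma gronwall_factor_mono:
  fixes e \<epsilon> L :: real
  assumes "0 \<le> e" "0 \<le> \<epsilon>" "0 \<le> L" "0 \<le> t" "t \<le> t'"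
  shows "(e + \<epsilon> * t) * exp (L * t) \<le> (e + \<epsilon> * t') * exp (L * t')"
  using assms by (intro mult_mono add_left_mono) (auto intro!: mult_left_mono add_nonneg_nonneg)

text \<open>The left side is the error after one affine step whose velocity is off by at most
  \<open>\<epsilon> + L * e\<close>; the estimate rests on
  \<open>1 + L * t \<le> exp (L * t)\<close>.\<close>

lemma gronwall_factor_step:
  fixes e \<epsilon> L :: real
  assumes "0 \<le> e" "0 \<le> \<epsilon>" "0 \<le> L" "0 \<le> t"
  shows "e + t * (\<epsilon> + L * e) \<le> (e + \<epsilon> * t) * exp (L * t)"
proof -
  have "e * (1 + L * t) \<le> e * exp (L * t)"
    using assms by (intro mult_left_mono) auto
  moreover have "\<epsilon> * t * 1 \<le> \<epsilon> * t * exp (L * t)"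
    using assms by (intro mult_left_mono) auto
  ultimately show ?thesis by (simp add: algebra_simps)
qed

text \<open>A discrete Filippov theorem: the tolerance \<^term>\<open>\<epsilon>'\<close> of the new
  solution is at our disposal, only its distance to the old one depends on \<^term>\<open>\<epsilon>\<close>.\<close>

lemma polygonal_sol_refine:
  fixes x :: "real \<Rightarrow> 'a::real_normed_vector"
  assumes sol: "polygonal_sol F \<epsilon> a b x" and "a \<le> b"
    and lip: "sv_lipschitz_on L (cball 0 (R + 1)) F"
    and bound: "\<And>p u. p \<in> cball 0 (R + 1) \<Longrightarrow> u \<in> F p \<Longrightarrow> norm u \<le> M"
    and R: "\<And>s. a \<le> s \<Longrightarrow> s \<le> b \<Longrightarrow> norm (x s) \<le> R"
    and "0 \<le> \<epsilon>" "0 < \<epsilon>'" and \<xi>: "norm (\<xi> - x a) \<le> \<delta>"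
    and E: "E = (\<delta> + \<epsilon> * (b - a)) * exp (L * (b - a))" "E \<le> 1"
  shows "\<exists>y. polygonal_sol F \<epsilon>' a b y \<and> y a = \<xi> \<and> (\<forall>s\<in>{a..b}. norm (y s - x s) \<le> E) \<and>
    (\<epsilon> + L * E)-lipschitz_on {a..b} (\<lambda>s. y s - x s)"
proof -
  have L0: "0 \<le> L" using lip unfolding sv_lipschitz_on_def by blast
  define B where "B e t = (e + \<epsilon> * t) * exp (L * t)" for e t
  \<comment> \<open>Over a piece shorter than \<open>h\<close>, a velocity of norm at most
    \<open>M\<close> moves the point so little that the values of \<open>F\<close> drift by at most
    \<open>\<epsilon>'\<close>. \<open>max 0 M\<close> is used because \<open>M\<close> is not
    assumed nonnegative, and \<open>+ 1\<close> because the product may vanish.\<close>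
  define h where "h = \<epsilon>' / (L * max 0 M + 1)"
  have pos: "0 < L * max 0 M + 1" using L0 by (smt (verit) mult_nonneg_nonneg)
  have h: "0 < h" "L * max 0 M * h \<le> \<epsilon>'"
  proof -
    show "0 < h" unfolding h_def using pos \<open>0 < \<epsilon>'\<close> by simp
    have "L * max 0 M * \<epsilon>' \<le> \<epsilon>' * (L * max 0 M + 1)"
      using \<open>0 < \<epsilon>'\<close> by (simp add: algebra_simps)
    then show "L * max 0 M * h \<le> \<epsilon>'"
      unfolding h_def using pos by (simp add: field_simps)
  qed
  \<comment> \<open>Both the start and the error bound \<open>e\<close> are quantified: on a second
    piece the start is the end of the first correction, and \<open>e\<close> is the error
    accumulated so far.\<close>
  define Q where "Q c d \<longleftrightarrow> (\<forall>\<xi> e. norm (\<xi> - x c) \<le> e \<longrightarrow> B e (d - c) \<le> 1 \<longrightarrow>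
     (\<exists>y. polygonal_sol F \<epsilon>' c d y \<and> y c = \<xi> \<and> (\<forall>s\<in>{c..d}. norm (y s - x s) \<le> B e (s - c)) \<and>
          (\<epsilon> + L * B e (d - c))-lipschitz_on {c..d} (\<lambda>s. y s - x s)))" for c d
  have B_mono: "B e t \<le> B e t'" if "0 \<le> e" "0 \<le> t" "t \<le> t'" for e t t'
    unfolding B_def using that \<open>0 \<le> \<epsilon>\<close> L0 by (intro gronwall_factor_mono) auto
  \<comment> \<open>Concatenating two intervals composes their error bounds; this inequality lets
    the induction close with one and the same formula.\<close>
  have B_comp: "B (B e t) t' \<le> B e (t + t')" if "0 \<le> e" "0 \<le> t" "0 \<le> t'" for e t t'
    unfolding B_def using that \<open>0 \<le> \<epsilon>\<close> L0 by (intro gronwall_factor_compose) auto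
  have B_nonneg: "0 \<le> B e t" if "0 \<le> e" "0 \<le> t" for e t
    unfolding B_def using that \<open>0 \<le> \<epsilon>\<close> by simp
  have "Q a b"
    using sol \<open>a \<le> b\<close> \<open>0 < h\<close>
  proof (induction rule: polygonal_sol_induct)
    case (trans c d k)
    show ?case
      unfolding Q_def
    proof (intro allI impI)
      fix \<xi> e assume \<xi>: "norm (\<xi> - x c) \<le> e" and B1: "B e (k - c) \<le> 1"
      have e: "0 \<le> e" using \<xi> norm_ge_zero order_trans by blast
      have *: "B e (d - c) \<le> B e (k - c)" using trans e by (intro B_mono) auto
      then obtain y where y: "polygonal_sol F \<epsilon>' c d y" "y c = \<xi>"
        "\<forall>s\<in>{c..d}. norm (y s - x s) \<le> B e (s - c)"
        "(\<epsilon> + L * B e (d - c))-lipschitz_on {c..d} (\<lambda>s. y s - x s)"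
        using trans(5) \<xi> B1 unfolding Q_def by (blast intro: order_trans)
      define e' where "e' = B e (d - c)"
      have e': "0 \<le> e'" "norm (y d - x d) \<le> e'"
        using y(3) trans B_nonneg e unfolding e'_def by auto
      have comp: "B e' (s - d) \<le> B e (s - c)" if "d \<le> s" for s
        using B_comp[of e "d - c" "s - d"] that trans e unfolding e'_def by simp
      have "B e' (k - d) \<le> 1" using comp[of k] B1 trans by simp
      then obtain z where z: "polygonal_sol F \<epsilon>' d k z" "z d = y d"
        "\<forall>s\<in>{d..k}. norm (z s - x s) \<le> B e' (s - d)"
        "(\<epsilon> + L * B e' (k - d))-lipschitz_on {d..k} (\<lambda>s. z s - x s)"
        using trans(6) e' unfolding Q_def by blast
      let ?w = "\<lambda>s. if s \<le> d then y s else z s"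
      have "polygonal_sol F \<epsilon>' c k ?w"
        by (rule polygonal_sol_glue[OF y(1) z(1)]) (use trans z in auto)
      moreover have "?w c = \<xi>" using trans y by simp
      moreover have "norm (?w s - x s) \<le> B e (s - c)" if "s \<in> {c..k}" for s
        using y(3) z(3) comp[of s] that by (cases "s \<le> d") (auto intro: order_trans)
      moreover have "(\<epsilon> + L * B e (k - c))-lipschitz_on {c..k} (\<lambda>s. ?w s - x s)"
      proof -
        have "(\<epsilon> + L * B e (k - c))-lipschitz_on {c..d} (\<lambda>s. y s - x s)"
          using * L0 by (intro lipschitz_on_mono[OF y(4)]) (auto intro: mult_left_mono)
        moreover have "(\<epsilon> + L * B e (k - c))-lipschitz_on {d..k} (\<lambda>s. z s - x s)"
          using comp[of k] trans L0 by (intro lipschitz_on_mono[OF z(4)]) (auto intro: mult_left_mono)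
        ultimately have "(\<epsilon> + L * B e (k - c))-lipschitz_on {c..k}
            (\<lambda>s. if s \<le> d then y s - x s else z s - x s)"
          using z(2) by (intro lipschitz_on_concat) auto
        then show ?thesis by (rule back_subst[of "lipschitz_on _ _"]) auto
      qed
      ultimately show "\<exists>y. polygonal_sol F \<epsilon>' c k y \<and> y c = \<xi> \<and> (\<forall>s\<in>{c..k}. norm (y s - x s) \<le> B e (s - c)) \<and>
          (\<epsilon> + L * B e (k - c))-lipschitz_on {c..k} (\<lambda>s. y s - x s)"
        by (intro exI[of _ ?w]) blast
    qed
  next
    case (segment c d)
    show ?case
      unfolding Q_def
    proof (intro allI impI)
      fix \<xi> e assume \<xi>: "norm (\<xi> - x c) \<le> e" and B1: "B e (d - c) \<le> 1"
      have e: "0 \<le> e" using \<xi> norm_ge_zero order_trans by blast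
      obtain w where w: "\<And>s. c \<le> s \<Longrightarrow> s \<le> d \<Longrightarrow> x s = x c + (s - c) *\<^sub>R w"
        "\<And>s. c \<le> s \<Longrightarrow> s \<le> d \<Longrightarrow> \<exists>u\<in>F (x s). norm (w - u) \<le> \<epsilon>"
        using segment by (metis segment_solE)
      have step: "e + (s - c) * (\<epsilon> + L * e) \<le> B e (s - c)" if "c \<le> s" for s
        unfolding B_def using that e \<open>0 \<le> \<epsilon>\<close> L0 by (intro gronwall_factor_step) auto
      have eB: "e \<le> B e (d - c)"
      proof -
        have "0 \<le> (d - c) * (\<epsilon> + L * e)" using segment e \<open>0 \<le> \<epsilon>\<close> L0 by simp
        then show ?thesis using step[of d] segment by simp
      qed
      \<comment> \<open>An error of at most 1 keeps the new curve in the ball on which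
        \<open>L\<close> and \<open>M\<close> are valid.\<close>
      have near: "p \<in> cball 0 (R + 1)" if "norm (p - x s) \<le> 1" "c \<le> s" "s \<le> d" for p s
        using that R[of s] segment norm_triangle_sub[of p "x s"] by simp
      have \<xi>1: "\<xi> \<in> cball 0 (R + 1)" using near[of \<xi> c] \<xi> eB B1 segment by simp
      have x1: "x c \<in> cball 0 (R + 1)" using near[of "x c" c] segment by simp
      \<comment> \<open>The new velocity \<open>w'\<close> is picked once, in \<open>F \<xi>\<close>
        at the left end, and kept along the piece. Its distance from \<open>w\<close> controls the
        distance of the two curves; the mesh \<open>h\<close> controls its own tolerance.\<close>
      obtain u where u: "u \<in> F (x c)" "norm (w - u) \<le> \<epsilon>" using w(2)[of c] segment by auto
      obtain w' where w': "w' \<in> F \<xi>" "norm (u - w') \<le> L * norm (x c - \<xi>)"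
        using lip x1 \<xi>1 u unfolding sv_lipschitz_on_def by blast
      have "norm (u - w') \<le> L * e"
        using w'(2) \<xi> L0 by (smt (verit) mult_left_mono norm_minus_commute)
      then have ww: "norm (w' - w) \<le> \<epsilon> + L * e"
        using u(2) norm_triangle_ineq[of "w - u" "u - w'"] by (simp add: norm_minus_commute)
      define y where "y s = \<xi> + (s - c) *\<^sub>R w'" for s
      have yx: "y s - x s = (\<xi> - x c) + (s - c) *\<^sub>R (w' - w)" if "c \<le> s" "s \<le> d" for s
        using w(1)[OF that] unfolding y_def by (simp add: algebra_simps)
      have close: "norm (y s - x s) \<le> B e (s - c)" if s: "c \<le> s" "s \<le> d" for s
      proof -
        have "norm (y s - x s) \<le> norm (\<xi> - x c) + norm ((s - c) *\<^sub>R (w' - w))"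
          unfolding yx[OF s] by (rule norm_triangle_ineq)
        also have "\<dots> \<le> e + (s - c) * (\<epsilon> + L * e)"
          using \<xi> ww s by (intro add_mono) (auto intro: mult_left_mono)
        finally show ?thesis using step[of s] s by linarith
      qed
      have "segment_sol F \<epsilon>' c d y"
      proof (rule segment_solI)
        fix s assume s: "c \<le> s" "s \<le> d"
        show "y s = y c + (s - c) *\<^sub>R w'" unfolding y_def by simp
        have "B e (s - c) \<le> B e (d - c)" using s e by (intro B_mono) auto
        then have "y s \<in> cball 0 (R + 1)" using near[of "y s" s] close[of s] s B1 by linarith
        then obtain u' where u': "u' \<in> F (y s)" "norm (w' - u') \<le> L * norm (\<xi> - y s)"
          using lip \<xi>1 w'(1) unfolding sv_lipschitz_on_def by blast
        have "norm (\<xi> - y s) = (s - c) * norm w'" unfolding y_def using s by simp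
        also have "\<dots> \<le> h * max 0 M"
          using bound[OF \<xi>1 w'(1)] s segment by (intro mult_mono) auto
        finally have "L * norm (\<xi> - y s) \<le> L * (h * max 0 M)" using L0 by (rule mult_left_mono)
        then show "\<exists>u\<in>F (y s). norm (w' - u) \<le> \<epsilon>'"
          using u' h(2) by (intro bexI[of _ u']) (auto simp: mult_ac)
      qed
      then have "polygonal_sol F \<epsilon>' c d y" by (rule segment_sol_imp_polygonal_sol)
      moreover have "y c = \<xi>" unfolding y_def by simp
      moreover have "(\<epsilon> + L * B e (d - c))-lipschitz_on {c..d} (\<lambda>s. y s - x s)"
      proof (rule lipschitz_onI)
        fix s r assume "s \<in> {c..d}" "r \<in> {c..d}"
        then have "(y s - x s) - (y r - x r) = (s - c) *\<^sub>R (w' - w) - (r - c) *\<^sub>R (w' - w)"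
          using yx[of s] yx[of r] by simp
        also have "\<dots> = (s - r) *\<^sub>R (w' - w)"
          by (simp add: scaleR_left_diff_distrib)
        finally have "(y s - x s) - (y r - x r) = (s - r) *\<^sub>R (w' - w)" .
        then have "dist (y s - x s) (y r - x r) = norm (w' - w) * dist s r"
          by (simp add: dist_norm dist_real_def mult.commute)
        also have "\<dots> \<le> (\<epsilon> + L * B e (d - c)) * dist s r"
          using ww mult_left_mono[OF eB L0] by (intro mult_right_mono) auto
        finally show "dist (y s - x s) (y r - x r) \<le> (\<epsilon> + L * B e (d - c)) * dist s r" .
      next
        show "0 \<le> \<epsilon> + L * B e (d - c)" using \<open>0 \<le> \<epsilon>\<close> L0 B_nonneg e segment by simp
      qed
      ultimately show "\<exists>y. polygonal_sol F \<epsilon>' c d y \<and> y c = \<xi> \<and> (\<forall>s\<in>{c..d}. norm (y s - x s) \<le> B e (s - c)) \<and>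
          (\<epsilon> + L * B e (d - c))-lipschitz_on {c..d} (\<lambda>s. y s - x s)"
        using close by (intro exI[of _ y]) auto
    qed
  qed
  then have Qab: "B \<delta> (b - a) \<le> 1 \<Longrightarrow> \<exists>y. polygonal_sol F \<epsilon>' a b y \<and> y a = \<xi> \<and>
      (\<forall>s\<in>{a..b}. norm (y s - x s) \<le> B \<delta> (s - a)) \<and>
      (\<epsilon> + L * B \<delta> (b - a))-lipschitz_on {a..b} (\<lambda>s. y s - x s)"
    using \<xi> unfolding Q_def by blast
  have BE: "B \<delta> (b - a) = E" unfolding B_def E(1) by simp
  obtain y where y: "polygonal_sol F \<epsilon>' a b y" "y a = \<xi>"
    "\<forall>s\<in>{a..b}. norm (y s - x s) \<le> B \<delta> (s - a)"
    "(\<epsilon> + L * E)-lipschitz_on {a..b} (\<lambda>s. y s - x s)"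
    using Qab E(2) unfolding BE by blast
  have "0 \<le> \<delta>" using \<xi> norm_ge_zero order_trans by blast
  then have "norm (y s - x s) \<le> E" if "s \<in> {a..b}" for s
    using y(3) that B_mono[of \<delta> "s - a" "b - a"] BE by force
  then show ?thesis using y by blast
qed

text \<open>Time reversal turns the prescribed end into a start, and negating the values of
  \<open>F\<close> preserves its Lipschitz and norm bounds.\<close>

lemma polygonal_sol_refine_backward:
  fixes x :: "real \<Rightarrow> 'a::real_normed_vector"
  assumes sol: "polygonal_sol F \<epsilon> a b x" and "a \<le> b"
    and lip: "sv_lipschitz_on L (cball 0 (R + 1)) F"
    and bound: "\<And>p u. p \<in> cball 0 (R + 1) \<Longrightarrow> u \<in> F p \<Longrightarrow> norm u \<le> M"
    and R: "\<And>s. a \<le> s \<Longrightarrow> s \<le> b \<Longrightarrow> norm (x s) \<le> R"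
    and "0 \<le> \<epsilon>" "0 < \<epsilon>'" and \<xi>: "norm (\<xi> - x b) \<le> \<delta>"
    and E: "E = (\<delta> + \<epsilon> * (b - a)) * exp (L * (b - a))" "E \<le> 1"
  shows "\<exists>y. polygonal_sol F \<epsilon>' a b y \<and> y b = \<xi> \<and> (\<forall>s\<in>{a..b}. norm (y s - x s) \<le> E) \<and>
    (\<epsilon> + L * E)-lipschitz_on {a..b} (\<lambda>s. y s - x s)"
proof -
  let ?G = "\<lambda>p. uminus ` F p"
  have "sv_lipschitz_on L (cball 0 (R + 1)) ?G"
    unfolding sv_lipschitz_on_def
  proof (intro conjI ballI)
    show "0 \<le> L" using lip unfolding sv_lipschitz_on_def by blast
    fix p q v :: 'a assume "p \<in> cball 0 (R + 1)" "q \<in> cball 0 (R + 1)" "v \<in> ?G p"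
    then obtain w where "w \<in> F q" "norm (- v - w) \<le> L * norm (p - q)"
      using lip unfolding sv_lipschitz_on_def by fastforce
    then show "\<exists>w\<in>?G q. norm (v - w) \<le> L * norm (p - q)"
      by (intro bexI[of _ "- w"]) (auto simp: norm_minus_commute add.commute)
  qed
  then have "\<exists>y. polygonal_sol ?G \<epsilon>' (- b) (- a) y \<and> y (- b) = \<xi> \<and> 
      (\<forall>s\<in>{- b..- a}. norm (y s - x (- s)) \<le> E) \<and>
      (\<epsilon> + L * E)-lipschitz_on {- b..- a} (\<lambda>s. y s - x (- s))"
    using bound R \<xi> E \<open>a \<le> b\<close> \<open>0 \<le> \<epsilon>\<close> \<open>0 < \<epsilon>'\<close>
    by (intro polygonal_sol_refine[OF polygonal_sol_reverse[OF sol], of L R M _ _ \<delta>]) auto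
  then obtain y where y: "polygonal_sol ?G \<epsilon>' (- b) (- a) y" "y (- b) = \<xi>"
      "\<And>s. s \<in> {- b..- a} \<Longrightarrow> norm (y s - x (- s)) \<le> E"
      "(\<epsilon> + L * E)-lipschitz_on {- b..- a} (\<lambda>s. y s - x (- s))"
    by blast
  have "polygonal_sol F \<epsilon>' a b (\<lambda>t. y (- t))"
    using polygonal_sol_reverse[OF y(1)] by (simp add: image_image)
  moreover have "norm (y (- s) - x s) \<le> E" if "s \<in> {a..b}" for s
    using y(3)[of "- s"] that by simp
  moreover have "(\<epsilon> + L * E)-lipschitz_on {a..b} (\<lambda>s. y (- s) - x s)"
  proof (rule lipschitz_onI)
    show "0 \<le> \<epsilon> + L * E" using y(4) by (rule lipschitz_on_nonneg)
    fix s r assume "s \<in> {a..b}" "r \<in> {a..b}"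
    then show "dist (y (- s) - x s) (y (- r) - x r) \<le> (\<epsilon> + L * E) * dist s r"
      using lipschitz_onD[OF y(4), of "- s" "- r"] by (simp add: dist_minus)
  qed
  ultimately show ?thesis using y(2) by (intro exI[of _ "\<lambda>t. y (- t)"]) auto
qed

section \<open>Uniform bounds for the set-valued map on compact sets\<close>

lemma sv_locally_lipschitzE:
  fixes F :: "'a::real_normed_vector \<Rightarrow> 'b::real_normed_vector set"
  assumes "locally_lipschitz_setvalued F"
  obtains U L where "open U" "\<xi> \<in> U" "0 < L"
    "\<And>p q v. p \<in> U \<Longrightarrow> q \<in> U \<Longrightarrow> v \<in> F p \<Longrightarrow> \<exists>w\<in>F q. norm (v - w) \<le> L * norm (p - q)"
proof -
  obtain U L where U: "open U" "\<xi> \<in> U" "0 < L"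
    "\<forall>p\<in>U. \<forall>q\<in>U. F p \<subseteq> {v + (L * norm (p - q)) *\<^sub>R b |v b. v \<in> F q \<and> b \<in> cball 0 1}"
    using assms[unfolded locally_lipschitz_setvalued_def, rule_format, of \<xi>] by (elim exE conjE) (rule that)
  show ?thesis
  proof (rule that[OF U(1-3)])
    fix p q v assume pq: "p \<in> U" "q \<in> U" and "v \<in> F p"
    then have "v \<in> {v + (L * norm (p - q)) *\<^sub>R b |v b. v \<in> F q \<and> b \<in> cball 0 1}"
      using U(4) by (meson subsetD)
    then obtain w b where w: "v = w + (L * norm (p - q)) *\<^sub>R b" "w \<in> F q" "norm b \<le> 1"
      by auto
    then have "norm (v - w) = (L * norm (p - q)) * norm b" using \<open>0 < L\<close> by simp
    also have "\<dots> \<le> L * norm (p - q)" using \<open>0 < L\<close> w(3) by (intro mult_left_le) auto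
    finally show "\<exists>w\<in>F q. norm (v - w) \<le> L * norm (p - q)" using w(2) by blast
  qed
qed

lemma sv_bounded_on_compact:
  fixes F :: "'a::real_normed_vector \<Rightarrow> 'b::real_normed_vector set"
  assumes lip: "locally_lipschitz_setvalued F" and cpt: "\<And>\<xi>. compact (F \<xi>)" and "compact K"
  obtains M where "0 \<le> M" "\<And>p u. p \<in> K \<Longrightarrow> u \<in> F p \<Longrightarrow> norm u \<le> M"
proof -
  have "\<exists>V M. open V \<and> \<xi> \<in> V \<and> (\<forall>p\<in>V. \<forall>u\<in>F p. norm u \<le> M)" for \<xi>
  proof -
    obtain U L where U: "open U" "\<xi> \<in> U" "0 < L"
      "\<And>p q v. p \<in> U \<Longrightarrow> q \<in> U \<Longrightarrow> v \<in> F p \<Longrightarrow> \<exists>w\<in>F q. norm (v - w) \<le> L * norm (p - q)"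
      using lip by (rule sv_locally_lipschitzE[where \<xi> = \<xi>]) blast
    obtain B where B: "\<And>u. u \<in> F \<xi> \<Longrightarrow> norm u \<le> B"
      using compact_imp_bounded[OF cpt[of \<xi>]] unfolding bounded_iff by blast
    have "norm u \<le> B + L" if pu: "p \<in> U \<inter> ball \<xi> 1" "u \<in> F p" for p u
    proof -
      obtain w where w: "w \<in> F \<xi>" "norm (u - w) \<le> L * norm (p - \<xi>)"
        using U pu by blast
      have "norm (p - \<xi>) \<le> 1" using pu by (simp add: dist_norm norm_minus_commute)
      then have "norm (u - w) \<le> L"
        using w(2) \<open>0 < L\<close> mult_left_mono[of "norm (p - \<xi>)" 1 L] by linarith
      then show ?thesis using B[OF w(1)] norm_triangle_sub[of u w] by linarith
    qed
    then show ?thesis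
      using U by (intro exI[of _ "U \<inter> ball \<xi> 1"] exI[of _ "B + L"]) auto
  qed
  then obtain V M where V: "\<And>\<xi>. open (V \<xi>)" "\<And>\<xi>. \<xi> \<in> V \<xi>"
    "\<And>\<xi> p u. p \<in> V \<xi> \<Longrightarrow> u \<in> F p \<Longrightarrow> norm u \<le> M \<xi>"
    by metis
  obtain C where C: "C \<subseteq> K" "finite C" "K \<subseteq> (\<Union>\<xi>\<in>C. V \<xi>)"
    by (rule compactE_image[OF \<open>compact K\<close>, of K V]) (use V in auto)
  \<comment> \<open>The sum is an upper bound of all \<open>M \<xi>\<close> that makes sense even if
    the cover is empty.\<close>
  have "norm u \<le> (\<Sum>\<xi>\<in>C. \<bar>M \<xi>\<bar>)" if pu: "p \<in> K" "u \<in> F p" for p u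
  proof -
    obtain \<xi> where "\<xi> \<in> C" "p \<in> V \<xi>" using C pu by blast
    then have "norm u \<le> M \<xi>" "\<bar>M \<xi>\<bar> \<le> (\<Sum>\<xi>\<in>C. \<bar>M \<xi>\<bar>)"
      using V(3) pu C by (auto intro: member_le_sum)
    then show ?thesis by linarith
  qed
  moreover have "0 \<le> (\<Sum>\<xi>\<in>C. \<bar>M \<xi>\<bar>)" by (simp add: sum_nonneg)
  ultimately show ?thesis using that by blast
qed

text \<open>Two points closer than a Lebesgue number \<open>\<kappa>\<close> of the cover share a
  neighbourhood with a local constant. For points further apart the bound \<open>M\<close> on the
  values suffices, whence the summand \<open>2 * M / \<kappa>\<close>; there any companion value
  will do, as long as one exists.\<close>

lemma sv_lipschitz_on_compact:
  fixes F :: "'a::real_normed_vector \<Rightarrow> 'b::real_normed_vector set"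
  assumes lip: "locally_lipschitz_setvalued F" and cpt: "\<And>\<xi>. compact (F \<xi>)"
    and ne: "\<And>\<xi>. F \<xi> \<noteq> {}" and "compact K"
  obtains L where "sv_lipschitz_on L K F"
proof -
  obtain M where M: "0 \<le> M" "\<And>p u. p \<in> K \<Longrightarrow> u \<in> F p \<Longrightarrow> norm u \<le> M"
    using sv_bounded_on_compact[OF lip cpt \<open>compact K\<close>] by blast
  have "\<exists>U L. open U \<and> \<xi> \<in> U \<and> 0 < L \<and>
      (\<forall>p\<in>U. \<forall>q\<in>U. \<forall>v\<in>F p. \<exists>w\<in>F q. norm (v - w) \<le> L * norm (p - q))" for \<xi>
    using lip by (rule sv_locally_lipschitzE[where \<xi> = \<xi>]) blast
  then obtain U L where U: "\<And>\<xi>. open (U \<xi>)" "\<And>\<xi>. \<xi> \<in> U \<xi>" "\<And>\<xi>. 0 < L \<xi>"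
    "\<And>\<xi> p q v. p \<in> U \<xi> \<Longrightarrow> q \<in> U \<xi> \<Longrightarrow> v \<in> F p \<Longrightarrow> \<exists>w\<in>F q. norm (v - w) \<le> L \<xi> * norm (p - q)"
    by metis
  obtain C where C: "C \<subseteq> K" "finite C" "K \<subseteq> (\<Union>\<xi>\<in>C. U \<xi>)"
    by (rule compactE_image[OF \<open>compact K\<close>, of K U]) (use U in auto)
  obtain \<kappa> where \<kappa>: "0 < \<kappa>" "\<And>p. p \<in> K \<Longrightarrow> \<exists>G\<in>U ` C. ball p \<kappa> \<subseteq> G"
    by (rule Heine_Borel_lemma[OF \<open>compact K\<close> C(3)]) (use U in auto)
  define N where "N = (\<Sum>\<xi>\<in>C. L \<xi>) + 2 * M / \<kappa>"
  have N0: "0 \<le> (\<Sum>\<xi>\<in>C. L \<xi>)" using U(3) by (intro sum_nonneg) (auto intro: less_imp_le)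
  have "\<exists>w\<in>F q. norm (v - w) \<le> N * norm (p - q)" if pq: "p \<in> K" "q \<in> K" "v \<in> F p" for p q v
  proof (cases "dist p q < \<kappa>")
    case True
    obtain \<xi> where \<xi>: "\<xi> \<in> C" "ball p \<kappa> \<subseteq> U \<xi>" using \<kappa> pq by blast
    then have "p \<in> U \<xi>" "q \<in> U \<xi>" using True \<kappa>(1) by auto
    then obtain w where w: "w \<in> F q" "norm (v - w) \<le> L \<xi> * norm (p - q)" using U(4) pq by blast
    have "L \<xi> \<le> (\<Sum>\<xi>\<in>C. L \<xi>)"
      using U(3) C \<xi> by (intro member_le_sum) (auto intro: less_imp_le)
    moreover have "0 \<le> 2 * M / \<kappa>" using M \<kappa> by simp
    ultimately have "L \<xi> \<le> N" unfolding N_def by linarith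
    then have "L \<xi> * norm (p - q) \<le> N * norm (p - q)" by (rule mult_right_mono) simp
    then show ?thesis using w by (intro bexI[of _ w]) auto
  next
    case False
    obtain w where w: "w \<in> F q" using ne by blast
    have "norm (v - w) \<le> norm v + norm w" by (rule norm_triangle_ineq4)
    also have "\<dots> \<le> 2 * M" using M(2)[OF pq(1,3)] M(2)[OF pq(2) w] by simp
    also have "\<dots> = 2 * M / \<kappa> * \<kappa>" using \<kappa> by simp
    also have "\<dots> \<le> N * norm (p - q)"
      using False \<kappa> M N0 unfolding N_def by (intro mult_mono) (auto simp: dist_norm)
    finally show ?thesis using w by blast
  qed
  moreover have "0 \<le> N" unfolding N_def using N0 M \<kappa> by simp
  ultimately show ?thesis using that[of N] unfolding sv_lipschitz_on_def by blast
qed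

section \<open>Regularity of polygonal solutions\<close>

lemma polygonal_sol_lipschitz:
  assumes "polygonal_sol F \<epsilon> a b x" "a \<le> b"
  shows "\<exists>K. K-lipschitz_on {a..b} x"
  using assms zero_less_one
proof (induction rule: polygonal_sol_induct)
  case (trans c d e)
  then obtain K K' where "K-lipschitz_on {c..d} x" "K'-lipschitz_on {d..e} x" by blast
  then have "(max K K')-lipschitz_on {c..e} (\<lambda>s. if s \<le> d then x s else x s)"
    by (intro lipschitz_on_concat_max) auto
  then show ?case by auto
next
  case (segment c d)
  obtain w where w: "\<And>s. c \<le> s \<Longrightarrow> s \<le> d \<Longrightarrow> x s = x c + (s - c) *\<^sub>R w"
    using segment by (metis segment_solE)
  have "(norm w)-lipschitz_on {c..d} x"
  proof (rule lipschitz_onI)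
    fix s r assume "s \<in> {c..d}" "r \<in> {c..d}"
    then have "x s - x r = (s - c) *\<^sub>R w - (r - c) *\<^sub>R w"
      by (metis add_diff_cancel_left atLeastAtMost_iff w)
    also have "\<dots> = (s - r) *\<^sub>R w" by (simp add: scaleR_left_diff_distrib)
    finally show "dist (x s) (x r) \<le> norm w * dist s r"
      by (simp add: dist_norm mult.commute)
  qed simp
  then show ?case by blast
qed

text \<open>Finiteness of \<open>D\<close> is what matters: countably many curves together have only
  countably many bad times, a null set, and at all other times each of them has a two-sided
  velocity.\<close>

lemma polygonal_sol_breakpoints:
  assumes "polygonal_sol F \<epsilon> a b x" "a \<le> b"
  shows "\<exists>D. finite D \<and> (\<forall>t\<in>{a<..<b} - D. \<exists>w u \<delta>. 0 < \<delta> \<and>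
    (\<forall>s. \<bar>s - t\<bar> < \<delta> \<longrightarrow> x s = x t + (s - t) *\<^sub>R w) \<and> u \<in> F (x t) \<and> norm (w - u) \<le> \<epsilon>)"
  using assms zero_less_one
proof (induction rule: polygonal_sol_induct)
  case (trans c d e)
  let ?P = "\<lambda>t. \<exists>w u \<delta>. 0 < \<delta> \<and>
    (\<forall>s. \<bar>s - t\<bar> < \<delta> \<longrightarrow> x s = x t + (s - t) *\<^sub>R w) \<and> u \<in> F (x t) \<and> norm (w - u) \<le> \<epsilon>"
  obtain D D' where D: "finite D" "\<forall>t\<in>{c<..<d} - D. ?P t" "finite D'" "\<forall>t\<in>{d<..<e} - D'. ?P t"
    using trans(5,6) by blast
  have "{c<..<e} - insert d (D \<union> D') \<subseteq> ({c<..<d} - D) \<union> ({d<..<e} - D')" by auto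
  then have "\<forall>t\<in>{c<..<e} - insert d (D \<union> D'). ?P t" using D(2,4) by blast
  then show ?case using D by (intro exI[of _ "insert d (D \<union> D')"]) blast
next
  case (segment c d)
  obtain w where w: "\<And>s. c \<le> s \<Longrightarrow> s \<le> d \<Longrightarrow> x s = x c + (s - c) *\<^sub>R w"
    "\<And>s. c \<le> s \<Longrightarrow> s \<le> d \<Longrightarrow> \<exists>u\<in>F (x s). norm (w - u) \<le> \<epsilon>"
    using segment by (metis segment_solE)
  have "\<exists>w u \<delta>. 0 < \<delta> \<and> (\<forall>s. \<bar>s - t\<bar> < \<delta> \<longrightarrow> x s = x t + (s - t) *\<^sub>R w) \<and> u \<in> F (x t) \<and> norm (w - u) \<le> \<epsilon>"
    if t: "t \<in> {c<..<d}" for t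
  proof -
    obtain u where u: "u \<in> F (x t)" "norm (w - u) \<le> \<epsilon>" using w(2)[of t] t by auto
    have "x s = x t + (s - t) *\<^sub>R w" if "\<bar>s - t\<bar> < min (t - c) (d - t)" for s
    proof -
      have "x s = x c + (s - c) *\<^sub>R w" "x t = x c + (t - c) *\<^sub>R w"
        using that t by (intro w(1); simp add: abs_less_iff)+
      moreover have "(s - c) *\<^sub>R w = (t - c) *\<^sub>R w + (s - t) *\<^sub>R w"
        by (simp flip: scaleR_add_left)
      ultimately show ?thesis by simp
    qed
    moreover have "0 < min (t - c) (d - t)" using t by simp
    ultimately show ?thesis using u by blast
  qed
  then show ?case by (intro exI[of _ "{}"]) auto
qed

section \<open>Bounded reachability\<close>

text \<open>Since approximate solutions from nearby points are included, this notion is stable under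
  limits, unlike boundedness of the set reached by exact solutions.\<close>

definition reach_bounded :: "('a::real_normed_vector \<Rightarrow> 'a set) \<Rightarrow> 'a \<Rightarrow> real \<Rightarrow> bool" where
  "reach_bounded F \<xi> T \<longleftrightarrow> (\<exists>\<epsilon>>0. \<exists>M. \<forall>x b. 0 \<le> b \<longrightarrow> b \<le> T \<longrightarrow>
     polygonal_sol F \<epsilon> 0 b x \<longrightarrow> norm (x 0 - \<xi>) \<le> \<epsilon> \<longrightarrow> norm (x b) \<le> M)"

lemma reach_boundedI:
  assumes "0 < \<epsilon>" "\<And>x b. 0 \<le> b \<Longrightarrow> b \<le> T \<Longrightarrow> polygonal_sol F \<epsilon> 0 b x \<Longrightarrow> norm (x 0 - \<xi>) \<le> \<epsilon> \<Longrightarrow> norm (x b) \<le> M"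
  shows "reach_bounded F \<xi> T"
  using assms unfolding reach_bounded_def by blast

lemma reach_bounded_mono:
  assumes "reach_bounded F \<xi> T" "T' \<le> T"
  shows "reach_bounded F \<xi> T'"
  using assms unfolding reach_bounded_def by (meson order_trans)

lemma reach_bounded_0:
  fixes \<xi> :: "'a::real_normed_vector"
  shows "reach_bounded F \<xi> 0"
proof (rule reach_boundedI[where \<epsilon> = 1 and M = "norm \<xi> + 1"])
  fix x :: "real \<Rightarrow> 'a" and b :: real
  assume "0 \<le> b" "b \<le> 0" "norm (x 0 - \<xi>) \<le> 1"
  then show "norm (x b) \<le> norm \<xi> + 1" using norm_triangle_sub[of "x 0" \<xi>] by simp
qed simp

text \<open>The speed is at most \<open>M + 1\<close> as long as the curve is in the ball of radius
  \<open>r + 1\<close>, and the time is too short to leave that ball from radius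
  \<open>r\<close>.\<close>

lemma polygonal_sol_speed_bound:
  assumes "polygonal_sol F \<epsilon> a b x" "a \<le> b" "\<epsilon> \<le> 1" "norm (x a) \<le> r"
    and M: "\<And>p u. p \<in> cball 0 (r + 1) \<Longrightarrow> u \<in> F p \<Longrightarrow> norm u \<le> M" and "0 \<le> M"
    and small: "(M + 1) * (b - a) \<le> 1"
  shows "norm (x b) \<le> r + 1"
proof -
  \<comment> \<open>Stated as an implication between the two ends, so that concatenation is mere
    transitivity.\<close>
  define Q where "Q c d \<longleftrightarrow>
    norm (x c) \<le> r + (M + 1) * (c - a) \<longrightarrow> norm (x d) \<le> r + (M + 1) * (d - a)" for c d
  have "Q a b"
    using assms(1,2) zero_less_one
  proof (induction rule: polygonal_sol_induct)
    case (segment c d)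
    show ?case
      unfolding Q_def
    proof
      assume xc: "norm (x c) \<le> r + (M + 1) * (c - a)"
      have "(M + 1) * (c - a) \<le> (M + 1) * (b - a)"
        using segment \<open>0 \<le> M\<close> by (intro mult_left_mono) auto
      then have c: "x c \<in> cball 0 (r + 1)" using xc small by simp
      obtain w where w: "\<And>s. c \<le> s \<Longrightarrow> s \<le> d \<Longrightarrow> x s = x c + (s - c) *\<^sub>R w"
        "\<And>s. c \<le> s \<Longrightarrow> s \<le> d \<Longrightarrow> \<exists>u\<in>F (x s). norm (w - u) \<le> \<epsilon>"
        using segment by (metis segment_solE)
      obtain u where u: "u \<in> F (x c)" "norm (w - u) \<le> \<epsilon>" using w(2)[of c] segment by auto
      have "norm w \<le> M + 1"
        using M[OF c u(1)] u(2) \<open>\<epsilon> \<le> 1\<close> norm_triangle_sub[of w u] by linarith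
      then have "norm ((d - c) *\<^sub>R w) \<le> (M + 1) * (d - c)"
        using segment mult_right_mono[of "norm w" "M + 1" "d - c"] by (simp add: mult.commute)
      then have "norm (x d) \<le> norm (x c) + (M + 1) * (d - c)"
        using w(1)[of d] segment norm_triangle_ineq[of "x c" "(d - c) *\<^sub>R w"] by simp
      then show "norm (x d) \<le> r + (M + 1) * (d - a)" using xc by (simp add: algebra_simps)
    qed
  qed (simp add: Q_def)
  then show ?thesis using assms unfolding Q_def by simp
qed

text \<open>What matters is that the time is uniform on the ball. In contraposition, points whose
  reach times shrink to 0 must leave every ball.\<close>

lemma reach_bounded_local:
  fixes F :: "'a::euclidean_space \<Rightarrow> 'a set"
  assumes lip: "locally_lipschitz_setvalued F" and cpt: "\<And>\<xi>. compact (F \<xi>)"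
  obtains T where "0 < T" "\<And>\<xi>. norm \<xi> \<le> r \<Longrightarrow> reach_bounded F \<xi> T"
proof -
  obtain M where M: "0 \<le> M" "\<And>p u. p \<in> cball 0 (r + 1 + 1) \<Longrightarrow> u \<in> F p \<Longrightarrow> norm u \<le> M"
    using sv_bounded_on_compact[OF lip cpt compact_cball] by blast
  have "reach_bounded F \<xi> (1 / (M + 1))" if \<xi>: "norm \<xi> \<le> r" for \<xi>
  proof (rule reach_boundedI)
    fix x b assume b: "0 \<le> b" "b \<le> 1 / (M + 1)" and x: "polygonal_sol F 1 0 b x" "norm (x 0 - \<xi>) \<le> 1"
    have "norm (x 0) \<le> r + 1" using x(2) \<xi> norm_triangle_sub[of "x 0" \<xi>] by simp
    moreover have "(M + 1) * (b - 0) \<le> 1" using b M(1) by (simp add: field_simps)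
    ultimately show "norm (x b) \<le> r + 1 + 1"
      using M b x by (intro polygonal_sol_speed_bound[OF x(1), of "r + 1" M]) auto
  qed simp
  then show ?thesis using that[of "1 / (M + 1)"] M(1) by simp
qed

text \<open>Approximate solutions with tolerances tending to 0 attain arbitrarily large norms within
  time \<open>T\<close>. They cannot do so up to time \<open>s\<close>, so they are still running at
  \<open>s\<close>, in a bounded set. An accumulation point of their positions at \<open>s\<close>
  inherits the unboundedness for the remaining time, and their initial parts provide the
  connections.\<close>

lemma not_reach_bounded_step:
  fixes F :: "'a::euclidean_space \<Rightarrow> 'a set"
  assumes nb: "\<not> reach_bounded F \<xi> T" and s: "reach_bounded F \<xi> s" "0 \<le> s"
  obtains \<eta> where "\<not> reach_bounded F \<eta> (T - s)"
    "\<And>\<epsilon>. 0 < \<epsilon> \<Longrightarrow> \<exists>x. polygonal_sol F \<epsilon> 0 s x \<and> norm (x 0 - \<xi>) \<le> \<epsilon> \<and> norm (x s - \<eta>) \<le> \<epsilon>"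
proof -
  define \<epsilon> where "\<epsilon> n = 1 / real (Suc n)" for n
  have \<epsilon>: "0 < \<epsilon> n" for n unfolding \<epsilon>_def by simp
  have \<epsilon>_small: "\<forall>\<^sub>F n in sequentially. \<epsilon> n \<le> e" if "0 < e" for e
    unfolding \<epsilon>_def using LIMSEQ_inverse_real_of_nat that
    by (auto dest!: order_tendstoD(2)[where a = e] elim!: eventually_mono simp: inverse_eq_divide)
  have "\<exists>x b. 0 \<le> b \<and> b \<le> T \<and> polygonal_sol F (\<epsilon> n) 0 b x \<and> norm (x 0 - \<xi>) \<le> \<epsilon> n \<and> real n < norm (x b)" for n
    using nb \<epsilon>[of n] unfolding reach_bounded_def by (meson not_le)
  then obtain x b where x: "\<And>n. 0 \<le> b n" "\<And>n. b n \<le> T" "\<And>n. polygonal_sol F (\<epsilon> n) 0 (b n) (x n)"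
    "\<And>n. norm (x n 0 - \<xi>) \<le> \<epsilon> n" "\<And>n. real n < norm (x n (b n))"
    by metis
  obtain e M where e: "0 < e" and M: "\<And>x b. 0 \<le> b \<Longrightarrow> b \<le> s \<Longrightarrow>
     polygonal_sol F e 0 b x \<Longrightarrow> norm (x 0 - \<xi>) \<le> e \<Longrightarrow> norm (x b) \<le> M"
    using s(1) unfolding reach_bounded_def by blast
  obtain k where k: "\<And>n. k \<le> n \<Longrightarrow> \<epsilon> n \<le> e" "M \<le> real k"
  proof -
    obtain k\<^sub>1 where "\<And>n. k\<^sub>1 \<le> n \<Longrightarrow> \<epsilon> n \<le> e"
      using \<epsilon>_small[OF e] unfolding eventually_sequentially by blast
    moreover obtain k\<^sub>2 where "M \<le> real k\<^sub>2" using real_arch_simple by blast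
    ultimately show ?thesis using that[of "max k\<^sub>1 k\<^sub>2"] by auto
  qed
  have bs: "s < b n" if "k \<le> n" for n
  proof (rule ccontr)
    assume "\<not> s < b n"
    then have "norm (x n (b n)) \<le> M"
      using x(1)[of n] order_trans[OF x(4) k(1)[OF that]] k(1)[OF that]
      by (intro M polygonal_sol_mono[OF x(3)]) auto
    then show False using x(5)[of n] k(2) that by linarith
  qed
  have xs: "norm (x n s) \<le> M" if "k \<le> n" for n
    using s(2) bs[OF that] order_trans[OF x(4) k(1)[OF that]] k(1)[OF that]
    by (intro M polygonal_sol_mono[OF polygonal_sol_subinterval[OF x(3)[of n]]]) auto
  have "\<exists>\<eta>\<in>cball 0 M. \<exists>r. strict_mono r \<and> ((\<lambda>n. x (n + k) s) \<circ> r) \<longlonglongrightarrow> \<eta>"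
    using compact_cball[of "0::'a" M] xs unfolding compact_def by (metis le_add2 mem_cball_0)
  then obtain \<eta> r where r: "strict_mono r" "(\<lambda>n. x (r n + k) s) \<longlonglongrightarrow> \<eta>"
    by (auto simp: comp_def)
  define m where "m n = r n + k" for n
  have m: "n \<le> m n" "k \<le> m n" for n
    unfolding m_def using seq_suble[OF r(1), of n] by auto
  have ev: "\<forall>\<^sub>F n in sequentially. \<epsilon> (m n) \<le> e \<and> norm (x (m n) s - \<eta>) \<le> e" if "0 < e" for e
  proof (rule eventually_conj)
    have "\<epsilon> (m n) \<le> \<epsilon> n" for n unfolding \<epsilon>_def using m by (simp add: frac_le)
    then show "\<forall>\<^sub>F n in sequentially. \<epsilon> (m n) \<le> e"
      using \<epsilon>_small[OF that] by (auto elim!: eventually_mono intro: order_trans)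
    show "\<forall>\<^sub>F n in sequentially. norm (x (m n) s - \<eta>) \<le> e"
      using tendstoD[OF r(2) that] unfolding m_def by (auto elim!: eventually_mono simp: dist_norm)
  qed
  show ?thesis
  proof
    show "\<not> reach_bounded F \<eta> (T - s)"
    proof
      assume "reach_bounded F \<eta> (T - s)"
      then obtain e' M' where e': "0 < e'" and M': "\<And>x b. 0 \<le> b \<Longrightarrow> b \<le> T - s \<Longrightarrow>
          polygonal_sol F e' 0 b x \<Longrightarrow> norm (x 0 - \<eta>) \<le> e' \<Longrightarrow> norm (x b) \<le> M'"
        unfolding reach_bounded_def by blast
      obtain n\<^sub>1 where n\<^sub>1: "\<And>n. n\<^sub>1 \<le> n \<Longrightarrow> \<epsilon> (m n) \<le> e' \<and> norm (x (m n) s - \<eta>) \<le> e'"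
        using ev[OF e'] unfolding eventually_sequentially by blast
      obtain n\<^sub>2 where n\<^sub>2: "M' \<le> real n\<^sub>2" using real_arch_simple by blast
      define n where "n = max n\<^sub>1 n\<^sub>2"
      have n: "\<epsilon> (m n) \<le> e'" "norm (x (m n) s - \<eta>) \<le> e'" "M' \<le> real (m n)"
        using n\<^sub>1[of n] n\<^sub>2 m(1)[of n] unfolding n_def by auto
      have "polygonal_sol F (\<epsilon> (m n)) (0 + s) (b (m n) - s + s) (x (m n))"
        using polygonal_sol_subinterval[OF x(3)] s(2) by simp
      then have "polygonal_sol F e' 0 (b (m n) - s) (\<lambda>t. x (m n) (t + s))"
        by (intro polygonal_sol_mono[OF polygonal_sol_shift n(1)])
      then have "norm (x (m n) (b (m n) - s + s)) \<le> M'"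
        using M'[of "b (m n) - s" "\<lambda>t. x (m n) (t + s)"] bs[OF m(2)] x(2) n(2) by (auto simp: less_imp_le)
      then show False using x(5)[of "m n"] n(3) by simp
    qed
    fix e :: real assume "0 < e"
    then obtain n where n: "\<epsilon> (m n) \<le> e" "norm (x (m n) s - \<eta>) \<le> e"
      using ev unfolding eventually_sequentially by blast
    have "polygonal_sol F e 0 s (x (m n))"
      using bs[OF m(2), of n] by (intro polygonal_sol_mono[OF polygonal_sol_subinterval[OF x(3)] n(1)]) auto
    then show "\<exists>x. polygonal_sol F e 0 s x \<and> norm (x 0 - \<xi>) \<le> e \<and> norm (x s - \<eta>) \<le> e"
      using n x(4)[of "m n"] by (intro exI[of _ "x (m n)"]) auto
  qed
qed

section \<open>Absolute continuity and limits of polygonal solutions\<close>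

lemma abs_continuous_on_interval_imp_continuous_on:
  assumes "abs_continuous_on_interval a b f"
  shows "continuous_on {a..b} f"
  unfolding continuous_on_iff
proof (intro ballI allI impI)
  fix t e :: real assume t: "t \<in> {a..b}" and "0 < e"
  obtain d where d: "0 < d" "\<And>I. finite I \<Longrightarrow> (\<forall>(u, v)\<in>I. a \<le> u \<and> u \<le> v \<and> v \<le> b) \<Longrightarrow>
      pairwise (\<lambda>p q. disjnt {fst p<..<snd p} {fst q<..<snd q}) I \<Longrightarrow>
      (\<Sum>(u, v)\<in>I. v - u) < d \<Longrightarrow> (\<Sum>(u, v)\<in>I. norm (f v - f u)) < e"
    using assms[unfolded abs_continuous_on_interval_def, rule_format, OF \<open>0 < e\<close>] by blast
  have single: "norm (f v - f u) < e" if "a \<le> u" "u \<le> v" "v \<le> b" "v - u < d" for u v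
    using d(2)[of "{(u, v)}"] that by simp
  have "dist (f s) (f t) < e" if "s \<in> {a..b}" "dist s t < d" for s
    using single[of s t] single[of t s] that t
    by (cases "s \<le> t") (auto simp: dist_norm norm_minus_commute)
  then show "\<exists>d>0. \<forall>s\<in>{a..b}. dist s t < d \<longrightarrow> dist (f s) (f t) < e"
    using d(1) by blast
qed

lemma lipschitz_imp_abs_continuous_on_interval:
  assumes "K-lipschitz_on {a..b} f"
  shows "abs_continuous_on_interval a b f"
  unfolding abs_continuous_on_interval_def
proof (intro allI impI)
  fix e :: real assume "0 < e"
  have K: "0 \<le> K" using assms by (rule lipschitz_on_nonneg)
  have "(\<Sum>(u, v)\<in>I. norm (f v - f u)) < e"
    if I: "\<forall>(u, v)\<in>I. a \<le> u \<and> u \<le> v \<and> v \<le> b" and small: "(\<Sum>(u, v)\<in>I. v - u) < e / (K + 1)"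
    for I :: "(real \<times> real) set"
  proof -
    have "(\<Sum>(u, v)\<in>I. norm (f v - f u)) \<le> (\<Sum>(u, v)\<in>I. K * (v - u))"
    proof (rule sum_mono, clarify)
      fix u v assume "(u, v) \<in> I"
      then have "a \<le> u" "u \<le> v" "v \<le> b" using I by auto
      then show "norm (f v - f u) \<le> K * (v - u)"
        using lipschitz_on_normD[OF assms, of v u] by simp
    qed
    also have "\<dots> = K * (\<Sum>(u, v)\<in>I. v - u)" by (simp add: sum_distrib_left case_prod_unfold)
    also have "\<dots> \<le> K * (e / (K + 1))" using small K by (intro mult_left_mono) auto
    also have "\<dots> < e" using K \<open>0 < e\<close> by (simp add: field_simps)
    finally show ?thesis .
  qed
  then show "\<exists>\<delta>>0. \<forall>I. finite I \<longrightarrow> (\<forall>(u, v)\<in>I. a \<le> u \<and> u \<le> v \<and> v \<le> b) \<longrightarrow>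
      pairwise (\<lambda>p q. disjnt {fst p<..<snd p} {fst q<..<snd q}) I \<longrightarrow>
      (\<Sum>(u, v)\<in>I. v - u) < \<delta> \<longrightarrow> (\<Sum>(u, v)\<in>I. norm (f v - f u)) < e"
    using K \<open>0 < e\<close> by (intro exI[of _ "e / (K + 1)"]) auto
qed

text \<open>Telescoping against the tail of a geometric series. It serves alike for the values, the
  increments and the slopes of the approximating curves.\<close>

lemma geometric_Cauchy_limit:
  fixes X :: "nat \<Rightarrow> 'a::banach"
  assumes "\<And>k. n \<le> k \<Longrightarrow> norm (X (Suc k) - X k) \<le> c * (1/2)^k"
  shows "convergent X" "\<And>k. n \<le> k \<Longrightarrow> norm (lim X - X k) \<le> 2 * c * (1/2)^k"
proof -
  \<comment> \<open>The subtracted term is the part of the tail not yet consumed; without it the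
    induction over \<open>j\<close> would not close.\<close>
  have diff: "norm (X (k + j) - X k) \<le> 2 * c * (1/2)^k - 2 * c * (1/2)^(k + j)" if "n \<le> k" for k j
  proof (induction j)
    case (Suc j)
    have "norm (X (k + Suc j) - X k) \<le> norm (X (Suc (k + j)) - X (k + j)) + norm (X (k + j) - X k)"
      using norm_triangle_ineq[of "X (Suc (k + j)) - X (k + j)" "X (k + j) - X k"] by simp
    also have "\<dots> \<le> c * (1/2)^(k + j) + (2 * c * (1/2)^k - 2 * c * (1/2)^(k + j))"
      using assms[of "k + j"] that Suc by (intro add_mono) auto
    finally show ?case by simp
  qed simp
  have "0 \<le> c * (1/2)^n" using assms[of n] norm_ge_zero order_trans by blast
  moreover have "0 < (1/2::real)^n" by simp
  ultimately have c: "0 \<le> c" by (metis mult_less_0_iff not_le)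
  have diff': "norm (X m - X k) \<le> 2 * c * (1/2)^k" if "n \<le> k" "k \<le> m" for k m
  proof -
    have "norm (X (k + (m - k)) - X k) \<le> 2 * c * (1/2)^k - 2 * c * (1/2)^(k + (m - k))"
      using diff that(1) .
    moreover have "0 \<le> 2 * c * (1/2)^(k + (m - k))" using c by simp
    ultimately have "norm (X (k + (m - k)) - X k) \<le> 2 * c * (1/2)^k" by linarith
    then show ?thesis using that by simp
  qed
  have "(\<lambda>k. 2 * c * (1/2)^k) \<longlonglongrightarrow> 2 * c * 0"
    by (intro tendsto_mult tendsto_const LIMSEQ_power_zero) simp
  then have lim0: "(\<lambda>k. 2 * c * (1/2)^k) \<longlonglongrightarrow> 0" by simp
  have "Cauchy X"
  proof (rule CauchyI')
    fix e :: real assume "0 < e"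
    then obtain k where k: "\<And>m. k \<le> m \<Longrightarrow> 2 * c * (1/2)^m < e"
      using order_tendstoD(2)[OF lim0] unfolding eventually_sequentially by blast
    show "\<exists>M. \<forall>m\<ge>M. \<forall>j>m. dist (X m) (X j) < e"
    proof (intro exI[of _ "max n k"] allI impI)
      fix m j assume "max n k \<le> m" "m < j"
      then show "dist (X m) (X j) < e"
        using diff'[of m j] k[of m] by (simp add: dist_norm norm_minus_commute)
    qed
  qed
  then show conv: "convergent X" by (rule Cauchy_convergent)
  fix k assume "n \<le> k"
  have "(\<lambda>m. norm (X m - X k)) \<longlonglongrightarrow> norm (lim X - X k)"
    using conv by (intro tendsto_intros) (simp add: convergent_LIMSEQ_iff)
  moreover have "\<forall>\<^sub>F m in sequentially. norm (X m - X k) \<le> 2 * c * (1/2)^k"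
    unfolding eventually_sequentially using diff' \<open>n \<le> k\<close> by blast
  ultimately show "norm (lim X - X k) \<le> 2 * c * (1/2)^k"
    by (intro tendsto_upperbound) auto
qed

text \<open>The Lipschitz bounds on the differences express uniform convergence of the velocities,
  without which the velocity of the limit need not belong to \<^term>\<open>F\<close>.\<close>

lemma limit_of_polygonal_sols:
  fixes F :: "'a::euclidean_space \<Rightarrow> 'a set" and t :: "nat \<Rightarrow> real" and X :: "nat \<Rightarrow> real \<Rightarrow> 'a"
  assumes lip: "locally_lipschitz_setvalued F" and cpt: "\<And>\<xi>. compact (F \<xi>)"
    and ne: "\<And>\<xi>. F \<xi> \<noteq> {}"
    and t: "\<And>n. 0 \<le> t n" "\<And>n. t n < t (Suc n)" "t \<longlonglongrightarrow> \<tau>"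
    and sol: "\<And>n. polygonal_sol F ((1/2)^n) 0 (t n) (X n)"
    and close: "\<And>n s. 0 \<le> s \<Longrightarrow> s \<le> t n \<Longrightarrow> norm (X (Suc n) s - X n s) \<le> (1/2)^n"
    and close_lip: "\<And>n. ((1/2)^n)-lipschitz_on {0..t n} (\<lambda>s. X (Suc n) s - X n s)"
  obtains x where "is_solution F (ereal \<tau>) x" "\<And>n s. 0 \<le> s \<Longrightarrow> s \<le> t n \<Longrightarrow> norm (x s - X n s) \<le> 2 * (1/2)^n"
proof -
  have t_mono: "t m \<le> t n" if "m \<le> n" for m n
    using that t(2) by (meson lift_Suc_mono_le less_imp_le)
  have t_less: "t n < \<tau>" for n
  proof -
    have "t (Suc n) \<le> \<tau>"
      using t(3) by (rule LIMSEQ_le_const) (auto intro: t_mono)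
    then show ?thesis using t(2)[of n] by linarith
  qed
  have t_ex: "\<exists>n. s < t n" if "s < \<tau>" for s
    using order_tendstoD(1)[OF t(3) that] unfolding eventually_sequentially by blast
  define x where "x s = lim (\<lambda>n. X n s)" for s
  have x_lim: "(\<lambda>k. X k s) \<longlonglongrightarrow> x s"
    and x_close: "norm (x s - X n s) \<le> 2 * (1/2)^n" if "0 \<le> s" "s \<le> t n" for n s
  proof -
    have "norm (X (Suc k) s - X k s) \<le> 1 * (1/2)^k" if "n \<le> k" for k
      using close[of s k] t_mono[OF that] \<open>0 \<le> s\<close> \<open>s \<le> t n\<close> by simp
    note * = geometric_Cauchy_limit[of n "\<lambda>k. X k s" 1, OF this]
    show "(\<lambda>k. X k s) \<longlonglongrightarrow> x s" using *(1) unfolding x_def by (simp add: convergent_LIMSEQ_iff)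
    show "norm (x s - X n s) \<le> 2 * (1/2)^n" using *(2)[of n] unfolding x_def by simp
  qed
  \<comment> \<open>The limit inherits the sum of the Lipschitz bounds: the increments of
    \<open>x\<close> and of \<open>X n\<close> agree up to \<open>2 * (1/2)^n\<close> times the
    elapsed time. Everything said about velocities below rests on this.\<close>
  have x_lip: "norm ((x s - X n s) - (x r - X n r)) \<le> 2 * (1/2)^n * \<bar>s - r\<bar>"
    if sr: "0 \<le> s" "s \<le> t n" "0 \<le> r" "r \<le> t n" for n s r
  proof -
    have "norm ((X (Suc k) s - X (Suc k) r) - (X k s - X k r)) \<le> \<bar>s - r\<bar> * (1/2)^k" if "n \<le> k" for k
    proof -
      have "s \<in> {0..t k}" "r \<in> {0..t k}" using sr t_mono[OF that] by auto
      then have "norm ((X (Suc k) s - X k s) - (X (Suc k) r - X k r)) \<le> (1/2)^k * norm (s - r)"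
        by (rule lipschitz_on_normD[OF close_lip])
      moreover have "(X (Suc k) s - X k s) - (X (Suc k) r - X k r) = (X (Suc k) s - X (Suc k) r) - (X k s - X k r)"
        by simp
      ultimately show ?thesis by (simp add: mult.commute)
    qed
    note * = geometric_Cauchy_limit[of n "\<lambda>k. X k s - X k r" "\<bar>s - r\<bar>", OF this]
    have "(\<lambda>k. X k s - X k r) \<longlonglongrightarrow> x s - x r"
      using sr by (intro tendsto_diff x_lim)
    then have "lim (\<lambda>k. X k s - X k r) = x s - x r" by (rule limI)
    then have "norm ((x s - x r) - (X n s - X n r)) \<le> 2 * \<bar>s - r\<bar> * (1/2)^n"
      using *(2)[of n] by simp
    moreover have "(x s - x r) - (X n s - X n r) = (x s - X n s) - (x r - X n r)" by simp
    ultimately show ?thesis by (simp add: mult_ac)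
  qed
  have ac: "abs_continuous_on_interval a b x" if ab: "0 \<le> a" "ereal b < ereal \<tau>" for a b
  proof -
    obtain n where n: "b < t n" using t_ex ab by auto
    obtain K where K: "K-lipschitz_on {0..t n} (X n)"
      using polygonal_sol_lipschitz[OF sol t(1)] by blast
    have "(2 * (1/2)^n)-lipschitz_on {0..t n} (\<lambda>s. x s - X n s)"
      using x_lip by (intro lipschitz_onI) (auto simp: dist_norm)
    then have "(K + 2 * (1/2)^n)-lipschitz_on {0..t n} (\<lambda>s. X n s + (x s - X n s))"
      using K by (rule lipschitz_on_add[rotated])
    then have "(K + 2 * (1/2)^n)-lipschitz_on {a..b} x"
      using ab n by (auto intro: lipschitz_on_subset)
    then show ?thesis by (rule lipschitz_imp_abs_continuous_on_interval)
  qed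
  define P where "P n s \<longleftrightarrow> (\<exists>w u \<delta>. 0 < \<delta> \<and> (\<forall>r. \<bar>r - s\<bar> < \<delta> \<longrightarrow> X n r = X n s + (r - s) *\<^sub>R w) \<and>
      u \<in> F (X n s) \<and> norm (w - u) \<le> (1/2)^n)" for n s
  have "\<exists>D. finite D \<and> (\<forall>s\<in>{0<..<t n} - D. P n s)" for n
    using polygonal_sol_breakpoints[OF sol t(1)] unfolding P_def .
  then obtain D where D: "\<And>n. finite (D n)" "\<And>n. \<forall>s\<in>{0<..<t n} - D n. P n s"
    by metis
  \<comment> \<open>At such a time every late \<open>X n\<close> is affine nearby, with a slope
    \<open>w n\<close>. Its neighbourhood may shrink with \<open>n\<close>, but by
    \<open>lin\<close> the limit \<open>x\<close> itself follows that slope up to the relative error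
    \<open>2 * (1/2)^n\<close>.\<close>
  have deriv: "\<exists>v\<in>F (x s). (x has_vector_derivative v) (at s within A)"
    if s: "0 < s" "s < \<tau>" "\<And>n. s \<notin> D n" for s A
  proof -
    obtain N where N: "s < t N" using t_ex s by blast
    have sN: "s < t n" if "N \<le> n" for n using N t_mono[OF that] by linarith
    have "P n s" if "N \<le> n" for n
      using D(2)[of n] s sN[OF that] by simp
    then have "\<exists>w u \<delta>. N \<le> n \<longrightarrow> 0 < \<delta> \<and> (\<forall>r. \<bar>r - s\<bar> < \<delta> \<longrightarrow> X n r = X n s + (r - s) *\<^sub>R w) \<and>
      u \<in> F (X n s) \<and> norm (w - u) \<le> (1/2)^n" for n
      unfolding P_def by blast
    then obtain w u \<delta> where w: "\<And>n. N \<le> n \<Longrightarrow> 0 < \<delta> n"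
      "\<And>n r. N \<le> n \<Longrightarrow> \<bar>r - s\<bar> < \<delta> n \<Longrightarrow> X n r = X n s + (r - s) *\<^sub>R w n"
      "\<And>n. N \<le> n \<Longrightarrow> u n \<in> F (X n s)" "\<And>n. N \<le> n \<Longrightarrow> norm (w n - u n) \<le> (1/2)^n"
      by metis
    define d where "d n = min (\<delta> n) (min s (t n - s))" for n
    have d: "0 < d n" if "N \<le> n" for n unfolding d_def using w(1) sN s(1) that by simp
    have lin: "norm (x r - x s - (r - s) *\<^sub>R w n) \<le> 2 * (1/2)^n * \<bar>r - s\<bar>"
      if n: "N \<le> n" and r: "\<bar>r - s\<bar> < d n" for n r
    proof -
      have r': "\<bar>r - s\<bar> < \<delta> n" "0 \<le> r" "r \<le> t n" using r unfolding d_def by auto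
      then have "x r - x s - (r - s) *\<^sub>R w n = (x r - X n r) - (x s - X n s)"
        using w(2)[OF n r'(1)] by simp
      then show ?thesis using x_lip[OF r'(2,3), of s] s(1) sN[OF n] by (metis less_imp_le)
    qed
    \<comment> \<open>Both slopes approximate the same increment of \<open>x\<close> on the smaller
      of the two neighbourhoods, so they are compared through \<open>x\<close>.\<close>
    have w_close: "norm (w m - w n) \<le> 2 * (1/2)^m + 2 * (1/2)^n" if mn: "N \<le> m" "N \<le> n" for m n
    proof -
      define r where "r = s + min (d m) (d n) / 2"
      have r: "\<bar>r - s\<bar> < d m" "\<bar>r - s\<bar> < d n" "0 < \<bar>r - s\<bar>"
        unfolding r_def using d[OF mn(1)] d[OF mn(2)] by auto
      have eq: "(r - s) *\<^sub>R (w m - w n) = (x r - x s - (r - s) *\<^sub>R w n) - (x r - x s - (r - s) *\<^sub>R w m)"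
        by (simp add: algebra_simps)
      have "norm ((r - s) *\<^sub>R (w m - w n)) \<le> 2 * (1/2)^n * \<bar>r - s\<bar> + 2 * (1/2)^m * \<bar>r - s\<bar>"
        unfolding eq using norm_triangle_ineq4[of "x r - x s - (r - s) *\<^sub>R w n" "x r - x s - (r - s) *\<^sub>R w m"]
          lin[OF mn(1) r(1)] lin[OF mn(2) r(2)] by linarith
      then have "\<bar>r - s\<bar> * norm (w m - w n) \<le> \<bar>r - s\<bar> * (2 * (1/2)^m + 2 * (1/2)^n)"
        unfolding norm_scaleR real_norm_def by (simp add: distrib_left mult_ac)
      then show ?thesis using r(3) by (simp add: mult_le_cancel_left_pos)
    qed
    have w_step: "norm (w (Suc k) - w k) \<le> 3 * (1/2)^k" if "N \<le> k" for k
      using w_close[of "Suc k" k] that by simp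
    note lim_w = geometric_Cauchy_limit[of N w 3, OF w_step]
    define v where "v = lim w"
    have wv: "norm (v - w k) \<le> 6 * (1/2)^k" if "N \<le> k" for k
      using lim_w(2)[of k] that unfolding v_def by simp
    have half0: "(\<lambda>k. c * (1/2)^k) \<longlonglongrightarrow> 0" for c :: real
      by (rule tendsto_mult_right_zero[OF LIMSEQ_power_zero]) simp
    have "(x has_derivative (\<lambda>h. h *\<^sub>R v)) (at s within A)"
      unfolding has_derivative_within_alt
    proof (intro conjI allI impI)
      show "bounded_linear (\<lambda>h. h *\<^sub>R v)" by (rule bounded_linear_scaleR_left)
      fix e :: real assume "0 < e"
      \<comment> \<open>The 8 is the sum of 2 from \<open>lin\<close> and 6 from
        \<open>wv\<close>.\<close>
      then obtain k where k: "\<And>n. k \<le> n \<Longrightarrow> 8 * (1/2)^n < e"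
        using order_tendstoD(2)[OF half0[of 8]] unfolding eventually_sequentially by blast
      define n where "n = max N k"
      have n: "N \<le> n" "8 * (1/2)^n < e" unfolding n_def by (auto intro: k)
      show "\<exists>d>0. \<forall>r\<in>A. norm (r - s) < d \<longrightarrow> norm (x r - x s - (r - s) *\<^sub>R v) \<le> e * norm (r - s)"
      proof (intro exI[of _ "d n"] conjI ballI impI)
        show "0 < d n" by (rule d[OF n(1)])
        fix r assume "norm (r - s) < d n"
        then have l: "norm (x r - x s - (r - s) *\<^sub>R w n) \<le> 2 * (1/2)^n * \<bar>r - s\<bar>"
          using lin n(1) by simp
        have v: "norm ((r - s) *\<^sub>R (v - w n)) \<le> 6 * (1/2)^n * \<bar>r - s\<bar>"
          using mult_left_mono[OF wv[OF n(1)], of "\<bar>r - s\<bar>"] by (simp add: mult_ac)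
        have eq: "x r - x s - (r - s) *\<^sub>R v = (x r - x s - (r - s) *\<^sub>R w n) - (r - s) *\<^sub>R (v - w n)"
          by (simp add: algebra_simps)
        have "norm (x r - x s - (r - s) *\<^sub>R v) \<le> 8 * (1/2)^n * \<bar>r - s\<bar>"
          unfolding eq
          using l v norm_triangle_ineq4[of "x r - x s - (r - s) *\<^sub>R w n" "(r - s) *\<^sub>R (v - w n)"] by linarith
        also have "\<dots> \<le> e * norm (r - s)" using n(2) \<open>0 < e\<close> by (intro mult_mono) auto
        finally show "norm (x r - x s - (r - s) *\<^sub>R v) \<le> e * norm (r - s)" .
      qed
    qed
    then have der: "(x has_vector_derivative v) (at s within A)" by (simp add: has_vector_derivative_def)
    obtain L where L: "sv_lipschitz_on L (cball 0 (norm (x s) + 2)) F"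
      using sv_lipschitz_on_compact[OF lip cpt ne compact_cball] by blast
    then have L0: "0 \<le> L" unfolding sv_lipschitz_on_def by blast
    \<comment> \<open>The value \<open>u n\<close> near \<open>w n\<close> belongs to
      \<open>F (X n s)\<close>. The Lipschitz property moves it into \<open>F (x s)\<close>, and
      closedness puts \<open>v\<close> there without any convexity. The 7 is 6 from
      \<open>wv\<close> plus 1 from the tolerance.\<close>
    have "\<exists>z. N \<le> n \<longrightarrow> z \<in> F (x s) \<and> norm (z - v) \<le> (2 * L + 7) * (1/2)^n" for n
    proof (cases "N \<le> n")
      case True
      have xX: "norm (x s - X n s) \<le> 2 * (1/2)^n" using x_close[of s n] sN[OF True] s by simp
      have "2 * (1/2::real)^n \<le> 2" by (simp add: power_le_one)
      then have "norm (x s - X n s) \<le> 2" using xX by linarith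
      then have "X n s \<in> cball 0 (norm (x s) + 2)"
        using norm_triangle_sub[of "X n s" "x s"] by (simp add: norm_minus_commute)
      moreover have "x s \<in> cball 0 (norm (x s) + 2)" by simp
      ultimately obtain z where z: "z \<in> F (x s)" "norm (u n - z) \<le> L * norm (X n s - x s)"
        using L w(3)[OF True] unfolding sv_lipschitz_on_def by blast
      have "norm (u n - z) \<le> L * (2 * (1/2)^n)"
        using z(2) mult_left_mono[OF xX L0] by (simp add: norm_minus_commute)
      moreover have "norm (z - v) \<le> norm (u n - z) + norm (w n - u n) + norm (v - w n)"
        using norm_triangle_ineq[of "z - u n" "u n - w n"] norm_triangle_ineq[of "z - w n" "w n - v"]
        by (simp add: norm_minus_commute)
      ultimately have "norm (z - v) \<le> L * (2 * (1/2)^n) + (1/2)^n + 6 * (1/2)^n"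
        using w(4)[OF True] wv[OF True] by linarith
      then show ?thesis using z(1) by (intro exI[of _ z]) (simp add: algebra_simps)
    qed simp
    then obtain z where z: "\<And>n. N \<le> n \<Longrightarrow> z n \<in> F (x s)"
      "\<And>n. N \<le> n \<Longrightarrow> norm (z n - v) \<le> (2 * L + 7) * (1/2)^n" by metis
    have "\<forall>\<^sub>F n in sequentially. norm (z n - v) \<le> (2 * L + 7) * (1/2)^n"
      unfolding eventually_sequentially using z(2) by blast
    then have "(\<lambda>n. z n - v) \<longlonglongrightarrow> 0" by (rule Lim_null_comparison[OF _ half0])
    then have "z \<longlonglongrightarrow> v" by (rule LIM_zero_cancel)
    moreover have "\<forall>\<^sub>F n in sequentially. z n \<in> F (x s)"
      unfolding eventually_sequentially using z(1) by blast
    ultimately have "v \<in> F (x s)"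
      using Lim_in_closed_set[OF compact_imp_closed[OF cpt]] by (metis trivial_limit_sequentially)
    then show ?thesis using der by blast
  qed
  have "AE s in lebesgue. s \<notin> insert 0 (\<Union>n. D n)"
  proof -
    have "countable (insert 0 (\<Union>n. D n))"
      using D(1) by (intro countable_insert countable_UN) (auto intro: countable_finite)
    then have "insert 0 (\<Union>n. D n) \<in> null_sets lebesgue"
      by (intro null_sets_completionI countable_imp_null_set_lborel)
    then show ?thesis by (rule AE_not_in)
  qed
  then have "AE s in lebesgue. 0 \<le> s \<longrightarrow> ereal s < ereal \<tau> \<longrightarrow>
      (\<exists>v\<in>F (x s). (x has_vector_derivative v) (at s within {s. 0 \<le> s \<and> ereal s < ereal \<tau>}))"
  proof (rule eventually_mono, intro impI)
    fix s assume "s \<notin> insert 0 (\<Union>n. D n)" "0 \<le> s" "ereal s < ereal \<tau>"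
    then show "\<exists>v\<in>F (x s). (x has_vector_derivative v) (at s within {s. 0 \<le> s \<and> ereal s < ereal \<tau>})"
      by (intro deriv) auto
  qed
  moreover have "0 < \<tau>" using t(1)[of 0] t_less[of 0] by linarith
  ultimately have "is_solution F (ereal \<tau>) x" unfolding is_solution_def using ac by auto
  then show ?thesis using that x_close by blast
qed

text \<open>The supremum of the reach times need not be attained, so \<open>s\<close> is taken as
  half of it. The last claim says that \<open>s\<close> is not too short: along a chain whose steps
  tend to 0, the reach times must tend to 0 as well.\<close>

lemma nearly_maximal_reach_time:
  fixes F :: "'a::euclidean_space \<Rightarrow> 'a set"
  assumes lip: "locally_lipschitz_setvalued F" and cpt: "\<And>\<xi>. compact (F \<xi>)"
    and nb: "\<not> reach_bounded F \<xi> T"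
  obtains s where "0 < s" "reach_bounded F \<xi> s" "\<And>S. reach_bounded F \<xi> S \<Longrightarrow> S \<le> 2 * s"
proof -
  define A where "A = {S. reach_bounded F \<xi> S}"
  obtain S\<^sub>0 where S\<^sub>0: "0 < S\<^sub>0" "S\<^sub>0 \<in> A"
    unfolding A_def using reach_bounded_local[OF lip cpt, of "norm \<xi>"] by auto
  have "S \<le> T" if "S \<in> A" for S
    using that nb reach_bounded_mono[of F \<xi> S T] unfolding A_def by force
  then have bdd: "bdd_above A" by (rule bdd_aboveI)
  define \<sigma> where "\<sigma> = Sup A"
  have upper: "S \<le> \<sigma>" if "S \<in> A" for S unfolding \<sigma>_def using that bdd by (rule cSup_upper)
  have "0 < \<sigma>" using upper[OF S\<^sub>0(2)] S\<^sub>0(1) by linarith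
  then obtain S where "S \<in> A" "\<sigma> / 2 < S"
    using less_cSup_iff[OF _ bdd, of "\<sigma> / 2"] S\<^sub>0(2) unfolding \<sigma>_def by auto
  then have "reach_bounded F \<xi> (\<sigma> / 2)"
    unfolding A_def using reach_bounded_mono[of F \<xi> S] by auto
  then show ?thesis using that[of "\<sigma> / 2"] \<open>0 < \<sigma>\<close> upper unfolding A_def by auto
qed

text \<open>The two bounds are those of \<open>polygonal_sol_refine_backward\<close> for an initial error of
  \<^term>\<open>2 * \<epsilon>\<close>.\<close>

definition small_tolerance where
  "small_tolerance F R t n \<epsilon> \<longleftrightarrow> (\<exists>L. sv_lipschitz_on L (cball 0 (R + 1)) F \<and>
     (2 * \<epsilon> + \<epsilon> * t) * exp (L * t) \<le> (1/2)^n \<and>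
     \<epsilon> + L * ((2 * \<epsilon> + \<epsilon> * t) * exp (L * t)) \<le> (1/2)^n)"

text \<open>Once \<open>L\<close> is fixed for the ball, both bounds are linear in
  \<open>\<epsilon>\<close>, with the factors \<open>C\<close> and \<open>1 + L * C\<close>;
  dividing by \<open>1 + C + L * C\<close> meets both.\<close>

lemma small_tolerance_exists:
  fixes F :: "'a::euclidean_space \<Rightarrow> 'a set"
  assumes lip: "locally_lipschitz_setvalued F" and cpt: "\<And>\<xi>. compact (F \<xi>)"
    and ne: "\<And>\<xi>. F \<xi> \<noteq> {}" and "0 \<le> t"
  obtains \<epsilon>\<^sub>0 where "0 < \<epsilon>\<^sub>0" "\<And>\<epsilon>. 0 < \<epsilon> \<Longrightarrow> \<epsilon> \<le> \<epsilon>\<^sub>0 \<Longrightarrow> small_tolerance F R t n \<epsilon>"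
proof -
  obtain L where L: "sv_lipschitz_on L (cball 0 (R + 1)) F"
    using sv_lipschitz_on_compact[OF lip cpt ne compact_cball] by blast
  then have L0: "0 \<le> L" unfolding sv_lipschitz_on_def by blast
  define C where "C = (2 + t) * exp (L * t)"
  have C: "0 \<le> C" "0 \<le> L * C" unfolding C_def using \<open>0 \<le> t\<close> L0 by simp_all
  show ?thesis
  proof
    show "0 < (1/2)^n / (1 + C + L * C)" using C by (intro divide_pos_pos) auto
    fix \<epsilon> assume \<epsilon>: "0 < \<epsilon>" "\<epsilon> \<le> (1/2)^n / (1 + C + L * C)"
    then have "\<epsilon> * (1 + C + L * C) \<le> (1/2)^n" using C by (simp add: pos_le_divide_eq)
    moreover have "0 \<le> \<epsilon> * C" "0 \<le> \<epsilon> * (L * C)" using C \<epsilon>(1) by simp_all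
    moreover have "(2 * \<epsilon> + \<epsilon> * t) * exp (L * t) = \<epsilon> * C" unfolding C_def by (simp add: algebra_simps)
    ultimately show "small_tolerance F R t n \<epsilon>"
      unfolding small_tolerance_def using L \<epsilon>(1) by (intro exI[of _ L]) (simp add: algebra_simps)
  qed
qed

lemma small_tolerance_le:
  assumes "small_tolerance F R t n \<epsilon>" "0 \<le> t" "0 < \<epsilon>"
  shows "\<epsilon> \<le> (1/2)^n"
proof -
  obtain L where L: "sv_lipschitz_on L (cball 0 (R + 1)) F" "\<epsilon> + L * ((2 * \<epsilon> + \<epsilon> * t) * exp (L * t)) \<le> (1/2)^n"
    using assms(1) unfolding small_tolerance_def by blast
  have "0 \<le> L" using L(1) unfolding sv_lipschitz_on_def by blast
  then have "0 \<le> L * ((2 * \<epsilon> + \<epsilon> * t) * exp (L * t))" using assms by simp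
  then show ?thesis using L(2) by linarith
qed

text \<open>\<^term>\<open>x\<close> is corrected backwards in time so that it ends where a continuation towards
  \<^term>\<open>\<eta>\<close> starts. A forward correction of the continuation would not do, since the errors
  accumulated over infinitely many steps could be amplified without bound.\<close>

lemma extend_polygonal_sol:
  fixes F :: "'a::euclidean_space \<Rightarrow> 'a set"
  assumes lip: "locally_lipschitz_setvalued F" and cpt: "\<And>\<xi>. compact (F \<xi>)"
    and ne: "\<And>\<xi>. F \<xi> \<noteq> {}"
    and nb: "\<not> reach_bounded F \<xi> T" and "0 \<le> t" "0 < \<epsilon>"
    and sol: "polygonal_sol F \<epsilon> 0 t x" and R: "\<And>s. s \<in> {0..t} \<Longrightarrow> norm (x s) \<le> R"
    and near: "norm (x t - \<xi>) \<le> \<epsilon>" and small: "small_tolerance F R t n \<epsilon>"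
  obtains \<eta> s R' y \<epsilon>' where "\<not> reach_bounded F \<eta> (T - s)" "0 < s"
    "\<And>S. reach_bounded F \<xi> S \<Longrightarrow> S \<le> 2 * s" "0 < \<epsilon>'"
    "polygonal_sol F \<epsilon>' 0 (t + s) y" "\<And>r. r \<in> {0..t + s} \<Longrightarrow> norm (y r) \<le> R'"
    "norm (y (t + s) - \<eta>) \<le> \<epsilon>'" "small_tolerance F R' (t + s) (Suc n) \<epsilon>'"
    "\<And>r. r \<in> {0..t} \<Longrightarrow> norm (y r - x r) \<le> (1/2)^n"
    "((1/2)^n)-lipschitz_on {0..t} (\<lambda>r. y r - x r)"
proof -
  obtain s where s: "0 < s" "reach_bounded F \<xi> s" "\<And>S. reach_bounded F \<xi> S \<Longrightarrow> S \<le> 2 * s"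
    using nearly_maximal_reach_time[OF lip cpt nb] by blast
  obtain e M where e: "0 < e" and M: "\<And>u b. 0 \<le> b \<Longrightarrow> b \<le> s \<Longrightarrow>
     polygonal_sol F e 0 b u \<Longrightarrow> norm (u 0 - \<xi>) \<le> e \<Longrightarrow> norm (u b) \<le> M"
    using s(2) unfolding reach_bounded_def by blast
  obtain \<eta> where \<eta>: "\<not> reach_bounded F \<eta> (T - s)"
    "\<And>\<epsilon>. 0 < \<epsilon> \<Longrightarrow> \<exists>u. polygonal_sol F \<epsilon> 0 s u \<and> norm (u 0 - \<xi>) \<le> \<epsilon> \<and> norm (u s - \<eta>) \<le> \<epsilon>"
    using not_reach_bounded_step[OF nb s(2) less_imp_le[OF s(1)]] by blast
  \<comment> \<open>The tolerance has to suit a bound on the new curve, yet the curve is selected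
    only after the tolerance. There is no circle: \<open>M\<close> bounds every continuation whose
    tolerance and initial distance from \<open>\<xi>\<close> are at most \<open>e\<close>, and the
    correction moves the old part by at most 1.\<close>
  define R' where "R' = R + 1 + \<bar>M\<bar>"
  obtain \<epsilon>\<^sub>0 where \<epsilon>\<^sub>0: "0 < \<epsilon>\<^sub>0" "\<And>\<epsilon>. 0 < \<epsilon> \<Longrightarrow> \<epsilon> \<le> \<epsilon>\<^sub>0 \<Longrightarrow> small_tolerance F R' (t + s) (Suc n) \<epsilon>"
    using small_tolerance_exists[OF lip cpt ne, of "t + s"] \<open>0 \<le> t\<close> s(1) by (metis add_nonneg_nonneg less_imp_le)
  define \<epsilon>' where "\<epsilon>' = min \<epsilon> (min e \<epsilon>\<^sub>0)"
  have \<epsilon>': "0 < \<epsilon>'" "\<epsilon>' \<le> \<epsilon>" "\<epsilon>' \<le> e" "\<epsilon>' \<le> \<epsilon>\<^sub>0"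
    unfolding \<epsilon>'_def using \<open>0 < \<epsilon>\<close> e \<epsilon>\<^sub>0(1) by auto
  obtain u where u: "polygonal_sol F \<epsilon>' 0 s u" "norm (u 0 - \<xi>) \<le> \<epsilon>'" "norm (u s - \<eta>) \<le> \<epsilon>'"
    using \<eta>(2)[OF \<epsilon>'(1)] by blast
  have u_bound: "norm (u b) \<le> M" if "0 \<le> b" "b \<le> s" for b
    using that u(2) \<epsilon>'(3)
    by (intro M polygonal_sol_mono[OF polygonal_sol_subinterval[OF u(1)]]) auto
  obtain L where L: "sv_lipschitz_on L (cball 0 (R + 1)) F"
     "(2 * \<epsilon> + \<epsilon> * t) * exp (L * t) \<le> (1/2)^n"
     "\<epsilon> + L * ((2 * \<epsilon> + \<epsilon> * t) * exp (L * t)) \<le> (1/2)^n"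
    using small unfolding small_tolerance_def by blast
  obtain B where B: "\<And>p v. p \<in> cball 0 (R + 1) \<Longrightarrow> v \<in> F p \<Longrightarrow> norm v \<le> B"
    using sv_bounded_on_compact[OF lip cpt compact_cball] by blast
  \<comment> \<open>The old curve ends within \<open>\<epsilon>\<close> of \<open>\<xi>\<close> and
    the continuation starts within \<open>\<epsilon>'\<close> of it; hence the initial error
    \<open>2 * \<epsilon>\<close> in \<open>small_tolerance\<close>.\<close>
  have gap: "norm (u 0 - x t) \<le> 2 * \<epsilon>"
    using u(2) near \<epsilon>'(2) norm_triangle_ineq4[of "u 0 - \<xi>" "x t - \<xi>"] by simp
  define E where "E = (2 * \<epsilon> + \<epsilon> * (t - 0)) * exp (L * (t - 0))"
  have E: "E \<le> (1/2)^n" "\<epsilon> + L * E \<le> (1/2)^n" unfolding E_def using L(2,3) by simp_all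
  moreover have "(1/2::real)^n \<le> 1" by (simp add: power_le_one)
  ultimately have "E \<le> 1" by linarith
  then have "\<exists>z. polygonal_sol F \<epsilon>' 0 t z \<and> z t = u 0 \<and> (\<forall>s\<in>{0..t}. norm (z s - x s) \<le> E) \<and>
    (\<epsilon> + L * E)-lipschitz_on {0..t} (\<lambda>s. z s - x s)"
    using gap R \<open>0 < \<epsilon>\<close> \<epsilon>'(1)
    by (intro polygonal_sol_refine_backward[OF sol \<open>0 \<le> t\<close> L(1) B _ _ _ _ E_def]) auto
  then obtain z where z: "polygonal_sol F \<epsilon>' 0 t z" "z t = u 0"
    "\<And>r. r \<in> {0..t} \<Longrightarrow> norm (z r - x r) \<le> E" "(\<epsilon> + L * E)-lipschitz_on {0..t} (\<lambda>r. z r - x r)"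
    by blast
  define y where "y r = (if r \<le> t then z r else u (r + - t))" for r
  show ?thesis
  proof
    show "\<not> reach_bounded F \<eta> (T - s)" "0 < s" "0 < \<epsilon>'" by fact+
    show "S \<le> 2 * s" if "reach_bounded F \<xi> S" for S using s(3)[OF that] .
    have "polygonal_sol F \<epsilon>' t (t + s) (\<lambda>r. u (r + - t))"
      by (rule polygonal_sol_shift) (use u(1) in simp)
    then show "polygonal_sol F \<epsilon>' 0 (t + s) y"
      unfolding y_def using z(1,2) \<open>0 \<le> t\<close> s(1) by (intro polygonal_sol_glue) auto
    show "norm (y r) \<le> R'" if r: "r \<in> {0..t + s}" for r
    proof (cases "r \<le> t")
      case True
      then have "norm (z r) \<le> R + 1"
        using z(3)[of r] R[of r] r \<open>E \<le> 1\<close> norm_triangle_sub[of "z r" "x r"] by simp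
      then show ?thesis unfolding y_def R'_def using True by simp
    next
      case False
      have "0 \<le> R" using R[of 0] \<open>0 \<le> t\<close> norm_ge_zero[of "x 0"] by (simp del: norm_ge_zero)
      then show ?thesis
        unfolding y_def R'_def using False r u_bound[of "r + - t"] by auto
    qed
    show "norm (y (t + s) - \<eta>) \<le> \<epsilon>'" unfolding y_def using u(3) s(1) by simp
    show "small_tolerance F R' (t + s) (Suc n) \<epsilon>'" by (rule \<epsilon>\<^sub>0(2)[OF \<epsilon>'(1,4)])
    show "norm (y r - x r) \<le> (1/2)^n" if "r \<in> {0..t}" for r
      unfolding y_def using z(3)[OF that] E(1) that by auto
    show "((1/2)^n)-lipschitz_on {0..t} (\<lambda>r. y r - x r)"
      using lipschitz_on_mono[OF z(4) order_refl E(2)]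
      by (rule lipschitz_on_transform) (simp add: y_def)
  qed
qed

lemma forward_complete_imp_reach_bounded:
  fixes F :: "'a::euclidean_space \<Rightarrow> 'a set"
  assumes lip: "locally_lipschitz_setvalued F" and cpt: "\<And>\<xi>. compact (F \<xi>)"
    and ne: "\<And>\<xi>. F \<xi> \<noteq> {}" and complete: "forward_complete F"
  shows "reach_bounded F \<xi> T"
proof (rule ccontr)
  assume nb: "\<not> reach_bounded F \<xi> T"
  \<comment> \<open>The state of the chain: target point, elapsed time, bound, curve ending near the
    target, tolerance. The bound \<open>R\<close> is carried along because the next correction takes
    its Lipschitz constant on a ball containing the curve.\<close>
  define P where "P n = (\<lambda>(\<xi>, t, R, x, \<epsilon>). \<not> reach_bounded F \<xi> (T - t) \<and> 0 \<le> t \<and> 0 < \<epsilon> \<and>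
      polygonal_sol F \<epsilon> 0 t x \<and> (\<forall>s\<in>{0..t}. norm (x s) \<le> R) \<and> norm (x t - \<xi>) \<le> \<epsilon> \<and>
      small_tolerance F R t n \<epsilon>)" for n :: nat
  define Q where "Q n = (\<lambda>(\<xi>, t, R :: real, x :: real \<Rightarrow> 'a, \<epsilon> :: real) (\<xi>' :: 'a, t', R' :: real, x', \<epsilon>' :: real).
      t < t' \<and> (\<forall>S. reach_bounded F \<xi> S \<longrightarrow> S \<le> 2 * (t' - t)) \<and>
      (\<forall>s\<in>{0..t}. norm (x' s - x s) \<le> (1/2)^n) \<and>
      ((1/2)^n)-lipschitz_on {0..t} (\<lambda>s. x' s - x s))" for n :: nat
  have "\<exists>f. \<forall>n. P n (f n) \<and> Q n (f n) (f (Suc n))"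
  proof (rule dependent_nat_choice)
    obtain \<epsilon>\<^sub>0 where \<epsilon>\<^sub>0: "0 < \<epsilon>\<^sub>0" "\<And>\<epsilon>. 0 < \<epsilon> \<Longrightarrow> \<epsilon> \<le> \<epsilon>\<^sub>0 \<Longrightarrow> small_tolerance F (norm \<xi>) 0 0 \<epsilon>"
      using small_tolerance_exists[OF lip cpt ne order_refl] by blast
    obtain u where "u \<in> F \<xi>" using ne by blast
    then have "polygonal_sol F \<epsilon>\<^sub>0 0 0 (\<lambda>_. \<xi>)"
      using \<epsilon>\<^sub>0(1) by (intro segment_sol_imp_polygonal_sol segment_solI[where w = u]) force+
    then have "P 0 (\<xi>, 0, norm \<xi>, \<lambda>_. \<xi>, \<epsilon>\<^sub>0)"
      unfolding P_def using nb \<epsilon>\<^sub>0 by simp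
    then show "\<exists>z. P 0 z" by blast
  next
    fix z n assume Pz: "P n z"
    obtain \<xi> t R x \<epsilon> where z: "z = (\<xi>, t, R, x, \<epsilon>)" by (cases z) blast
    have inv: "\<not> reach_bounded F \<xi> (T - t)" "0 \<le> t" "0 < \<epsilon>" "polygonal_sol F \<epsilon> 0 t x"
      "\<And>s. s \<in> {0..t} \<Longrightarrow> norm (x s) \<le> R" "norm (x t - \<xi>) \<le> \<epsilon>" "small_tolerance F R t n \<epsilon>"
      using Pz unfolding P_def z by auto
    show "\<exists>z'. P (Suc n) z' \<and> Q n z z'"
    proof (rule extend_polygonal_sol[OF lip cpt ne inv])
      fix \<eta> s R' y \<epsilon>'
      assume y: "\<not> reach_bounded F \<eta> (T - t - s)" "0 < s"
      "\<And>S. reach_bounded F \<xi> S \<Longrightarrow> S \<le> 2 * s" "0 < \<epsilon>'"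
      "polygonal_sol F \<epsilon>' 0 (t + s) y" "\<And>r. r \<in> {0..t + s} \<Longrightarrow> norm (y r) \<le> R'"
      "norm (y (t + s) - \<eta>) \<le> \<epsilon>'" "small_tolerance F R' (t + s) (Suc n) \<epsilon>'"
      "\<And>r. r \<in> {0..t} \<Longrightarrow> norm (y r - x r) \<le> (1/2)^n"
      "((1/2)^n)-lipschitz_on {0..t} (\<lambda>r. y r - x r)"
      have "P (Suc n) (\<eta>, t + s, R', y, \<epsilon>')"
        unfolding P_def using y inv(2) by (simp add: diff_diff_eq)
      moreover have "Q n z (\<eta>, t + s, R', y, \<epsilon>')"
        unfolding Q_def z using y(2,3,9,10) by simp
      ultimately show "\<exists>z'. P (Suc n) z' \<and> Q n z z'" by blast
    qed
  qed
  then obtain f where f: "\<And>n. P n (f n)" "\<And>n. Q n (f n) (f (Suc n))" by blast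
  define \<zeta> t R X \<epsilon> where "\<zeta> n = fst (f n)" and "t n = fst (snd (f n))" and "R n = fst (snd (snd (f n)))"
    and "X n = fst (snd (snd (snd (f n))))" and "\<epsilon> n = snd (snd (snd (snd (f n))))" for n
  have f_eq: "f n = (\<zeta> n, t n, R n, X n, \<epsilon> n)" for n
    unfolding \<zeta>_def t_def R_def X_def \<epsilon>_def by simp
  have inv: "\<not> reach_bounded F (\<zeta> n) (T - t n)" "0 \<le> t n" "0 < \<epsilon> n" "polygonal_sol F (\<epsilon> n) 0 (t n) (X n)"
    "norm (X n (t n) - \<zeta> n) \<le> \<epsilon> n" "small_tolerance F (R n) (t n) n (\<epsilon> n)" for n
    using f(1)[of n] unfolding P_def f_eq by auto
  have step: "t n < t (Suc n)" "\<And>S. reach_bounded F (\<zeta> n) S \<Longrightarrow> S \<le> 2 * (t (Suc n) - t n)"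
    "\<And>s. s \<in> {0..t n} \<Longrightarrow> norm (X (Suc n) s - X n s) \<le> (1/2)^n"
    "((1/2)^n)-lipschitz_on {0..t n} (\<lambda>s. X (Suc n) s - X n s)" for n
    using f(2)[of n] unfolding Q_def f_eq by auto
  have \<epsilon>_le: "\<epsilon> n \<le> (1/2)^n" for n
    using small_tolerance_le inv by blast
  \<comment> \<open>Reach is bounded for nonpositive time, so the invariant keeps the times below
    \<open>T\<close>; being increasing, they converge.\<close>
  have "t n \<le> T" for n
  proof (rule ccontr)
    assume "\<not> t n \<le> T"
    then have "reach_bounded F (\<zeta> n) (T - t n)" by (intro reach_bounded_mono[OF reach_bounded_0]) auto
    then show False using inv(1) by blast
  qed
  moreover have "incseq t" using step(1) by (intro incseq_SucI less_imp_le)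
  ultimately obtain \<tau> where \<tau>: "t \<longlonglongrightarrow> \<tau>" using incseq_convergent by blast
  obtain x where x: "is_solution F (ereal \<tau>) x" "\<And>n s. 0 \<le> s \<Longrightarrow> s \<le> t n \<Longrightarrow> norm (x s - X n s) \<le> 2 * (1/2)^n"
    by (rule limit_of_polygonal_sols[OF lip cpt ne inv(2) step(1) \<tau>
        polygonal_sol_mono[OF inv(4) \<epsilon>_le] step(3) step(4)]) (simp, blast)
  have t_less: "t n < \<tau>" for n
    using step(1)[of n] incseq_le[OF \<open>incseq t\<close> \<tau>, of "Suc n"] by linarith
  \<comment> \<open>Convergence of \<open>t\<close> makes the steps tend to 0, while each step is at
    least half of every reach time of \<open>\<zeta> n\<close>. On a ball one positive reach time
    \<open>S\<close> is common to all points, so the chain cannot stay there.\<close>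
  have escape: "\<exists>n. r < norm (\<zeta> n)" for r
  proof -
    obtain S where S: "0 < S" "\<And>\<xi>. norm \<xi> \<le> r \<Longrightarrow> reach_bounded F \<xi> S"
      using reach_bounded_local[OF lip cpt] by blast
    have "(\<lambda>n. 2 * (t (Suc n) - t n)) \<longlonglongrightarrow> 2 * (\<tau> - \<tau>)"
      using \<tau> by (intro tendsto_intros LIMSEQ_Suc)
    then have "\<forall>\<^sub>F n in sequentially. 2 * (t (Suc n) - t n) < S"
      using S(1) by (intro order_tendstoD(2)) auto
    then obtain n where "2 * (t (Suc n) - t n) < S" unfolding eventually_sequentially by blast
    then have "\<not> norm (\<zeta> n) \<le> r" using S(2) step(2) by force
    then show ?thesis by (intro exI[of _ n]) simp
  qed
  \<comment> \<open>An extension past \<open>\<tau>\<close> would be continuous, hence bounded, on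
    \<open>{0..\<tau>}\<close>. But it passes within 3 of every \<open>\<zeta> n\<close>: at most 2
    from the limit and 1 from the tolerance.\<close>
  have "\<not> (\<exists>T' x'. ereal \<tau> < T' \<and> is_solution F T' x' \<and> (\<forall>s. 0 \<le> s \<and> ereal s < ereal \<tau> \<longrightarrow> x' s = x s))"
  proof
    assume "\<exists>T' x'. ereal \<tau> < T' \<and> is_solution F T' x' \<and> (\<forall>s. 0 \<le> s \<and> ereal s < ereal \<tau> \<longrightarrow> x' s = x s)"
    then obtain T' x' where x': "ereal \<tau> < T'" "is_solution F T' x'" "\<And>s. 0 \<le> s \<Longrightarrow> s < \<tau> \<Longrightarrow> x' s = x s"
      by auto
    have "0 \<le> \<tau>" using inv(2)[of 0] t_less[of 0] by linarith
    then have "abs_continuous_on_interval 0 \<tau> x'"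
      using x'(1,2) unfolding is_solution_def by blast
    then have "continuous_on {0..\<tau>} x'" by (rule abs_continuous_on_interval_imp_continuous_on)
    then have "bounded (x' ` {0..\<tau>})" by (intro compact_imp_bounded compact_continuous_image) auto
    then obtain B where B: "\<And>s. s \<in> {0..\<tau>} \<Longrightarrow> norm (x' s) \<le> B" unfolding bounded_iff by blast
    obtain n where n: "B + 3 < norm (\<zeta> n)" using escape by blast
    have "norm (x (t n)) \<le> B" using B[of "t n"] x'(3)[of "t n"] inv(2)[of n] t_less[of n] by simp
    moreover have "(1/2::real)^n \<le> 1" by (simp add: power_le_one)
    moreover have "norm (x (t n) - X n (t n)) \<le> 2 * (1/2)^n" using x(2) inv(2) by simp
    moreover have "norm (X n (t n) - \<zeta> n) \<le> (1/2)^n" using inv(5) \<epsilon>_le order_trans by blast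
    moreover have "norm (\<zeta> n) \<le> norm (x (t n)) + norm (x (t n) - X n (t n)) + norm (X n (t n) - \<zeta> n)"
      using norm_triangle_sub[of "\<zeta> n" "X n (t n)"] norm_triangle_sub[of "X n (t n)" "x (t n)"]
      by (simp add: norm_minus_commute)
    ultimately show False using n by linarith
  qed
  then have "(ereal \<tau>, x) \<in> maximal_solutions F" unfolding maximal_solutions_def using x(1) by blast
  then show False using complete unfolding forward_complete_def by auto
qed

text \<open>Null sets of exceptional times are handled by absolute continuity: they are covered by
  a small open set, and the intervals of the subdivision inside it are collected in \<^term>\<open>I\<close>.\<close>

lemma polygonal_sol_shadowing:
  fixes F :: "'a::real_normed_vector \<Rightarrow> 'a set"
  assumes lip: "sv_lipschitz_on L (cball 0 (R + 1)) F"
    and bound: "\<And>p u. p \<in> cball 0 (R + 1) \<Longrightarrow> u \<in> F p \<Longrightarrow> norm u \<le> M" and "0 \<le> M"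
    and ne: "\<And>p. F p \<noteq> {}"
    and ac: "abs_continuous_on_interval 0 b x" and "0 \<le> b"
    and null: "N \<in> null_sets lebesgue"
    and deriv: "\<And>t. t \<in> {0..b} - N \<Longrightarrow> \<exists>v\<in>F (x t). (x has_vector_derivative v) (at t within {0..b})"
    and R: "\<And>s. s \<in> {0..b} \<Longrightarrow> norm (x s) \<le> R" and "0 < \<epsilon>"
  obtains y where "polygonal_sol F \<epsilon> 0 b y" "y 0 = x 0" "norm (y b - x b) \<le> 1"
proof -
  have L0: "0 \<le> L" using lip unfolding sv_lipschitz_on_def by blast
  \<comment> \<open>The error budget in units of \<open>e\<close>: \<open>(L + 1) * b\<close> for
    the intervals around times of differentiability, 1 for the variation of \<open>x\<close> over
    the exceptional intervals, and \<open>M\<close> for the movement of the new curve there.\<close>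
  define \<kappa> where "\<kappa> = (L + 1) * b + 1 + M"
  have \<kappa>: "0 < \<kappa>" unfolding \<kappa>_def using L0 \<open>0 \<le> b\<close> \<open>0 \<le> M\<close>
    by (intro add_pos_nonneg add_nonneg_pos mult_nonneg_nonneg) auto
  define e where "e = 1 / (2 * \<kappa> * exp (L * b))"
  have e: "0 < e" "(e * \<kappa>) * exp (L * b) = 1 / 2"
    unfolding e_def using \<kappa> by (simp_all add: field_simps)
  \<comment> \<open>One \<open>e\<close> for the remainder of the derivative, and
    \<open>L * e\<close> for choosing the velocity at the left end of an interval instead of at the
    time of differentiability.\<close>
  define \<epsilon>\<^sub>1 where "\<epsilon>\<^sub>1 = (L + 1) * e"
  have \<epsilon>\<^sub>1: "0 \<le> \<epsilon>\<^sub>1" unfolding \<epsilon>\<^sub>1_def using L0 e by simp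
  obtain \<delta>\<^sub>0 where \<delta>\<^sub>0: "0 < \<delta>\<^sub>0" "\<And>I. finite I \<Longrightarrow> (\<forall>(u, v)\<in>I. 0 \<le> u \<and> u \<le> v \<and> v \<le> b) \<Longrightarrow>
      pairwise (\<lambda>p q. disjnt {fst p<..<snd p} {fst q<..<snd q}) I \<Longrightarrow>
      (\<Sum>(u, v)\<in>I. v - u) < \<delta>\<^sub>0 \<Longrightarrow> (\<Sum>(u, v)\<in>I. norm (x v - x u)) < e"
    using ac[unfolded abs_continuous_on_interval_def, rule_format, OF \<open>0 < e\<close>] by blast
  define \<delta> where "\<delta> = min \<delta>\<^sub>0 e"
  have \<delta>: "0 < \<delta>" "\<delta> \<le> \<delta>\<^sub>0" "\<delta> \<le> e" unfolding \<delta>_def using \<delta>\<^sub>0(1) e by auto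
  obtain G where G: "open G" "N \<subseteq> G" "G \<in> lmeasurable" "measure lebesgue G < \<delta>"
  proof -
    obtain G where G: "open G" "N \<subseteq> G" "G - N \<in> lmeasurable" "emeasure lebesgue (G - N) < ennreal \<delta>"
      using sets_lebesgue_outer_open[OF null_setsD2[OF null] \<delta>(1)] by blast
    have "measure lebesgue (G - N) < \<delta>"
      using G(4) unfolding emeasure_eq_measure2[OF G(3)] by (simp add: ennreal_less_iff)
    moreover have eq: "emeasure lebesgue (G - N) = emeasure lebesgue G"
      using G(1) null by (intro emeasure_Diff_null_set) auto
    ultimately have "measure lebesgue G < \<delta>" by (simp add: measure_def)
    moreover have "G \<in> lmeasurable"
      using G(1) fmeasurableD2[OF G(3)] eq by (intro fmeasurableI) (auto simp: less_top)
    ultimately show ?thesis using that G(1,2) by blast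
  qed
  have meas: "G \<inter> {c..<d} \<in> lmeasurable" for c d :: real
    using G(3) by (intro fmeasurable_Int_fmeasurable) auto
  \<comment> \<open>Half-open intervals make this exactly additive under concatenation.\<close>
  define \<mu> where "\<mu> c d = measure lebesgue (G \<inter> {c..<d})" for c d
  have \<mu>_nonneg: "0 \<le> \<mu> c d" for c d unfolding \<mu>_def by simp
  have \<mu>_add: "\<mu> c d + \<mu> d k = \<mu> c k" if "c \<le> d" "d \<le> k" for c d k
  proof -
    have "G \<inter> {c..<k} = (G \<inter> {c..<d}) \<union> (G \<inter> {d..<k})" using that by auto
    moreover have "(G \<inter> {c..<d}) \<inter> (G \<inter> {d..<k}) = {}" by auto
    ultimately show ?thesis
      unfolding \<mu>_def using measure_Un2[OF meas[of c d] meas[of d k]] by (simp add: Diff_triv Int_commute)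
  qed
  have "uniformly_continuous_on {0..b} x"
    using abs_continuous_on_interval_imp_continuous_on[OF ac]
    by (rule compact_uniformly_continuous) simp
  then obtain h\<^sub>0 where h\<^sub>0: "0 < h\<^sub>0"
    "\<And>s r. s \<in> {0..b} \<Longrightarrow> r \<in> {0..b} \<Longrightarrow> dist r s < h\<^sub>0 \<Longrightarrow> dist (x r) (x s) < e"
    using \<open>0 < e\<close> unfolding uniformly_continuous_on_def by metis
  \<comment> \<open>Three demands on the mesh: \<open>x\<close> varies by less than
    \<open>e\<close>, a constant velocity stays within the tolerance \<open>\<epsilon>\<close>, and
    the new curve moves by at most 1/2, so that starting within 1/2 of \<open>x\<close> it remains
    in the ball of radius \<open>R + 1\<close>.\<close>
  define h where "h = min h\<^sub>0 (min (\<epsilon> / (L * M + 1)) (1 / (2 * (M + 1))))"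
  have LM: "0 < L * M + 1" using L0 \<open>0 \<le> M\<close> by (simp add: add_nonneg_pos)
  have h: "0 < h" "h \<le> h\<^sub>0" "L * M * h \<le> \<epsilon>" "M * h \<le> 1/2"
  proof -
    show "0 < h" "h \<le> h\<^sub>0" unfolding h_def using h\<^sub>0(1) \<open>0 < \<epsilon>\<close> LM \<open>0 \<le> M\<close> by auto
    have "h * (L * M + 1) \<le> \<epsilon>"
      using LM unfolding h_def by (simp add: min_le_iff_disj flip: pos_le_divide_eq)
    then show "L * M * h \<le> \<epsilon>" using \<open>0 < h\<close> by (simp add: algebra_simps)
    have "h * (2 * (M + 1)) \<le> 1"
      using \<open>0 \<le> M\<close> unfolding h_def by (simp add: min_le_iff_disj flip: pos_le_divide_eq)
    then show "M * h \<le> 1/2" using \<open>0 < h\<close> by (simp add: algebra_simps)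
  qed
  have linear: "polygonal_sol F \<epsilon> c d (\<lambda>s. \<xi> + (s - c) *\<^sub>R w)"
    if \<xi>: "norm \<xi> \<le> R + 1/2" and w: "w \<in> F \<xi>" and "d - c < h" for c d \<xi> w
  proof (intro segment_sol_imp_polygonal_sol segment_solI)
    fix s assume s: "c \<le> s" "s \<le> d"
    have \<xi>': "\<xi> \<in> cball 0 (R + 1)" using \<xi> by simp
    have "norm ((s - c) *\<^sub>R w) \<le> h * M"
      using s \<open>d - c < h\<close> bound[OF \<xi>' w] h(1) by (auto intro!: mult_mono)
    then have step: "norm ((s - c) *\<^sub>R w) \<le> M * h" by (simp add: mult.commute)
    then have "\<xi> + (s - c) *\<^sub>R w \<in> cball 0 (R + 1)"
      using \<xi> h(4) norm_triangle_ineq[of \<xi> "(s - c) *\<^sub>R w"] by simp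
    then obtain u where u: "u \<in> F (\<xi> + (s - c) *\<^sub>R w)" "norm (w - u) \<le> L * norm (\<xi> - (\<xi> + (s - c) *\<^sub>R w))"
      using lip \<xi>' w unfolding sv_lipschitz_on_def by blast
    have "norm (w - u) \<le> L * (M * h)"
      using u(2) mult_left_mono[OF step L0] by simp
    then show "\<exists>u\<in>F (\<xi> + (s - c) *\<^sub>R w). norm (w - u) \<le> \<epsilon>"
      using u(1) h(3) by (intro bexI[of _ u]) (simp_all add: mult.assoc)
  qed simp
  \<comment> \<open>On an exceptional interval the error need not be small relative to the length.
    It is charged as variation of \<open>x\<close> plus movement of the new curve, and only the sum
    over all of \<open>I\<close> is estimated, at the very end.\<close>
  define V where "V I = (\<Sum>(u, v)\<in>I. norm (x v - x u) + M * (v - u))" for I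
  \<comment> \<open>The strict \<open>u < v\<close> keeps the families of adjacent intervals
    disjoint as sets of pairs, so that \<open>V\<close> adds up.\<close>
  define good where "good c d I \<longleftrightarrow> finite I \<and> (\<forall>(u, v)\<in>I. c \<le> u \<and> u < v \<and> v \<le> d) \<and>
      pairwise (\<lambda>p q. disjnt {fst p<..<snd p} {fst q<..<snd q}) I \<and> (\<Sum>(u, v)\<in>I. v - u) \<le> \<mu> c d"
    for c d :: real and I
  define B where "B a t V = (a + \<epsilon>\<^sub>1 * t + V) * exp (L * t)" for a t V
  \<comment> \<open>The family \<open>I\<close> is fixed before the start and the error bound, and
    smallness enters as a hypothesis, since nothing is known about the size of \<open>V I\<close>
    during the induction.\<close>
  define Q where "Q c d \<longleftrightarrow> (\<exists>I. good c d I \<and> (\<forall>\<xi> a. norm (\<xi> - x c) \<le> a \<longrightarrow> B a (d - c) (V I) \<le> 1/2 \<longrightarrow>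
      (\<exists>y. polygonal_sol F \<epsilon> c d y \<and> y c = \<xi> \<and> norm (y d - x d) \<le> B a (d - c) (V I))))" for c d
  have V_nonneg: "0 \<le> V I" if "good c d I" for c d I
    unfolding V_def using that \<open>0 \<le> M\<close> unfolding good_def
    by (intro sum_nonneg) (force intro!: add_nonneg_nonneg mult_nonneg_nonneg)
  have B_lower: "a + \<epsilon>\<^sub>1 * t + v \<le> B a t v" if "0 \<le> a" "0 \<le> t" "0 \<le> v" for a t v
  proof -
    have "(a + \<epsilon>\<^sub>1 * t + v) * 1 \<le> (a + \<epsilon>\<^sub>1 * t + v) * exp (L * t)"
      using that \<epsilon>\<^sub>1 L0 by (intro mult_left_mono) auto
    then show ?thesis unfolding B_def by simp
  qed
  define P where "P c d \<longleftrightarrow> (0 \<le> c \<longrightarrow> d \<le> b \<longrightarrow> Q c d)" for c d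
  have "P 0 b" using \<open>0 \<le> b\<close>
  proof (induction rule: Bolzano)
    case (trans c d k)
    show ?case
      unfolding P_def
    proof (intro impI)
      assume "0 \<le> c" "k \<le> b"
      then have "Q c d" "Q d k" using trans by (simp_all add: P_def)
      from \<open>Q c d\<close> obtain I where I: "good c d I"
        "\<And>\<xi> a. norm (\<xi> - x c) \<le> a \<Longrightarrow> B a (d - c) (V I) \<le> 1/2 \<Longrightarrow>
          \<exists>y. polygonal_sol F \<epsilon> c d y \<and> y c = \<xi> \<and> norm (y d - x d) \<le> B a (d - c) (V I)"
        unfolding Q_def by blast
      from \<open>Q d k\<close> obtain J where J: "good d k J"
        "\<And>\<xi> a. norm (\<xi> - x d) \<le> a \<Longrightarrow> B a (k - d) (V J) \<le> 1/2 \<Longrightarrow>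
          \<exists>y. polygonal_sol F \<epsilon> d k y \<and> y d = \<xi> \<and> norm (y k - x k) \<le> B a (k - d) (V J)"
        unfolding Q_def by blast
      have IJ: "I \<inter> J = {}" using I(1) J(1) unfolding good_def by force
      then have V_Un: "V (I \<union> J) = V I + V J"
        unfolding V_def using I(1) J(1) unfolding good_def by (intro sum.union_disjoint) auto
      have I_le: "u < v \<and> c \<le> u \<and> v \<le> d" if "(u, v) \<in> I" for u v
        using I(1) that unfolding good_def by blast
      have J_le: "u < v \<and> d \<le> u \<and> v \<le> k" if "(u, v) \<in> J" for u v
        using J(1) that unfolding good_def by blast
      have "good c k (I \<union> J)"
        unfolding good_def
      proof (intro conjI)
        show "finite (I \<union> J)" using I(1) J(1) unfolding good_def by blast
        show "\<forall>(u, v)\<in>I \<union> J. c \<le> u \<and> u < v \<and> v \<le> k" using I_le J_le trans(3,4) by fastforce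
        have "disjnt {fst p<..<snd p} {fst q<..<snd q}" if "p \<in> I" "q \<in> J" for p q
          using I_le[of "fst p" "snd p"] J_le[of "fst q" "snd q"] that by (auto simp: disjnt_def)
        then show "pairwise (\<lambda>p q. disjnt {fst p<..<snd p} {fst q<..<snd q}) (I \<union> J)"
          using I(1) J(1) unfolding good_def pairwise_def by (metis Un_iff disjnt_sym)
        have "(\<Sum>(u, v)\<in>I \<union> J. v - u) = (\<Sum>(u, v)\<in>I. v - u) + (\<Sum>(u, v)\<in>J. v - u)"
          using IJ I(1) J(1) unfolding good_def by (intro sum.union_disjoint) auto
        then show "(\<Sum>(u, v)\<in>I \<union> J. v - u) \<le> \<mu> c k"
          using I(1) J(1) \<mu>_add[OF trans(3,4)] unfolding good_def by linarith
      qed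
      moreover have "\<exists>y. polygonal_sol F \<epsilon> c k y \<and> y c = \<xi> \<and> norm (y k - x k) \<le> B a (k - c) (V (I \<union> J))"
        if \<xi>: "norm (\<xi> - x c) \<le> a" and small: "B a (k - c) (V (I \<union> J)) \<le> 1/2" for \<xi> a
      proof -
        have a: "0 \<le> a" using \<xi> norm_ge_zero order_trans by blast
        have V: "0 \<le> V I" "0 \<le> V J" using V_nonneg I(1) J(1) by auto
        let ?a = "B a (d - c) (V I)"
        have comp: "B ?a (k - d) (V J) \<le> B a (k - c) (V (I \<union> J))"
        proof -
          have "(\<epsilon>\<^sub>1 * (k - d) + V J) * 1 \<le> (\<epsilon>\<^sub>1 * (k - d) + V J) * exp (L * (d - c))"
            using V \<epsilon>\<^sub>1 trans(3,4) L0 by (intro mult_left_mono) auto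
          then have "?a + \<epsilon>\<^sub>1 * (k - d) + V J \<le> (a + \<epsilon>\<^sub>1 * (k - c) + V (I \<union> J)) * exp (L * (d - c))"
            unfolding B_def V_Un by (simp add: algebra_simps)
          then have "B ?a (k - d) (V J) \<le> (a + \<epsilon>\<^sub>1 * (k - c) + V (I \<union> J)) * exp (L * (d - c)) * exp (L * (k - d))"
            unfolding B_def[of ?a] by (rule mult_right_mono) simp
          also have "\<dots> = B a (k - c) (V (I \<union> J))"
            unfolding B_def by (simp add: mult.assoc algebra_simps flip: exp_add)
          finally show ?thesis .
        qed
        have a1: "0 \<le> ?a" unfolding B_def using a V \<epsilon>\<^sub>1 trans(3) by simp
        have "?a \<le> B ?a (k - d) (V J)"
          using B_lower[OF a1, of "k - d" "V J"] V \<epsilon>\<^sub>1 trans(4)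
            mult_nonneg_nonneg[OF \<epsilon>\<^sub>1, of "k - d"] by linarith
        then have "?a \<le> 1/2" using comp small by linarith
        then obtain y where y: "polygonal_sol F \<epsilon> c d y" "y c = \<xi>" "norm (y d - x d) \<le> ?a"
          using I(2)[OF \<xi>] by blast
        obtain z where z: "polygonal_sol F \<epsilon> d k z" "z d = y d" "norm (z k - x k) \<le> B ?a (k - d) (V J)"
          using J(2)[OF y(3)] comp small by auto
        let ?w = "\<lambda>s. if s \<le> d then y s else z s"
        have "polygonal_sol F \<epsilon> c k ?w"
          by (rule polygonal_sol_glue[OF y(1) z(1) trans(3,4)]) (simp add: z(2))
        moreover have "?w c = \<xi>" using y(2) trans(3) by simp
        moreover have "?w k = z k" using trans(4) z(2) by auto
        then have "norm (?w k - x k) \<le> B a (k - c) (V (I \<union> J))" using z(3) comp by simp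
        ultimately show ?thesis by blast
      qed
      ultimately show "Q c k" unfolding Q_def by blast
    qed
  next
    case (local t)
    have near: "norm \<xi> \<le> R + 1/2" if "norm (\<xi> - x c) \<le> 1/2" "c \<in> {0..b}" for \<xi> c
      using that R[of c] norm_triangle_sub[of \<xi> "x c"] by simp
    have e_le: "a \<le> 1/2" if "B a (d - c) v \<le> 1/2" "0 \<le> a" "c \<le> d" "0 \<le> v" for a c d v
      using B_lower[of a "d - c" v] that mult_nonneg_nonneg[OF \<epsilon>\<^sub>1, of "d - c"] by simp
    have good0: "good c d {}" for c d unfolding good_def by (simp add: \<mu>_nonneg)
    have V0: "V {} = 0" unfolding V_def by simp
    show ?case
    proof (cases "t \<in> N")
      case False
      then obtain v where v: "v \<in> F (x t)" "(x has_vector_derivative v) (at t within {0..b})"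
        using deriv[of t] local by auto
      then obtain \<delta>\<^sub>t where \<delta>\<^sub>t: "0 < \<delta>\<^sub>t" "\<And>s. s \<in> {0..b} \<Longrightarrow> norm (s - t) < \<delta>\<^sub>t \<Longrightarrow>
          norm (x s - x t - (s - t) *\<^sub>R v) \<le> e * norm (s - t)"
        using \<open>0 < e\<close> unfolding has_vector_derivative_def has_derivative_within_alt by metis
      have "P c d" if cd: "c \<le> t" "t \<le> d" "d - c < min \<delta>\<^sub>t h" for c d
        unfolding P_def
      proof (intro impI)
        assume "0 \<le> c" "d \<le> b"
        then have mem: "c \<in> {0..b}" "d \<in> {0..b}" "t \<in> {0..b}" using cd by auto
        have "\<exists>y. polygonal_sol F \<epsilon> c d y \<and> y c = \<xi> \<and> norm (y d - x d) \<le> B a (d - c) (V {})"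
          if \<xi>: "norm (\<xi> - x c) \<le> a" and small: "B a (d - c) (V {}) \<le> 1/2" for \<xi> a
        proof -
          have a: "0 \<le> a" using \<xi> norm_ge_zero order_trans by blast
          then have "a \<le> 1/2" using e_le[OF small] cd V0 by simp
          then have \<xi>R: "norm \<xi> \<le> R + 1/2" using near[of \<xi> c] \<xi> mem(1) by linarith
          have tR: "x t \<in> cball 0 (R + 1)" using R[OF mem(3)] by simp
          obtain w where w: "w \<in> F \<xi>" "norm (v - w) \<le> L * norm (x t - \<xi>)"
            using lip tR \<xi>R v(1) unfolding sv_lipschitz_on_def by fastforce
          have "dist (x c) (x t) < e"
            using mem cd h(2) by (intro h\<^sub>0(2)) (auto simp: dist_real_def)
          then have "norm (x t - \<xi>) \<le> a + e"
            using \<xi> norm_triangle_ineq[of "x t - x c" "x c - \<xi>"] by (simp add: dist_norm norm_minus_commute)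
          then have vw: "norm (v - w) \<le> L * (a + e)"
            using w(2) mult_left_mono[OF _ L0] order_trans by blast
          \<comment> \<open>The derivative is taken at \<open>t\<close>, inside the interval, so the
            increment from \<open>c\<close> to \<open>d\<close> is split there and leaves two
            remainders.\<close>
          define r where "r s = x s - x t - (s - t) *\<^sub>R v" for s
          have r: "norm (r c) \<le> e * (t - c)" "norm (r d) \<le> e * (d - t)"
            unfolding r_def using \<delta>\<^sub>t(2)[of c] \<delta>\<^sub>t(2)[of d] mem cd by auto
          have "(\<xi> + (d - c) *\<^sub>R w) - x d = (\<xi> - x c) + (d - c) *\<^sub>R (w - v) + r c - r d"
            unfolding r_def by (simp add: algebra_simps)
          then have "norm ((\<xi> + (d - c) *\<^sub>R w) - x d) \<le>
              norm (\<xi> - x c) + norm ((d - c) *\<^sub>R (w - v)) + norm (r c) + norm (r d)"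
            by (metis (no_types, lifting) add_mono norm_triangle_le norm_triangle_le_diff order_refl)
          also have "\<dots> \<le> a + (d - c) * (L * (a + e)) + e * (t - c) + e * (d - t)"
            using \<xi> r cd mult_left_mono[OF vw, of "d - c"] by (simp add: norm_minus_commute)
          also have "\<dots> = a + (d - c) * (\<epsilon>\<^sub>1 + L * a)"
            unfolding \<epsilon>\<^sub>1_def by (simp add: algebra_simps)
          also have "\<dots> \<le> (a + \<epsilon>\<^sub>1 * (d - c)) * exp (L * (d - c))"
            using a \<epsilon>\<^sub>1 L0 cd by (intro gronwall_factor_step) auto
          also have "\<dots> = B a (d - c) (V {})" unfolding B_def V0 by simp
          finally have "norm ((\<xi> + (d - c) *\<^sub>R w) - x d) \<le> B a (d - c) (V {})" .
          moreover have "polygonal_sol F \<epsilon> c d (\<lambda>s. \<xi> + (s - c) *\<^sub>R w)"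
            by (rule linear[OF \<xi>R w(1)]) (use cd in simp)
          ultimately show ?thesis by (intro exI[of _ "\<lambda>s. \<xi> + (s - c) *\<^sub>R w"]) simp
        qed
        then show "Q c d" unfolding Q_def using good0 by blast
      qed
      then show ?thesis using \<delta>\<^sub>t(1) h(1) by (intro exI[of _ "min \<delta>\<^sub>t h"]) auto
    next
      case True
      then obtain \<delta>\<^sub>t where \<delta>\<^sub>t: "0 < \<delta>\<^sub>t" "ball t \<delta>\<^sub>t \<subseteq> G" using G(1,2) open_contains_ball by blast
      have "P c d" if cd: "c \<le> t" "t \<le> d" "d - c < min \<delta>\<^sub>t h" for c d
        unfolding P_def
      proof (intro impI)
        assume "0 \<le> c" "d \<le> b"
        then have mem: "c \<in> {0..b}" using cd by auto
        define I where "I = (if c < d then {(c, d)} else {})"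
        have VI: "V I = norm (x d - x c) + M * (d - c)" unfolding I_def V_def using cd by (cases "c = d") auto
        have "good c d I"
        proof (cases "c < d")
          case True
          \<comment> \<open>The whole interval lies in \<open>G\<close>, so its length is exactly
            its share of the measure of \<open>G\<close>.\<close>
          have "G \<inter> {c..<d} = {c..<d}" using \<delta>\<^sub>t(2) cd by (auto simp: subset_iff dist_real_def)
          then have "\<mu> c d = d - c" unfolding \<mu>_def using cd by simp
          then show ?thesis unfolding good_def I_def using True by simp
        qed (simp add: I_def good0)
        moreover have "\<exists>y. polygonal_sol F \<epsilon> c d y \<and> y c = \<xi> \<and> norm (y d - x d) \<le> B a (d - c) (V I)"
          if \<xi>: "norm (\<xi> - x c) \<le> a" and small: "B a (d - c) (V I) \<le> 1/2" for \<xi> a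
        proof -
          have a: "0 \<le> a" using \<xi> norm_ge_zero order_trans by blast
          have V: "0 \<le> V I" unfolding VI using cd \<open>0 \<le> M\<close> by simp
          have "a \<le> 1/2" using e_le[OF small a _ V] cd by simp
          then have \<xi>R: "norm \<xi> \<le> R + 1/2" using near[of \<xi> c] \<xi> mem(1) by linarith
          obtain w where w: "w \<in> F \<xi>" using ne by blast
          have "norm w \<le> M" using bound[OF _ w] \<xi>R by simp
          then have "norm ((d - c) *\<^sub>R w) \<le> M * (d - c)"
            using cd mult_left_mono[of "norm w" M "d - c"] by (simp add: mult.commute)
          moreover have "(\<xi> + (d - c) *\<^sub>R w) - x d = (\<xi> - x c) + (d - c) *\<^sub>R w - (x d - x c)" by simp
          then have "norm ((\<xi> + (d - c) *\<^sub>R w) - x d) \<le>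
              norm (\<xi> - x c) + norm ((d - c) *\<^sub>R w) + norm (x d - x c)"
            by (metis (no_types, lifting) add_mono norm_triangle_le norm_triangle_le_diff order_refl)
          ultimately have "norm ((\<xi> + (d - c) *\<^sub>R w) - x d) \<le> a + V I"
            unfolding VI using \<xi> by linarith
          also have "\<dots> \<le> B a (d - c) (V I)"
            using B_lower[OF a _ V, of "d - c"] cd mult_nonneg_nonneg[OF \<epsilon>\<^sub>1, of "d - c"] by simp
          finally have "norm ((\<xi> + (d - c) *\<^sub>R w) - x d) \<le> B a (d - c) (V I)" .
          moreover have "polygonal_sol F \<epsilon> c d (\<lambda>s. \<xi> + (s - c) *\<^sub>R w)"
            by (rule linear[OF \<xi>R w(1)]) (use cd in simp)
          ultimately show ?thesis by (intro exI[of _ "\<lambda>s. \<xi> + (s - c) *\<^sub>R w"]) simp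
        qed
        ultimately show "Q c d" unfolding Q_def by blast
      qed
      then show ?thesis using \<delta>\<^sub>t(1) h(1) by (intro exI[of _ "min \<delta>\<^sub>t h"]) auto
    qed
  qed
  then have "Q 0 b" by (simp add: P_def)
  then obtain I where I: "good 0 b I" "\<And>\<xi> a. norm (\<xi> - x 0) \<le> a \<Longrightarrow> B a (b - 0) (V I) \<le> 1/2 \<Longrightarrow>
      \<exists>y. polygonal_sol F \<epsilon> 0 b y \<and> y 0 = \<xi> \<and> norm (y b - x b) \<le> B a (b - 0) (V I)"
    unfolding Q_def by blast
  have "\<mu> 0 b \<le> measure lebesgue G"
    unfolding \<mu>_def using G(3) meas by (intro measure_mono_fmeasurable) auto
  then have len: "(\<Sum>(u, v)\<in>I. v - u) < \<delta>" using I(1) G(4) unfolding good_def by linarith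
  have "(\<Sum>(u, v)\<in>I. norm (x v - x u)) < e"
    using I(1) len \<delta>(2) unfolding good_def by (intro \<delta>\<^sub>0(2)) (auto intro: less_imp_le)
  moreover have "M * (\<Sum>(u, v)\<in>I. v - u) \<le> M * e"
    using len \<delta>(3) \<open>0 \<le> M\<close> by (intro mult_left_mono) auto
  moreover have "V I = (\<Sum>(u, v)\<in>I. norm (x v - x u)) + M * (\<Sum>(u, v)\<in>I. v - u)"
    unfolding V_def by (simp add: sum.distrib sum_distrib_left case_prod_unfold)
  ultimately have "V I \<le> e + M * e" by linarith
  then have "B 0 (b - 0) (V I) \<le> (\<epsilon>\<^sub>1 * b + (e + M * e)) * exp (L * b)"
    unfolding B_def by simp
  also have "\<dots> = (e * \<kappa>) * exp (L * b)" unfolding \<epsilon>\<^sub>1_def \<kappa>_def by (simp add: algebra_simps)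
  finally have "B 0 (b - 0) (V I) \<le> 1/2" using e(2) by simp
  then obtain y where "polygonal_sol F \<epsilon> 0 b y" "y 0 = x 0" "norm (y b - x b) \<le> 1/2"
    using I(2)[of "x 0" 0] by force
  then show ?thesis using that[of y] by simp
qed

section \<open>Time shifts and bounds for exact solutions\<close>

lemma abs_continuous_on_interval_shift:
  assumes "abs_continuous_on_interval (a + k) (b + k) x"
  shows "abs_continuous_on_interval a b (\<lambda>t. x (t + k))"
  unfolding abs_continuous_on_interval_def
proof (intro allI impI)
  fix e :: real assume "0 < e"
  obtain d where d: "0 < d" "\<And>I. finite I \<Longrightarrow> (\<forall>(u, v)\<in>I. a + k \<le> u \<and> u \<le> v \<and> v \<le> b + k) \<Longrightarrow>
      pairwise (\<lambda>p q. disjnt {fst p<..<snd p} {fst q<..<snd q}) I \<Longrightarrow>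
      (\<Sum>(u, v)\<in>I. v - u) < d \<Longrightarrow> (\<Sum>(u, v)\<in>I. norm (x v - x u)) < e"
    using assms[unfolded abs_continuous_on_interval_def, rule_format, OF \<open>0 < e\<close>] by blast
  show "\<exists>\<delta>>0. \<forall>I. finite I \<longrightarrow> (\<forall>(u, v)\<in>I. a \<le> u \<and> u \<le> v \<and> v \<le> b) \<longrightarrow>
      pairwise (\<lambda>p q. disjnt {fst p<..<snd p} {fst q<..<snd q}) I \<longrightarrow>
      (\<Sum>(u, v)\<in>I. v - u) < \<delta> \<longrightarrow> (\<Sum>(u, v)\<in>I. norm (x (v + k) - x (u + k))) < e"
  proof (intro exI[of _ d] conjI allI impI)
    show "0 < d" by fact
    fix I :: "(real \<times> real) set"
    assume I: "finite I" "\<forall>(u, v)\<in>I. a \<le> u \<and> u \<le> v \<and> v \<le> b"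
      "pairwise (\<lambda>p q. disjnt {fst p<..<snd p} {fst q<..<snd q}) I" "(\<Sum>(u, v)\<in>I. v - u) < d"
    define T where "T = (\<lambda>(u, v). (u + k, v + k))"
    have inj: "inj_on T I" unfolding T_def inj_on_def by auto
    have sum: "(\<Sum>p\<in>T ` I. f p) = (\<Sum>p\<in>I. f (T p))" for f :: "real \<times> real \<Rightarrow> real"
      using inj by (simp add: sum.reindex)
    have "(\<Sum>(u, v)\<in>T ` I. norm (x v - x u)) < e"
    proof (rule d(2))
      show "finite (T ` I)" using I(1) by simp
      show "\<forall>(u, v)\<in>T ` I. a + k \<le> u \<and> u \<le> v \<and> v \<le> b + k"
        using I(2) unfolding T_def by auto
      show "pairwise (\<lambda>p q. disjnt {fst p<..<snd p} {fst q<..<snd q}) (T ` I)"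
      proof (rule pairwise_imageI)
        fix p q assume "p \<in> I" "q \<in> I" "p \<noteq> q"
        then have *: "disjnt {fst p<..<snd p} {fst q<..<snd q}" using I(3) unfolding pairwise_def by blast
        have "s - k \<in> {fst p<..<snd p} \<inter> {fst q<..<snd q}"
          if "s \<in> {fst (T p)<..<snd (T p)}" "s \<in> {fst (T q)<..<snd (T q)}" for s
          using that unfolding T_def by (auto split: prod.splits)
        then show "disjnt {fst (T p)<..<snd (T p)} {fst (T q)<..<snd (T q)}"
          using * unfolding disjnt_def by blast
      qed
      show "(\<Sum>(u, v)\<in>T ` I. v - u) < d"
        unfolding sum using I(4) by (simp add: T_def case_prod_unfold)
    qed
    then show "(\<Sum>(u, v)\<in>I. norm (x (v + k) - x (u + k))) < e"
      unfolding sum by (simp add: T_def case_prod_unfold)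
  qed
qed

lemma AE_lebesgue_shift:
  assumes "AE t in lebesgue. P t"
  shows "AE t in lebesgue. P (t + k :: real)"
proof -
  obtain N where N: "\<And>t. t \<in> space lebesgue - N \<Longrightarrow> P t" "N \<in> null_sets lebesgue"
    using AE_E3[OF assms] by blast
  have "(+) (- k) ` N \<in> null_sets lebesgue"
    using N(2) negligible_translation[of N "- k"] by (simp add: negligible_iff_null_sets)
  then have "AE t in lebesgue. t \<notin> (+) (- k) ` N" by (rule AE_not_in)
  then show ?thesis
  proof (rule eventually_mono)
    fix t assume t: "t \<notin> (+) (- k) ` N"
    have "t + k \<notin> N"
    proof
      assume "t + k \<in> N"
      then have "- k + (t + k) \<in> (+) (- k) ` N" by (rule imageI)
      then show False using t by simp
    qed
    then show "P (t + k)" using N(1) by simp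
  qed
qed

text \<open>The inclusion is autonomous; this is what allows the MES estimate to be restarted at a
  later time.\<close>

lemma is_solution_shift:
  assumes sol: "is_solution F \<infinity> x" and "0 \<le> k"
  shows "is_solution F \<infinity> (\<lambda>t. x (t + k))"
proof -
  have "AE t in lebesgue. 0 \<le> t \<longrightarrow>
      (\<exists>v\<in>F (x t). (x has_vector_derivative v) (at t within {0..}))"
    using sol unfolding is_solution_def by (simp add: atLeast_def)
  then have "AE t in lebesgue. 0 \<le> t + k \<longrightarrow>
      (\<exists>v\<in>F (x (t + k)). (x has_vector_derivative v) (at (t + k) within {0..}))"
    by (rule AE_lebesgue_shift)
  then have "AE t in lebesgue. 0 \<le> t \<longrightarrow>
      (\<exists>v\<in>F (x (t + k)). ((\<lambda>t. x (t + k)) has_vector_derivative v) (at t within {0..}))"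
  proof (rule eventually_mono, intro impI)
    fix t assume *: "0 \<le> t + k \<longrightarrow> (\<exists>v\<in>F (x (t + k)). (x has_vector_derivative v) (at (t + k) within {0..}))"
      and "0 \<le> t"
    then obtain v where v: "v \<in> F (x (t + k))" "(x has_vector_derivative v) (at (t + k) within {0..})"
      using \<open>0 \<le> k\<close> by auto
    have "((\<lambda>t. t + k) has_vector_derivative 1) (at t within {0..})"
      by (auto intro!: derivative_eq_intros)
    moreover have "(x has_vector_derivative v) (at (t + k) within (\<lambda>t. t + k) ` {0..})"
      using v(2) by (rule has_vector_derivative_within_subset) (use \<open>0 \<le> k\<close> in auto)
    ultimately have "((x \<circ> (\<lambda>t. t + k)) has_vector_derivative (1 *\<^sub>R v)) (at t within {0..})"
      by (rule vector_diff_chain_within)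
    then show "\<exists>v\<in>F (x (t + k)). ((\<lambda>t. x (t + k)) has_vector_derivative v) (at t within {0..})"
      using v(1) by (auto simp: comp_def)
  qed
  moreover have "abs_continuous_on_interval a b (\<lambda>t. x (t + k))" if "0 \<le> a" "a \<le> b" for a b
    using sol that \<open>0 \<le> k\<close> unfolding is_solution_def by (intro abs_continuous_on_interval_shift) simp
  ultimately show ?thesis unfolding is_solution_def by (simp add: atLeast_def)
qed

text \<open>Nothing extends beyond \<open>\<infinity>\<close>, so a shifted solution is again
  subject to MES without a separate argument for its maximality.\<close>

lemma forward_complete_maximal_solution_iff:
  assumes "forward_complete F"
  shows "(T, x) \<in> maximal_solutions F \<longleftrightarrow> T = \<infinity> \<and> is_solution F \<infinity> x"
  using assms unfolding forward_complete_def maximal_solutions_def by auto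

text \<open>Compactness of \<open>K\<close> leaves finitely many centres with bounded reach. An
  exact solution is shadowed by a polygonal one with the same start, whose end is bounded; the
  shadowing distance adds 1.\<close>

lemma solution_reach_bound:
  fixes F :: "'a::euclidean_space \<Rightarrow> 'a set"
  assumes lip: "locally_lipschitz_setvalued F" and cpt: "\<And>\<xi>. compact (F \<xi>)"
    and ne: "\<And>\<xi>. F \<xi> \<noteq> {}" and complete: "forward_complete F" and "compact K"
  obtains C where "\<And>x t. is_solution F \<infinity> x \<Longrightarrow> x 0 \<in> K \<Longrightarrow> 0 \<le> t \<Longrightarrow> t \<le> T \<Longrightarrow> norm (x t) \<le> C"
proof -
  have "\<exists>\<epsilon> M. 0 < \<epsilon> \<and> (\<forall>y b. 0 \<le> b \<longrightarrow> b \<le> T \<longrightarrow> polygonal_sol F \<epsilon> 0 b y \<longrightarrow>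
      norm (y 0 - \<xi>) \<le> \<epsilon> \<longrightarrow> norm (y b) \<le> M)" for \<xi>
    using forward_complete_imp_reach_bounded[OF lip cpt ne complete, of \<xi> T]
    unfolding reach_bounded_def by blast
  then obtain \<epsilon> M where \<epsilon>: "\<And>\<xi>. 0 < \<epsilon> \<xi>"
    and M: "\<And>\<xi> y b. 0 \<le> b \<Longrightarrow> b \<le> T \<Longrightarrow> polygonal_sol F (\<epsilon> \<xi>) 0 b y \<Longrightarrow>
      norm (y 0 - \<xi>) \<le> \<epsilon> \<xi> \<Longrightarrow> norm (y b) \<le> M \<xi>"
    by metis
  obtain A where A: "A \<subseteq> K" "finite A" "K \<subseteq> (\<Union>\<xi>\<in>A. ball \<xi> (\<epsilon> \<xi>))"
    by (rule compactE_image[OF \<open>compact K\<close>, of K "\<lambda>\<xi>. ball \<xi> (\<epsilon> \<xi>)"]) (use \<epsilon> in auto)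
  \<comment> \<open>\<open>insert 1\<close> covers the case of an empty \<open>A\<close>.\<close>
  define e where "e = Min (insert 1 (\<epsilon> ` A))"
  have e: "0 < e" "\<And>\<xi>. \<xi> \<in> A \<Longrightarrow> e \<le> \<epsilon> \<xi>"
    unfolding e_def using A(2) \<epsilon> by auto
  have "norm (x t) \<le> (\<Sum>\<xi>\<in>A. \<bar>M \<xi>\<bar>) + 1"
    if sol: "is_solution F \<infinity> x" and "x 0 \<in> K" and t: "0 \<le> t" "t \<le> T" for x t
  proof -
    obtain \<xi> where \<xi>: "\<xi> \<in> A" "norm (x 0 - \<xi>) \<le> \<epsilon> \<xi>"
      using A(3) \<open>x 0 \<in> K\<close> by (force simp: dist_norm norm_minus_commute)
    have ac: "abs_continuous_on_interval 0 t x" using sol t(1) unfolding is_solution_def by simp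
    have "AE s in lebesgue. 0 \<le> s \<longrightarrow> (\<exists>v\<in>F (x s). (x has_vector_derivative v) (at s within {0..}))"
      using sol unfolding is_solution_def by (simp add: atLeast_def)
    then obtain N where N: "N \<in> null_sets lebesgue"
      "\<And>s. s \<in> space lebesgue - N \<Longrightarrow> 0 \<le> s \<longrightarrow> (\<exists>v\<in>F (x s). (x has_vector_derivative v) (at s within {0..}))"
      by (rule AE_E3) blast
    have deriv: "\<exists>v\<in>F (x s). (x has_vector_derivative v) (at s within {0..t})" if s: "s \<in> {0..t} - N" for s
    proof -
      obtain v where "v \<in> F (x s)" "(x has_vector_derivative v) (at s within {0..})"
        using N(2)[of s] s by auto
      moreover from this(2) have "(x has_vector_derivative v) (at s within {0..t})"
        by (rule has_vector_derivative_within_subset) auto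
      ultimately show ?thesis by blast
    qed
    have "bounded (x ` {0..t})"
      using abs_continuous_on_interval_imp_continuous_on[OF ac]
      by (intro compact_imp_bounded compact_continuous_image) auto
    \<comment> \<open>\<open>R\<close>, \<open>L\<close> and \<open>B\<close> depend on the
      individual solution. They serve to construct its shadow and do not enter the final
      bound.\<close>
    then obtain R where R: "\<And>s. s \<in> {0..t} \<Longrightarrow> norm (x s) \<le> R" unfolding bounded_iff by blast
    obtain L where L: "sv_lipschitz_on L (cball 0 (R + 1)) F"
      using sv_lipschitz_on_compact[OF lip cpt ne compact_cball] by blast
    obtain B where B: "0 \<le> B" "\<And>p u. p \<in> cball 0 (R + 1) \<Longrightarrow> u \<in> F p \<Longrightarrow> norm u \<le> B"
      using sv_bounded_on_compact[OF lip cpt compact_cball] by blast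
    show ?thesis
    proof (rule polygonal_sol_shadowing[OF L _ B(1) ne ac t(1) N(1) _ _ e(1)])
      show "norm u \<le> B" if "p \<in> cball 0 (R + 1)" "u \<in> F p" for p u by (rule B(2)[OF that])
      show "\<exists>v\<in>F (x s). (x has_vector_derivative v) (at s within {0..t})" if "s \<in> {0..t} - N" for s
        by (rule deriv[OF that])
      show "norm (x s) \<le> R" if "s \<in> {0..t}" for s by (rule R[OF that])
      fix y assume y: "polygonal_sol F e 0 t y" "y 0 = x 0" "norm (y t - x t) \<le> 1"
      have "norm (y t) \<le> M \<xi>"
        using \<xi> y t by (intro M polygonal_sol_mono[OF y(1) e(2)]) auto
      moreover have "\<bar>M \<xi>\<bar> \<le> (\<Sum>\<xi>\<in>A. \<bar>M \<xi>\<bar>)" using A(2) \<xi>(1) by (intro member_le_sum) auto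
      ultimately show "norm (x t) \<le> (\<Sum>\<xi>\<in>A. \<bar>M \<xi>\<bar>) + 1"
        using y(3) norm_triangle_sub[of "x t" "y t"] by (simp add: norm_minus_commute)
    qed
  qed
  then show ?thesis using that by blast
qed

section \<open>From MES to SIT\<close>

lemma class_K_mono:
  assumes "class_K \<alpha>" "0 \<le> s" "s \<le> s'"
  shows "\<alpha> s \<le> \<alpha> s'"
  using assms strict_mono_onD[of "{0..}" \<alpha> s s'] unfolding class_K_def by (cases "s = s'") auto

lemma class_K_nonneg:
  assumes "class_K \<alpha>" "0 \<le> s"
  shows "0 \<le> \<alpha> s"
  using class_K_mono[OF assms(1) order_refl assms(2)] assms(1) unfolding class_K_def by simp

text \<open>Averaging \<^term>\<open>\<lambda>s. \<phi> s t\<close> over \<^term>\<open>{s..s+1}\<close> makes it continuous but destroys the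
  value 0 at 0; the geometric mean with \<^term>\<open>\<alpha>\<close> restores it.\<close>

lemma class_KL_majorant:
  fixes \<phi> :: "real \<Rightarrow> real \<Rightarrow> real"
  assumes \<alpha>: "class_K \<alpha>"
    and nonneg: "\<And>s t. 0 \<le> s \<Longrightarrow> 0 \<le> t \<Longrightarrow> 0 \<le> \<phi> s t"
    and le: "\<And>s t. 0 \<le> s \<Longrightarrow> 0 \<le> t \<Longrightarrow> \<phi> s t \<le> \<alpha> s"
    and mono: "\<And>s s' t. 0 \<le> s \<Longrightarrow> s \<le> s' \<Longrightarrow> 0 \<le> t \<Longrightarrow> \<phi> s t \<le> \<phi> s' t"
    and anti: "\<And>s t t'. 0 \<le> s \<Longrightarrow> 0 \<le> t \<Longrightarrow> t \<le> t' \<Longrightarrow> \<phi> s t' \<le> \<phi> s t"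
    and lim: "\<And>s. 0 \<le> s \<Longrightarrow> (\<phi> s \<longlongrightarrow> 0) at_top"
  obtains \<beta> where "class_KL \<beta>" "\<And>s t. 0 \<le> s \<Longrightarrow> 0 \<le> t \<Longrightarrow> \<phi> s t \<le> \<beta> s t"
proof -
  \<comment> \<open>The window lies to the right of \<open>s\<close>, so monotonicity gives
    \<open>\<phi> s t \<le> \<psi> s t \<le> \<phi> (s + 1) t\<close>: domination on one side, decay
    in \<open>t\<close> on the other.\<close>
  define \<psi> where "\<psi> s t = integral {s..s + 1} (\<lambda>r. \<phi> r t)" for s t
  \<comment> \<open>The summand \<open>s * exp (- t)\<close> supplies strict monotonicity in
    \<open>s\<close> and vanishes as \<open>t\<close> grows.\<close>
  define \<beta> where "\<beta> s t = sqrt (\<alpha> s * \<psi> s t) + s * exp (- t)" for s t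
  have int: "(\<lambda>r. \<phi> r t) integrable_on {a..b}" if "0 \<le> a" "0 \<le> t" for a b t
    using that mono by (intro integrable_on_mono_on mono_onI) auto
  have const: "integral {a..b} (\<lambda>_. c) = (b - a) * c" if "a \<le> b" for a b c :: real
    using that by simp
  have lower: "\<phi> s t \<le> \<psi> s t" if "0 \<le> s" "0 \<le> t" for s t
  proof -
    have "integral {s..s + 1} (\<lambda>_. \<phi> s t) \<le> \<psi> s t"
      unfolding \<psi>_def using that mono int by (intro integral_le) auto
    then show ?thesis by simp
  qed
  have upper: "\<psi> s t \<le> \<phi> (s + 1) t" if "0 \<le> s" "0 \<le> t" for s t
  proof -
    have "\<psi> s t \<le> integral {s..s + 1} (\<lambda>_. \<phi> (s + 1) t)"
      unfolding \<psi>_def using that mono int by (intro integral_le) auto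
    then show ?thesis by simp
  qed
  have \<psi>_nonneg: "0 \<le> \<psi> s t" if "0 \<le> s" "0 \<le> t" for s t
    using lower nonneg that order_trans by blast
  have \<psi>_mono: "\<psi> s t \<le> \<psi> s' t" if "0 \<le> s" "s \<le> s'" "0 \<le> t" for s s' t
  proof -
    \<comment> \<open>Translating the later window onto the earlier one reduces the claim to a
      comparison of integrands.\<close>
    have "\<psi> s' t = integral {s..s + 1} ((\<lambda>r. \<phi> r t) \<circ> (+) (s' - s))"
      unfolding \<psi>_def integral_shift_Icc_real by (simp add: algebra_simps)
    moreover have "\<psi> s t \<le> integral {s..s + 1} ((\<lambda>r. \<phi> r t) \<circ> (+) (s' - s))"
      unfolding \<psi>_def
    proof (rule integral_le)
      show "(\<lambda>r. \<phi> r t) integrable_on {s..s + 1}" using int that by blast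
      show "(\<lambda>r. \<phi> r t) \<circ> (+) (s' - s) integrable_on {s..s + 1}"
        using that mono by (intro integrable_on_mono_on mono_onI) auto
      show "\<phi> r t \<le> ((\<lambda>r. \<phi> r t) \<circ> (+) (s' - s)) r" if "r \<in> {s..s + 1}" for r
        using that \<open>0 \<le> s\<close> \<open>s \<le> s'\<close> \<open>0 \<le> t\<close> mono by auto
    qed
    ultimately show ?thesis by simp
  qed
  have \<psi>_anti: "\<psi> s t' \<le> \<psi> s t" if "0 \<le> s" "0 \<le> t" "t \<le> t'" for s t t'
    unfolding \<psi>_def using that anti int by (intro integral_le) auto
  have \<psi>_lim: "(\<psi> s \<longlongrightarrow> 0) at_top" if "0 \<le> s" for s
  proof (rule tendsto_sandwich)
    show "\<forall>\<^sub>F t in at_top. 0 \<le> \<psi> s t"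
      using eventually_ge_at_top[of 0] \<psi>_nonneg[OF that] by (rule eventually_mono)
    show "\<forall>\<^sub>F t in at_top. \<psi> s t \<le> \<phi> (s + 1) t"
      using eventually_ge_at_top[of 0] upper[OF that] by (rule eventually_mono)
    show "(\<phi> (s + 1) \<longlongrightarrow> 0) at_top" using lim that by simp
  qed simp
  have \<psi>_cont: "continuous_on {0..} (\<lambda>s. \<psi> s t)" if "0 \<le> t" for t
  proof -
    define \<Phi> where "\<Phi> s = integral {0..s} (\<lambda>r. \<phi> r t)" for s
    have \<Phi>_cont: "continuous_on {0..} \<Phi>"
      unfolding continuous_on_eq_continuous_within
    proof
      fix s :: real assume "s \<in> {0..}"
      have "continuous_on {0..s + 1} \<Phi>"
        unfolding \<Phi>_def using int that by (intro indefinite_integral_continuous_1) auto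
      then have "continuous (at s within {0..s + 1}) \<Phi>"
        using \<open>s \<in> {0..}\<close> by (auto simp: continuous_on_eq_continuous_within)
      moreover have "at s within {0..} = at s within {0..s + 1}"
        by (rule at_within_nhd[of s "{..<s + 1}"]) auto
      ultimately show "continuous (at s within {0..}) \<Phi>" by simp
    qed
    have "continuous_on {0..} (\<lambda>s. \<Phi> (s + 1) - \<Phi> s)"
    proof (intro continuous_intros)
      show "continuous_on {0..} (\<lambda>s. \<Phi> (s + 1))"
        by (rule continuous_on_compose2[OF \<Phi>_cont]) (auto intro: continuous_intros)
    qed (rule \<Phi>_cont)
    moreover have "\<Phi> (s + 1) - \<Phi> s = \<psi> s t" if "s \<in> {0..}" for s
    proof -
      have "integral {0..s} (\<lambda>r. \<phi> r t) + integral {s..s + 1} (\<lambda>r. \<phi> r t) = integral {0..s + 1} (\<lambda>r. \<phi> r t)"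
        using that \<open>0 \<le> t\<close> int by (intro Henstock_Kurzweil_Integration.integral_combine) auto
      then show ?thesis unfolding \<Phi>_def \<psi>_def by linarith
    qed
    ultimately show ?thesis by (metis (no_types, lifting) continuous_on_cong)
  qed
  have "class_K (\<lambda>s. \<beta> s t)" if "0 \<le> t" for t
    unfolding class_K_def
  proof (intro conjI allI impI)
    show "continuous_on {0..} (\<lambda>s. \<beta> s t)"
      unfolding \<beta>_def using \<alpha> \<psi>_cont[OF that] unfolding class_K_def by (intro continuous_intros) auto
    have strict: "\<beta> s t < \<beta> s' t" if "0 \<le> s" "s < s'" for s s'
      unfolding \<beta>_def using that \<open>0 \<le> t\<close> class_K_mono[OF \<alpha>] class_K_nonneg[OF \<alpha>] \<psi>_mono \<psi>_nonneg
      by (intro add_le_less_mono real_sqrt_le_mono mult_mono) auto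
    then show "strict_mono_on {0..} (\<lambda>s. \<beta> s t)" by (intro strict_mono_onI) auto
    show zero: "\<beta> 0 t = 0" unfolding \<beta>_def using \<alpha> by (simp add: class_K_def)
    show "0 < \<beta> s t" if "0 < s" for s using strict[of 0 s] zero that by simp
  qed
  moreover have "antimono_on {0..} (\<beta> s)" if "0 \<le> s" for s
    unfolding \<beta>_def using that \<psi>_anti class_K_nonneg[OF \<alpha>]
    by (intro monotone_onI add_mono real_sqrt_le_mono mult_left_mono) auto
  moreover have "(\<beta> s \<longlongrightarrow> 0) at_top" if "0 \<le> s" for s
  proof -
    have "((\<lambda>t. exp (- t)) \<longlongrightarrow> (0::real)) at_top"
      using exp_at_bot filterlim_uminus_at_bot_at_top by (rule filterlim_compose)
    then have "((\<lambda>t. sqrt (\<alpha> s * \<psi> s t) + s * exp (- t)) \<longlongrightarrow> sqrt (\<alpha> s * 0) + s * 0) at_top"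
      using \<psi>_lim[OF that] by (intro tendsto_intros)
    then show ?thesis unfolding \<beta>_def by simp
  qed
  ultimately have "class_KL \<beta>" unfolding class_KL_def by blast
  moreover have "\<phi> s t \<le> \<beta> s t" if st: "0 \<le> s" "0 \<le> t" for s t
  proof -
    \<comment> \<open>One factor is bounded by \<open>\<alpha> s\<close>, the other by
      \<open>\<psi> s t\<close>.\<close>
    have "\<phi> s t * \<phi> s t \<le> \<alpha> s * \<psi> s t"
      using st nonneg le lower class_K_nonneg[OF \<alpha>] by (intro mult_mono) auto
    then have "\<phi> s t \<le> sqrt (\<alpha> s * \<psi> s t)" by (intro real_le_rsqrt) (simp add: power2_eq_square)
    moreover have "0 \<le> s * exp (- t)" using st by simp
    ultimately show ?thesis unfolding \<beta>_def by linarith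
  qed
  ultimately show ?thesis using that by blast
qed

lemma locally_lipschitz_imp_continuous_on:
  assumes "locally_lipschitz f"
  shows "continuous_on S f"
proof (rule continuous_at_imp_continuous_on, rule ballI)
  fix \<xi>
  obtain U L where U: "open U" "\<xi> \<in> U" "L-lipschitz_on U f"
    using assms unfolding locally_lipschitz_def by blast
  then have "continuous_on U f" by (intro lipschitz_on_continuous_on)
  then show "isCont f \<xi>" using U(1,2) by (simp add: continuous_on_eq_continuous_at)
qed

lemma is_solution_continuous_on:
  assumes "is_solution F \<infinity> x" "0 \<le> a"
  shows "continuous_on {a..b} x"
proof (cases "a \<le> b")
  case True
  then show ?thesis
    using assms unfolding is_solution_def by (intro abs_continuous_on_interval_imp_continuous_on) auto
qed simp

theorem lemma5p1:
  fixes F :: "real ^ 'n \<Rightarrow> (real ^ 'n) set"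
    and h :: "real ^ 'n \<Rightarrow> real ^ 'p"
    and g :: "real ^ 'n \<Rightarrow> real ^ 'q"
    and \<omega> :: "real ^ 'n \<Rightarrow> real"
  assumes "\<And>\<xi>. F \<xi> \<noteq> {}"
    and "\<And>\<xi>. compact (F \<xi>)"
    and "locally_lipschitz_setvalued F"
    and "forward_complete F"
    and "locally_lipschitz h"
    and "locally_lipschitz g"
    and "\<And>\<xi>. 0 \<le> \<omega> \<xi>"
    and "continuous_on UNIV \<omega>"
    and "proper_map euclidean (top_of_set {0..}) \<omega>"
    and "MES F h g \<omega>"
  shows "\<exists>\<rho>. class_K \<rho> \<and> SIT F h g \<omega> \<rho>"
proof -
  obtain \<beta> \<gamma> where \<beta>: "class_KL \<beta>" and \<gamma>: "class_K \<gamma>"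
    and mes: "\<forall>(T, x)\<in>maximal_solutions F. \<forall>t. 0 \<le> t \<longrightarrow> ereal t < T \<longrightarrow>
      norm (h (x t)) \<le> max (\<beta> (\<omega> (x 0)) t) (\<gamma> (SUP s\<in>{0..t}. norm (g (x s))))"
    using \<open>MES F h g \<omega>\<close> unfolding MES_def by blast
  note max_iff = forward_complete_maximal_solution_iff[OF \<open>forward_complete F\<close>]
  have mes': "norm (h (x t)) \<le> max (\<beta> (\<omega> (x 0)) t) (\<gamma> (SUP s\<in>{0..t}. norm (g (x s))))"
    if "is_solution F \<infinity> x" "0 \<le> t" for x t
    using bspec[OF mes, of "(\<infinity>, x)"] max_iff[of \<infinity> x] that by simp
  have \<beta>_K: "class_K (\<lambda>s. \<beta> s t)" if "0 \<le> t" for t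
    using \<beta> that unfolding class_KL_def by blast
  have \<beta>_mono: "\<beta> s t \<le> \<beta> s' t" if "0 \<le> s" "s \<le> s'" "0 \<le> t" for s s' t
    using class_K_mono[OF \<beta>_K] that by blast
  have \<beta>_nonneg: "0 \<le> \<beta> s t" if "0 \<le> s" "0 \<le> t" for s t
    using class_K_nonneg[OF \<beta>_K] that by blast
  have \<beta>_anti: "\<beta> s t' \<le> \<beta> s t" if "0 \<le> s" "0 \<le> t" "t \<le> t'" for s t t'
  proof -
    have "antimono_on {0..} (\<beta> s)" using \<beta> that(1) unfolding class_KL_def by blast
    from monotone_onD[OF this, of t t'] show ?thesis using that by simp
  qed
  have \<beta>_lim: "(\<beta> s \<longlongrightarrow> 0) at_top" if "0 \<le> s" for s
    using \<beta> that unfolding class_KL_def by blast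
  define \<rho> where "\<rho> s = 2 * \<gamma> s" for s
  have \<rho>: "class_K \<rho>"
    using \<gamma> unfolding class_K_def \<rho>_def by (auto intro!: continuous_intros simp: strict_mono_on_def)
  \<comment> \<open>The gain condition holds only up to \<open>t\<^sub>1\<close>. All estimates
    below are uniform in \<open>t\<^sub>1\<close>, since SIT asks for a single KL function.\<close>
  define detectable where "detectable x t\<^sub>1 \<longleftrightarrow> is_solution F \<infinity> x \<and> 0 < t\<^sub>1 \<and>
      (\<forall>t\<in>{0..t\<^sub>1}. norm (h (x t)) > \<rho> (norm (g (x t))))" for x and t\<^sub>1 :: real
  have restart: "norm (h (x t)) \<le> max (\<beta> (\<omega> (x r)) (t - r)) (S / 2)"
    if x: "detectable x t\<^sub>1" and t: "0 \<le> r" "r \<le> t" "t \<le> t\<^sub>1"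
      and S: "\<And>s. s \<in> {r..t} \<Longrightarrow> norm (h (x s)) \<le> S" for x r t t\<^sub>1 S
  proof -
    have sol: "is_solution F \<infinity> x" using x unfolding detectable_def by blast
    have "norm (h (x (t - r + r))) \<le> max (\<beta> (\<omega> (x (0 + r))) (t - r)) (\<gamma> (SUP s\<in>{0..t - r}. norm (g (x (s + r)))))"
      using mes'[OF is_solution_shift[OF sol t(1)], of "t - r"] t(2) by simp
    moreover have "\<gamma> (SUP s\<in>{0..t - r}. norm (g (x (s + r)))) \<le> S / 2"
    proof -
      have "continuous_on {0..t - r} (\<lambda>s. norm (g (x (s + r))))"
        by (intro continuous_on_norm continuous_on_compose2[OF
              locally_lipschitz_imp_continuous_on[OF \<open>locally_lipschitz g\<close>]
              is_solution_continuous_on[OF is_solution_shift[OF sol t(1)] order_refl] subset_UNIV])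
      \<comment> \<open>By continuity the supremum of the norm of w is attained, so the gain
        inequality can be applied at a maximizing time.\<close>
      then obtain s where s: "s \<in> {0..t - r}" "\<And>s'. s' \<in> {0..t - r} \<Longrightarrow> norm (g (x (s' + r))) \<le> norm (g (x (s + r)))"
        using continuous_attains_sup[of "{0..t - r}" "\<lambda>s. norm (g (x (s + r)))"] t(2) by auto
      then have "(SUP s\<in>{0..t - r}. norm (g (x (s + r)))) = norm (g (x (s + r)))"
        by (intro cSup_eq_maximum) auto
      moreover have "2 * \<gamma> (norm (g (x (s + r)))) < norm (h (x (s + r)))"
        using x s(1) t unfolding detectable_def \<rho>_def by auto
      moreover have "norm (h (x (s + r))) \<le> S" using S s(1) by auto
      ultimately show ?thesis by simp
    qed
    ultimately show ?thesis by auto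
  qed
  have bounded: "norm (h (x t)) \<le> \<beta> (\<omega> (x 0)) 0" if x: "detectable x t\<^sub>1" and t: "0 \<le> t" "t \<le> t\<^sub>1" for x t t\<^sub>1
  proof -
    have "is_solution F \<infinity> x" using x unfolding detectable_def by blast
    then have "continuous_on {0..t\<^sub>1} (\<lambda>s. norm (h (x s)))"
      by (intro continuous_on_norm continuous_on_compose2[OF
            locally_lipschitz_imp_continuous_on[OF \<open>locally_lipschitz h\<close>]
            is_solution_continuous_on[OF _ order_refl] subset_UNIV])
    then obtain s where s: "s \<in> {0..t\<^sub>1}" "\<And>s'. s' \<in> {0..t\<^sub>1} \<Longrightarrow> norm (h (x s')) \<le> norm (h (x s))"
      using continuous_attains_sup[of "{0..t\<^sub>1}" "\<lambda>s. norm (h (x s))"] t by auto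
    \<comment> \<open>Here \<open>S\<close> is the maximum of the output norm on
      \<open>{0..t\<^sub>1}\<close>, attained at \<open>s\<close>. In the second alternative it
      would be at most half of itself, hence at most 0.\<close>
    have "norm (h (x s)) \<le> max (\<beta> (\<omega> (x 0)) (s - 0)) (norm (h (x s)) / 2)"
      using s by (intro restart[OF x]) auto
    moreover have "\<beta> (\<omega> (x 0)) (s - 0) \<le> \<beta> (\<omega> (x 0)) 0"
      using s(1) assms(7) by (intro \<beta>_anti) auto
    moreover have "0 \<le> \<beta> (\<omega> (x 0)) 0" using assms(7) by (intro \<beta>_nonneg) auto
    ultimately have "norm (h (x s)) \<le> \<beta> (\<omega> (x 0)) 0" by linarith
    then show ?thesis using s(2)[of t] t by simp
  qed
  \<comment> \<open>Properness makes the sublevel sets of \<open>\<omega>\<close> compact, the reach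
    bound confines the trajectories to a ball up to time \<open>T\<close>, and continuity bounds
    \<open>\<omega>\<close> on that ball.\<close>
  have reach: "\<exists>C\<ge>0. \<forall>x. is_solution F \<infinity> x \<longrightarrow> \<omega> (x 0) \<le> r \<longrightarrow> \<omega> (x T) \<le> C" if "0 \<le> T" for r T
  proof -
    have "compactin euclidean {\<xi> \<in> topspace euclidean. \<omega> \<xi> \<in> {0..r}}"
      by (rule compactin_proper_map_preimage[OF assms(9)]) (auto simp: compactin_subtopology)
    then have "compact {\<xi>. \<omega> \<xi> \<in> {0..r}}" by simp
    then obtain C where C: "\<And>x t. is_solution F \<infinity> x \<Longrightarrow> x 0 \<in> {\<xi>. \<omega> \<xi> \<in> {0..r}} \<Longrightarrow>
        0 \<le> t \<Longrightarrow> t \<le> T \<Longrightarrow> norm (x t) \<le> C"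
      by (rule solution_reach_bound[OF assms(3,2,1,4), of _ T]) blast
    have "bounded (\<omega> ` cball 0 C)"
      using assms(8) by (intro compact_imp_bounded compact_continuous_image) (auto intro: continuous_on_subset)
    then obtain B where B: "\<And>\<xi>. \<xi> \<in> cball 0 C \<Longrightarrow> norm (\<omega> \<xi>) \<le> B" unfolding bounded_iff by blast
    have "\<omega> (x T) \<le> max B 0" if "is_solution F \<infinity> x" "\<omega> (x 0) \<le> r" for x
      using B[of "x T"] C[of x T] that assms(7) \<open>0 \<le> T\<close> by fastforce
    then show ?thesis by (intro exI[of _ "max B 0"]) auto
  qed
  \<comment> \<open>Each round halves the level. It lasts until \<open>\<beta> C\<close> has fallen
    below the fixed \<open>\<epsilon>\<close>, where \<open>C\<close> bounds \<open>\<omega>\<close>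
    at the start of the round, so its length is the same for all trajectories. Without
    \<open>\<epsilon>\<close> in the maximum the first MES term could not be absorbed.\<close>
  have attract: "\<exists>T\<ge>0. \<forall>x t\<^sub>1 t. detectable x t\<^sub>1 \<longrightarrow> \<omega> (x 0) \<le> r \<longrightarrow> T \<le> t \<longrightarrow> t \<le> t\<^sub>1 \<longrightarrow>
      norm (h (x t)) \<le> max \<epsilon> ((1/2)^k * \<beta> r 0)" if "0 < \<epsilon>" "0 \<le> r" for \<epsilon> r k
  proof (induction k)
    case 0
    have "norm (h (x t)) \<le> \<beta> r 0" if "detectable x t\<^sub>1" "\<omega> (x 0) \<le> r" "0 \<le> t" "t \<le> t\<^sub>1" for x t\<^sub>1 t
      using bounded[OF that(1,3,4)] \<beta>_mono[of "\<omega> (x 0)" r 0] assms(7) that(2) by force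
    then show ?case by (intro exI[of _ 0]) (auto simp: le_max_iff_disj)
  next
    case (Suc k)
    then obtain T where T: "0 \<le> T" "\<And>x t\<^sub>1 t. detectable x t\<^sub>1 \<Longrightarrow> \<omega> (x 0) \<le> r \<Longrightarrow> T \<le> t \<Longrightarrow> t \<le> t\<^sub>1 \<Longrightarrow>
      norm (h (x t)) \<le> max \<epsilon> ((1/2)^k * \<beta> r 0)" by blast
    obtain C where C: "0 \<le> C" "\<And>x. is_solution F \<infinity> x \<Longrightarrow> \<omega> (x 0) \<le> r \<Longrightarrow> \<omega> (x T) \<le> C"
      using reach[OF T(1)] by blast
    have "\<forall>\<^sub>F t in at_top. \<beta> C t < \<epsilon>" using \<beta>_lim[OF C(1)] \<open>0 < \<epsilon>\<close> by (rule order_tendstoD)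
    then obtain \<tau>\<^sub>0 where \<tau>\<^sub>0: "\<And>t. \<tau>\<^sub>0 \<le> t \<Longrightarrow> \<beta> C t < \<epsilon>" unfolding eventually_at_top_linorder by blast
    define \<tau> where "\<tau> = max \<tau>\<^sub>0 0"
    have "norm (h (x t)) \<le> max \<epsilon> ((1/2)^Suc k * \<beta> r 0)"
      if x: "detectable x t\<^sub>1" "\<omega> (x 0) \<le> r" and t: "T + \<tau> \<le> t" "t \<le> t\<^sub>1" for x t\<^sub>1 t
    proof -
      have *: "T \<le> t" using t(1) unfolding \<tau>_def by linarith
      have "norm (h (x t)) \<le> max (\<beta> (\<omega> (x T)) (t - T)) (max \<epsilon> ((1/2)^k * \<beta> r 0) / 2)"
        using T(2)[OF x] t by (intro restart[OF x(1) T(1) * t(2)]) auto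
      moreover have "\<beta> (\<omega> (x T)) (t - T) \<le> \<beta> C (t - T)"
        using C(2) x assms(7) * unfolding detectable_def by (intro \<beta>_mono) auto
      moreover have "\<beta> C (t - T) < \<epsilon>" using t(1) unfolding \<tau>_def by (intro \<tau>\<^sub>0) linarith
      moreover have "max \<epsilon> ((1/2)^k * \<beta> r 0) / 2 \<le> max \<epsilon> ((1/2)^Suc k * \<beta> r 0)"
        using \<open>0 < \<epsilon>\<close> by (auto simp: max_def)
      ultimately show ?thesis by linarith
    qed
    then show ?case using T(1) unfolding \<tau>_def by (intro exI[of _ "T + max \<tau>\<^sub>0 0"]) auto
  qed
  \<comment> \<open>The inserted 0 keeps the set nonempty when no trajectory qualifies. Admitting
    all later times and all smaller initial values makes the supremum decreasing in \<open>t\<close>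
    and increasing in \<open>r\<close>.\<close>
  define A where "A r t = insert 0 {norm (h (x s)) |x s t\<^sub>1. detectable x t\<^sub>1 \<and> \<omega> (x 0) \<le> r \<and> t \<le> s \<and> s \<le> t\<^sub>1}"
    for r t :: real
  define \<phi> where "\<phi> r t = Sup (A r t)" for r t
  have A_le: "a \<le> \<beta> r 0" if "a \<in> A r t" "0 \<le> r" "0 \<le> t" for a r t
  proof -
    have "norm (h (x s)) \<le> \<beta> r 0" if "detectable x t\<^sub>1" "\<omega> (x 0) \<le> r" "t \<le> s" "s \<le> t\<^sub>1" for x s t\<^sub>1
      using bounded[OF that(1), of s] \<beta>_mono[of "\<omega> (x 0)" r 0] assms(7) that \<open>0 \<le> t\<close> by force
    then show ?thesis using that \<beta>_nonneg[of r 0] unfolding A_def by auto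
  qed
  have A_bdd: "bdd_above (A r t)" if "0 \<le> r" "0 \<le> t" for r t
    using A_le that by (intro bdd_aboveI) blast
  have A_ne: "A r t \<noteq> {}" "0 \<in> A r t" for r t unfolding A_def by auto
  have A_mono: "A r t \<subseteq> A r' t'" if "r \<le> r'" "t' \<le> t" for r r' t t'
    unfolding A_def using that by (intro insert_mono subsetI) (blast intro: order_trans)
  have \<phi>_mono: "\<phi> r t \<le> \<phi> r' t'" if "0 \<le> r'" "0 \<le> t'" "r \<le> r'" "t' \<le> t" for r r' t t'
    unfolding \<phi>_def using that A_ne A_bdd A_mono by (intro cSup_subset_mono) auto
  obtain \<beta>' where \<beta>': "class_KL \<beta>'" "\<And>s t. 0 \<le> s \<Longrightarrow> 0 \<le> t \<Longrightarrow> \<phi> s t \<le> \<beta>' s t"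
  proof (rule class_KL_majorant[of "\<lambda>s. \<beta> s 0" \<phi>])
    show "class_K (\<lambda>s. \<beta> s 0)" by (rule \<beta>_K) simp
    show "0 \<le> \<phi> s t" if "0 \<le> s" "0 \<le> t" for s t
      unfolding \<phi>_def using A_ne(2) A_bdd[OF that] by (rule cSup_upper)
    show "\<phi> s t \<le> \<beta> s 0" if "0 \<le> s" "0 \<le> t" for s t
      unfolding \<phi>_def using A_ne(1) A_le that by (intro cSup_least) auto
    show "\<phi> s t \<le> \<phi> s' t" if "0 \<le> s" "s \<le> s'" "0 \<le> t" for s s' t
      using that by (intro \<phi>_mono) auto
    show "\<phi> s t' \<le> \<phi> s t" if "0 \<le> s" "0 \<le> t" "t \<le> t'" for s t t'
      using that by (intro \<phi>_mono) auto
    show "(\<phi> r \<longlongrightarrow> 0) at_top" if "0 \<le> r" for r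
    proof (rule tendstoI)
      fix \<epsilon> :: real assume "0 < \<epsilon>"
      have "(\<lambda>k. (1/2)^k * \<beta> r 0) \<longlonglongrightarrow> 0 * \<beta> r 0"
        by (intro tendsto_intros LIMSEQ_power_zero) simp
      then have "\<forall>\<^sub>F k in sequentially. (1/2)^k * \<beta> r 0 < \<epsilon> / 2"
        using \<open>0 < \<epsilon>\<close> by (intro order_tendstoD(2)) auto
      then obtain k where k: "(1/2)^k * \<beta> r 0 < \<epsilon> / 2" unfolding eventually_sequentially by blast
      obtain T where T: "0 \<le> T" "\<And>x t\<^sub>1 t. detectable x t\<^sub>1 \<Longrightarrow> \<omega> (x 0) \<le> r \<Longrightarrow> T \<le> t \<Longrightarrow> t \<le> t\<^sub>1 \<Longrightarrow>
          norm (h (x t)) \<le> max (\<epsilon> / 2) ((1/2)^k * \<beta> r 0)"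
        using attract[OF half_gt_zero[OF \<open>0 < \<epsilon>\<close>] \<open>0 \<le> r\<close>, of k] by blast
      have "dist (\<phi> r t) 0 < \<epsilon>" if "T \<le> t" for t
      proof -
        have "a \<le> \<epsilon> / 2" if "a \<in> A r t" for a
          using that T(2) k \<open>T \<le> t\<close> \<open>0 < \<epsilon>\<close> unfolding A_def by force
        then have "\<phi> r t \<le> \<epsilon> / 2" unfolding \<phi>_def using A_ne(1) by (intro cSup_least) auto
        moreover have "0 \<le> \<phi> r t"
          unfolding \<phi>_def using \<open>0 \<le> r\<close> \<open>T \<le> t\<close> T(1) by (intro cSup_upper A_ne(2) A_bdd) auto
        ultimately show ?thesis using \<open>0 < \<epsilon>\<close> by simp
      qed
      then show "\<forall>\<^sub>F t in at_top. dist (\<phi> r t) 0 < \<epsilon>" unfolding eventually_at_top_linorder by blast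
    qed
  qed blast
  have "SIT F h g \<omega> \<rho>"
    unfolding SIT_def
  proof (intro exI[of _ \<beta>'] conjI ballI, rule \<beta>'(1), clarify)
    fix T x and t\<^sub>1 t :: real
    assume max: "(T, x) \<in> maximal_solutions F" and "0 < t\<^sub>1"
      and gain: "\<forall>t\<in>{0..t\<^sub>1}. norm (h (x t)) > \<rho> (norm (g (x t)))" and t: "t \<in> {0..t\<^sub>1}"
    then have "detectable x t\<^sub>1" unfolding detectable_def using max_iff by blast
    then have "norm (h (x t)) \<in> A (\<omega> (x 0)) t" unfolding A_def using t by auto
    then have "norm (h (x t)) \<le> \<phi> (\<omega> (x 0)) t"
      unfolding \<phi>_def using t assms(7) by (intro cSup_upper A_bdd) auto
    also have "\<dots> \<le> \<beta>' (\<omega> (x 0)) t" using \<beta>'(2) assms(7) t by simp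
    finally show "norm (h (x t)) \<le> \<beta>' (\<omega> (x 0)) t" .
  qed
  then show ?thesis using \<rho> by blast
qed

end
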